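(* Let $E\subseteq\mathbb{R}^d$ be bounded, let $\phi\in PW_E$, let $\Phi=|\hat\phi|^2$, and let $\{\lambda_k\}_{k\in\mathbb{Z}}$ be a sequence in $\mathbb{R}^d$. Let $\{e_{\lambda_k}\}_{k\in\mathbb{Z}}$ be a frame for $L^2(\operatorname{supp}(\hat\phi))$, and assume there exist $p,P>0$ such that $p\le\Phi\le P$ a.e. on $\operatorname{supp}(\hat\phi)$. Define $\theta_k^\#$ by $$\widehat{\theta_k^\#}=\begin{cases}\dfrac{\hat\phi}{\sqrt{\Phi}}\,e_{\lambda_k}^\# & \text{on }\operatorname{supp}(\Phi),\\ 0&\text{otherwise},\end{cases}$$ where $\{e_{\lambda_k}^\#\}_{k\in\mathbb{Z}}$ denotes the canonical tight frame of $\{e_{\lambda_k}\}_{k\in\mathbb{Z}}$. Then $\{\theta_k^\#\}_{k\in\mathbb{Z}}$ forms a Parseval frame with the same span as $\{T_{\lambda_k}\phi\}_{k\in\mathbb{Z}}$. The frames $\{\theta_k^\#\}_{k\in\mathbb{Z}}$ and $\{T_{\lambda_k}\phi\}_{k\in\mathbb{Z}}$ are equivalent. If $\{e_{\lambda_k}\}_{k\in\mathbb{Z}}$ forms an $A_e$-tight frame, then $\{\theta_k^\#\}_{k\in\mathbb{Z}}$ forms a tight frame of translates with shifts $\lambda_k$ and generator $\frac{1}{A_e}\mathcal{F}^{-1}\frac{\hat\phi}{\sqrt{\Phi}}$.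
   Context: Fourier transform: $\hat f(w)=\mathcal{F}f(w)=\int_{\mathbb{R}^d}f(x)e^{-2\pi i x\cdot w}\,dx$, extended to $L^2(\mathbb{R}^d)$. For $\lambda\in\mathbb{R}^d$: $e_\lambda(x)=e^{-2\pi i\lambda\cdot x}$ and $T_\lambda f(x)=f(x-\lambda)$. For bounded $E\subseteq\mathbb{R}^d$, $L^2(E)$ is identified with the functions in $L^2(\mathbb{R}^d)$ vanishing a.e. outside $E$, and $PW_E=\{f\in L^2(\mathbb{R}^d):\operatorname{supp}(\hat f)\subseteq E\}$. Saying that $\{e_{\lambda_k}\}$ is a frame of $L^2(E)$ means that $\{e_{\lambda_k}\chi_E\}$ is, where $\chi_E$ is the indicator function of $E$. A frame for a Hilbert space $\mathcal{H}$ is a sequence $\{\psi_k\}$ with $A\|f\|^2\le\sum_k|\langle f,\psi_k\rangle|^2\le B\|f\|^2$ for all $f\in\mathcal{H}$ and some $A,B>0$; it is $A$-tight if one can take $B=A$, and Parseval if $A=B=1$. "Span" here means closed linear span, and the frames in the conclusion are frames for their spans. The canonical tight frame of a frame $\{\psi_k\}$ is $\{S^{-1/2}\psi_k\}$, where $Sf=\sum_k\langle f,\psi_k\rangle\psi_k$ and $S^{-1/2}$ is the positive square root of $S^{-1}$. Two frames $\{f_k\}$, $\{g_k\}$ of $\mathcal{H}$ are equivalent if there is a bounded invertible operator $U$ on $\mathcal{H}$ with $Uf_k=g_k$ for all $k$ (equivalently, their analysis operators $f\mapsto\{\langle f,f_k\rangle\}_k$ and $f\mapsto\{\langle f,g_k\rangle\}_k$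 have the same range). The quotient $\hat\phi/\sqrt{\Phi}$ is understood as $0$ outside $\operatorname{supp}(\Phi)$.
   Formalization: The generator is stated with 1/√A_e instead of the printed 1/A_e, which is false for A_e ≠ 1: for φ̂ = χ_[0,1], λ_k = k/2 one has A_e = 2 and θ_k^# = 2^{-1/2} T_{k/2}φ. *)

theory Defs
  imports "HOL-Analysis.Analysis"
begin

(* Elements of L^2(R^d) are represented by square-integrable Borel functions; equality in L^2 is
   equality almost everywhere. *)

definition L2 :: "('a::euclidean_space \<Rightarrow> complex) set" where
  "L2 = {f \<in> borel_measurable lborel. integrable lborel (\<lambda>x. (cmod (f x))\<^sup>2)}"

definition ae_eq :: "('a::euclidean_space \<Rightarrow> complex) \<Rightarrow> ('a \<Rightarrow> complex) \<Rightarrow> bool"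
    (infix "=\<^sub>a\<^sub>e" 50) where
  "f =\<^sub>a\<^sub>e g \<longleftrightarrow> (AE x in lborel. f x = g x)"

definition l2_inner :: "('a::euclidean_space \<Rightarrow> complex) \<Rightarrow> ('a \<Rightarrow> complex) \<Rightarrow> complex" where
  "l2_inner f g = (LINT x|lborel. f x * cnj (g x))"

(* Junk value 0 when f is not square-integrable; only meaningful for f in L2. *)
definition l2_norm :: "('a::euclidean_space \<Rightarrow> complex) \<Rightarrow> real" where
  "l2_norm f = sqrt (LINT x|lborel. (cmod (f x))\<^sup>2)"

definition L2_on :: "'a::euclidean_space set \<Rightarrow> ('a \<Rightarrow> complex) set" where
  "L2_on E = {f \<in> L2. AE x in lborel. x \<notin> E \<longrightarrow> f x = 0}"

definition l2_has_sum ::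
    "('k \<Rightarrow> 'a::euclidean_space \<Rightarrow> complex) \<Rightarrow> ('a \<Rightarrow> complex) \<Rightarrow> bool" where
  "l2_has_sum u g \<longleftrightarrow> (\<forall>k. u k \<in> L2) \<and> g \<in> L2 \<and>
     ((\<lambda>F. l2_norm (\<lambda>x. g x - (\<Sum>k\<in>F. u k x))) \<longlongrightarrow> 0) (finite_subsets_at_top UNIV)"

definition closed_span :: "('k \<Rightarrow> 'a::euclidean_space \<Rightarrow> complex) \<Rightarrow> ('a \<Rightarrow> complex) set" where
  "closed_span \<psi> = {f \<in> L2. \<forall>\<epsilon>>0. \<exists>F c. finite F \<and> l2_norm (\<lambda>x. f x - (\<Sum>k\<in>F. c k * \<psi> k x)) < \<epsilon>}"

definition ft_L1 :: "('a::euclidean_space \<Rightarrow> complex) \<Rightarrow> 'a \<Rightarrow> complex" where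
  "ft_L1 f w = (LINT x|lborel. f x * exp (- 2 * of_real pi * \<i> * of_real (x \<bullet> w)))"

(* The extension to L^2: the closure in L^2 x L^2 of the graph of ft_L1 on L^1 Int L^2. *)
definition has_fourier :: "('a::euclidean_space \<Rightarrow> complex) \<Rightarrow> ('a \<Rightarrow> complex) \<Rightarrow> bool" where
  "has_fourier f g \<longleftrightarrow> f \<in> L2 \<and> g \<in> L2 \<and>
     (\<exists>h. (\<forall>n::nat. h n \<in> L2 \<and> integrable lborel (h n) \<and> ft_L1 (h n) \<in> L2) \<and>
          (\<lambda>n. l2_norm (\<lambda>x. h n x - f x)) \<longlonglongrightarrow> 0 \<and>
          (\<lambda>n. l2_norm (\<lambda>w. ft_L1 (h n) w - g w)) \<longlonglongrightarrow> 0)"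

(* As everywhere below, the choice operator picks a representative of a class of functions modulo
   null sets. *)
definition fourier :: "('a::euclidean_space \<Rightarrow> complex) \<Rightarrow> 'a \<Rightarrow> complex" where
  "fourier f = (SOME g. has_fourier f g)"

definition inv_fourier :: "('a::euclidean_space \<Rightarrow> complex) \<Rightarrow> 'a \<Rightarrow> complex" where
  "inv_fourier g = (SOME f. f \<in> L2 \<and> fourier f =\<^sub>a\<^sub>e g)"

(* For an element of L^2 this set depends on the representative only up to a null set, and it is
   used only in ways insensitive to null sets. *)
definition supp :: "('a \<Rightarrow> 'b::zero) \<Rightarrow> 'a set" where
  "supp f = {x. f x \<noteq> 0}"

(* The inclusion of the support of the Fourier transform in E is understood modulo null sets. *)
definition PW :: "'a::euclidean_space set \<Rightarrow> ('a \<Rightarrow> complex) set" where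
  "PW E = {f \<in> L2. AE w in lborel. w \<in> supp (fourier f) \<longrightarrow> w \<in> E}"

definition expo :: "'a::euclidean_space \<Rightarrow> 'a \<Rightarrow> complex" where
  "expo l x = exp (- 2 * of_real pi * \<i> * of_real (l \<bullet> x))"

definition translate :: "'a::euclidean_space \<Rightarrow> ('a \<Rightarrow> complex) \<Rightarrow> 'a \<Rightarrow> complex" where
  "translate l f x = f (x - l)"

(* In what follows H is a closed subspace of L^2, given as a set of functions closed under
   equality almost everywhere. *)

definition frame_with_bounds :: "real \<Rightarrow> real \<Rightarrow> ('a::euclidean_space \<Rightarrow> complex) set
    \<Rightarrow> ('k \<Rightarrow> 'a \<Rightarrow> complex) \<Rightarrow> bool" where
  "frame_with_bounds A B H \<psi> \<longleftrightarrow> 0 < A \<and> 0 < B \<and> (\<forall>k. \<psi> k \<in> H) \<and>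
     (\<forall>f\<in>H. (\<lambda>k. (cmod (l2_inner f (\<psi> k)))\<^sup>2) summable_on UNIV \<and>
        A * (l2_norm f)\<^sup>2 \<le> (\<Sum>\<^sub>\<infinity>k. (cmod (l2_inner f (\<psi> k)))\<^sup>2) \<and>
        (\<Sum>\<^sub>\<infinity>k. (cmod (l2_inner f (\<psi> k)))\<^sup>2) \<le> B * (l2_norm f)\<^sup>2)"

definition is_frame ::
    "('a::euclidean_space \<Rightarrow> complex) set \<Rightarrow> ('k \<Rightarrow> 'a \<Rightarrow> complex) \<Rightarrow> bool" where
  "is_frame H \<psi> \<longleftrightarrow> (\<exists>A B. frame_with_bounds A B H \<psi>)"

definition is_tight_frame ::
    "real \<Rightarrow> ('a::euclidean_space \<Rightarrow> complex) set \<Rightarrow> ('k \<Rightarrow> 'a \<Rightarrow> complex) \<Rightarrow> bool" where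
  "is_tight_frame A H \<psi> \<longleftrightarrow> frame_with_bounds A A H \<psi>"

definition is_parseval_frame ::
    "('a::euclidean_space \<Rightarrow> complex) set \<Rightarrow> ('k \<Rightarrow> 'a \<Rightarrow> complex) \<Rightarrow> bool" where
  "is_parseval_frame H \<psi> \<longleftrightarrow> frame_with_bounds 1 1 H \<psi>"

(* Linearity is modulo null sets; with boundedness it makes T respect equality almost everywhere
   on H. *)
definition bounded_op :: "('a::euclidean_space \<Rightarrow> complex) set
    \<Rightarrow> (('a \<Rightarrow> complex) \<Rightarrow> ('a \<Rightarrow> complex)) \<Rightarrow> bool" where
  "bounded_op H T \<longleftrightarrow> (\<forall>f\<in>H. T f \<in> H) \<and>
     (\<forall>f\<in>H. \<forall>g\<in>H. \<forall>a b. T (\<lambda>x. a * f x + b * g x) =\<^sub>a\<^sub>e (\<lambda>x. a * T f x + b * T g x)) \<and>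
     (\<exists>C. \<forall>f\<in>H. l2_norm (T f) \<le> C * l2_norm f)"

definition is_op_inverse :: "('a::euclidean_space \<Rightarrow> complex) set
    \<Rightarrow> (('a \<Rightarrow> complex) \<Rightarrow> ('a \<Rightarrow> complex)) \<Rightarrow> (('a \<Rightarrow> complex) \<Rightarrow> ('a \<Rightarrow> complex)) \<Rightarrow> bool" where
  "is_op_inverse H T V \<longleftrightarrow> bounded_op H V \<and> (\<forall>f\<in>H. V (T f) =\<^sub>a\<^sub>e f \<and> T (V f) =\<^sub>a\<^sub>e f)"

definition op_inverse :: "('a::euclidean_space \<Rightarrow> complex) set
    \<Rightarrow> (('a \<Rightarrow> complex) \<Rightarrow> ('a \<Rightarrow> complex)) \<Rightarrow> ('a \<Rightarrow> complex) \<Rightarrow> ('a \<Rightarrow> complex)" where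
  "op_inverse H T = (SOME V. is_op_inverse H T V)"

definition positive_op :: "('a::euclidean_space \<Rightarrow> complex) set
    \<Rightarrow> (('a \<Rightarrow> complex) \<Rightarrow> ('a \<Rightarrow> complex)) \<Rightarrow> bool" where
  "positive_op H T \<longleftrightarrow> bounded_op H T \<and>
     (\<forall>f\<in>H. Im (l2_inner (T f) f) = 0 \<and> 0 \<le> Re (l2_inner (T f) f))"

definition op_sqrt :: "('a::euclidean_space \<Rightarrow> complex) set
    \<Rightarrow> (('a \<Rightarrow> complex) \<Rightarrow> ('a \<Rightarrow> complex)) \<Rightarrow> ('a \<Rightarrow> complex) \<Rightarrow> ('a \<Rightarrow> complex)" where
  "op_sqrt H T = (SOME R. positive_op H R \<and> (\<forall>f\<in>H. R (R f) =\<^sub>a\<^sub>e T f))"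

definition frame_op :: "('k \<Rightarrow> 'a::euclidean_space \<Rightarrow> complex) \<Rightarrow> ('a \<Rightarrow> complex) \<Rightarrow> 'a \<Rightarrow> complex" where
  "frame_op \<psi> f = (SOME g. l2_has_sum (\<lambda>k x. l2_inner f (\<psi> k) * \<psi> k x) g)"

definition canonical_tight_frame :: "('a::euclidean_space \<Rightarrow> complex) set
    \<Rightarrow> ('k \<Rightarrow> 'a \<Rightarrow> complex) \<Rightarrow> 'k \<Rightarrow> 'a \<Rightarrow> complex" where
  "canonical_tight_frame H \<psi> k = op_sqrt H (op_inverse H (frame_op \<psi>)) (\<psi> k)"

definition equivalent_frames :: "('a::euclidean_space \<Rightarrow> complex) set
    \<Rightarrow> ('k \<Rightarrow> 'a \<Rightarrow> complex) \<Rightarrow> ('k \<Rightarrow> 'a \<Rightarrow> complex) \<Rightarrow> bool" where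
  "equivalent_frames H f g \<longleftrightarrow> is_frame H f \<and> is_frame H g \<and>
     (\<exists>U. bounded_op H U \<and> (\<exists>V. is_op_inverse H U V) \<and> (\<forall>k. U (f k) =\<^sub>a\<^sub>e g k))"

(* The family of exponentials restricted to S, i.e. multiplied by the indicator function of S. *)
definition expo_family :: "('k \<Rightarrow> 'a::euclidean_space) \<Rightarrow> 'a set \<Rightarrow> 'k \<Rightarrow> 'a \<Rightarrow> complex" where
  "expo_family lam S k x = expo (lam k) x * indicator S x"

end

theory Submission
  imports Defs "HOL-Probability.Characteristic_Functions"
begin

text \<open>The Fourier transform is a unitary operator that turns the translates of \<open>\<phi>\<close> into the
  exponentials multiplied by the transform of \<open>\<phi>\<close>. That transform is bounded above and below on its
  support, so multiplication by it is a bounded invertible operator there, and multiplication by its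
  phase is unitary; hence both families are images of frames under bounded invertible operators, and
  the closed span of such an image is the image of the whole space. For a positive square root \<open>r\<close>
  of \<open>S\<^sup>-\<^sup>1\<close>, where \<open>S\<close> is the frame operator, \<open>r S r = 1\<close>, which is the Parseval property; in the
  tight case \<open>S\<close> is a multiple of the identity, and so is \<open>r\<close>.\<close>

section \<open>The Hilbert space of square-integrable functions\<close>

text \<open>The Fourier transform, its inverse, the frame operator, its inverse and the square root
  are all selected by choice among functions that represent classes modulo null sets. Each selection
  needs a witness before anything is known about the selected object, and operators on functions are
  linear only up to null sets. The argument therefore moves to the Hilbert space of classes, where
  the witnesses are constructed and most choices become unique. The square root is used through its
  defining properties alone, so what is proved holds for every positive root of the inverse frame
  operator. Since the transform is the closure of a graph, it is Plancherel's theorem for functions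
  in both L^1 and L^2 that makes it single-valued and defined on the whole space.\<close>

lemma L2_measurable [measurable_dest]: "f \<in> L2 \<Longrightarrow> f \<in> borel_measurable borel"
  by (simp add: L2_def)

lemma L2_integrable: "f \<in> L2 \<Longrightarrow> integrable lborel (\<lambda>x. (cmod (f x))\<^sup>2)"
  by (simp add: L2_def)

lemma L2_I: "f \<in> borel_measurable borel \<Longrightarrow> integrable lborel (\<lambda>x. (cmod (f x))\<^sup>2) \<Longrightarrow> f \<in> L2"
  by (simp add: L2_def)

lemma borel_measurable_cnj [measurable (raw)]:
  "f \<in> borel_measurable M \<Longrightarrow> (\<lambda>x. cnj (f x)) \<in> borel_measurable M"
  by (rule borel_measurable_continuous_on[OF continuous_on_cnj[OF continuous_on_id]])

lemma L2_zero [simp]: "(\<lambda>x. 0) \<in> L2"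
  by (simp add: L2_def)

lemma L2_bound:
  assumes "f \<in> L2" "g \<in> borel_measurable borel" "AE x in lborel. cmod (g x) \<le> C * cmod (f x)"
  shows "g \<in> L2"
proof (rule L2_I)
  show "integrable lborel (\<lambda>x. (cmod (g x))\<^sup>2)"
  proof (rule Bochner_Integration.integrable_bound)
    show "integrable lborel (\<lambda>x. C\<^sup>2 * (cmod (f x))\<^sup>2)"
      using L2_integrable[OF assms(1)] by simp
    show "(\<lambda>x. (cmod (g x))\<^sup>2) \<in> borel_measurable lborel"
      using assms(2) by measurable
    show "AE x in lborel. norm ((cmod (g x))\<^sup>2) \<le> norm (C\<^sup>2 * (cmod (f x))\<^sup>2)"
      using assms(3)
    proof eventually_elim
      case (elim x)
      then have "(cmod (g x))\<^sup>2 \<le> (C * cmod (f x))\<^sup>2"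
        by (intro power_mono) auto
      then show ?case by (simp add: power_mult_distrib)
    qed
  qed
qed fact

lemma L2_add: assumes "f \<in> L2" "g \<in> L2" shows "(\<lambda>x. f x + g x) \<in> L2"
proof (rule L2_I)
  note [measurable] = assms[THEN L2_measurable]
  show "(\<lambda>x. f x + g x) \<in> borel_measurable borel" by measurable
  show "integrable lborel (\<lambda>x. (cmod (f x + g x))\<^sup>2)"
  proof (rule Bochner_Integration.integrable_bound)
    show "integrable lborel (\<lambda>x. 2 * (cmod (f x))\<^sup>2 + 2 * (cmod (g x))\<^sup>2)"
      by (intro Bochner_Integration.integrable_add integrable_mult_right L2_integrable assms)
    have "(cmod (a + b))\<^sup>2 \<le> 2 * (cmod a)\<^sup>2 + 2 * (cmod b)\<^sup>2" for a b
    proof -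
      have "(cmod (a + b))\<^sup>2 \<le> (cmod a + cmod b)\<^sup>2"
        by (intro power_mono norm_triangle_ineq) auto
      also have "\<dots> \<le> 2 * (cmod a)\<^sup>2 + 2 * (cmod b)\<^sup>2"
        using zero_le_power2[of "cmod a - cmod b"] by (simp add: power2_eq_square algebra_simps)
      finally show ?thesis .
    qed
    then show "AE x in lborel. norm ((cmod (f x + g x))\<^sup>2) \<le> norm (2 * (cmod (f x))\<^sup>2 + 2 * (cmod (g x))\<^sup>2)"
      by auto
  qed measurable
qed

lemma L2_cmult: assumes "f \<in> L2" shows "(\<lambda>x. c * f x) \<in> L2"
  by (rule L2_bound[OF assms, where C="cmod c"]) (use assms L2_measurable in \<open>auto simp: norm_mult\<close>)

lemma L2_minus: "f \<in> L2 \<Longrightarrow> (\<lambda>x. - f x) \<in> L2"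
  using L2_cmult[of f "-1"] by simp

lemma L2_diff: "f \<in> L2 \<Longrightarrow> g \<in> L2 \<Longrightarrow> (\<lambda>x. f x - g x) \<in> L2"
  using L2_add[of f "\<lambda>x. - g x"] L2_minus[of g] by simp

lemma L2_cnj: "f \<in> L2 \<Longrightarrow> (\<lambda>x. cnj (f x)) \<in> L2"
  by (rule L2_bound[of f _ 1]) (auto dest: L2_measurable intro: borel_measurable_cnj)

lemma L2_sum: "(\<And>k. k \<in> F \<Longrightarrow> u k \<in> L2) \<Longrightarrow> (\<lambda>x. \<Sum>k\<in>F. u k x) \<in> L2"
  by (induction F rule: infinite_finite_induct) (auto intro: L2_add)

lemma L2_mult_integrable:
  assumes "f \<in> L2" "g \<in> L2" shows "integrable lborel (\<lambda>x. f x * g x)"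
proof (rule Bochner_Integration.integrable_bound)
  note [measurable] = assms[THEN L2_measurable]
  show "integrable lborel (\<lambda>x. (cmod (f x))\<^sup>2 + (cmod (g x))\<^sup>2)"
    by (intro Bochner_Integration.integrable_add L2_integrable assms)
  show "(\<lambda>x. f x * g x) \<in> borel_measurable lborel" by measurable
  have "cmod (a * b) \<le> (cmod a)\<^sup>2 + (cmod b)\<^sup>2" for a b
  proof -
    have "0 \<le> cmod a * cmod b" by simp
    then show ?thesis
      using zero_le_power2[of "cmod a - cmod b"]
      unfolding norm_mult power2_eq_square by (simp only: algebra_simps)
  qed
  then show "AE x in lborel. norm (f x * g x) \<le> norm ((cmod (f x))\<^sup>2 + (cmod (g x))\<^sup>2)"
    by auto
qed

lemma L2_inner_integrable:
  "f \<in> L2 \<Longrightarrow> g \<in> L2 \<Longrightarrow> integrable lborel (\<lambda>x. f x * cnj (g x))"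
  by (intro L2_mult_integrable L2_cnj)

section \<open>Classes of functions modulo null sets\<close>

lemma ae_eq_refl [simp]: "f =\<^sub>a\<^sub>e f"
  by (simp add: ae_eq_def)

lemma ae_eq_sym: "f =\<^sub>a\<^sub>e g \<Longrightarrow> g =\<^sub>a\<^sub>e f"
  by (simp add: ae_eq_def eq_commute)

lemma ae_eq_trans [trans]: "f =\<^sub>a\<^sub>e g \<Longrightarrow> g =\<^sub>a\<^sub>e h \<Longrightarrow> f =\<^sub>a\<^sub>e h"
  unfolding ae_eq_def by (elim AE_mp) (auto intro!: AE_I2)

text \<open>Only members of \<open>L2\<close> are related to themselves. The quotient by this
  partial equivalence thus contains exactly the classes of square-integrable functions.\<close>

definition L2_rel :: "('a::euclidean_space \<Rightarrow> complex) \<Rightarrow> ('a \<Rightarrow> complex) \<Rightarrow> bool" where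
  "L2_rel f g \<longleftrightarrow> f \<in> L2 \<and> g \<in> L2 \<and> f =\<^sub>a\<^sub>e g"

lemma L2_relI: "f \<in> L2 \<Longrightarrow> f = g \<Longrightarrow> L2_rel f g"
  by (simp add: L2_rel_def)

lemma part_equivp_L2_rel: "part_equivp L2_rel"
  unfolding part_equivp_def L2_rel_def
  by (intro conjI exI[of _ "\<lambda>x. 0"]) (auto simp: fun_eq_iff intro: ae_eq_sym ae_eq_trans)

quotient_type (overloaded) 'a lsq = "'a::euclidean_space \<Rightarrow> complex" / partial: L2_rel
  by (rule part_equivp_L2_rel)

lemma rep_L2 [simp]: "rep_lsq u \<in> L2"
  using Quotient3_rel_rep[OF Quotient3_lsq, of u u] by (simp add: L2_rel_def)

lemma abs_rep [simp]: "abs_lsq (rep_lsq u) = u"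
  by (rule Quotient3_abs_rep[OF Quotient3_lsq])

lemma abs_eq_iff: "f \<in> L2 \<Longrightarrow> g \<in> L2 \<Longrightarrow> abs_lsq f = abs_lsq g \<longleftrightarrow> f =\<^sub>a\<^sub>e g"
  using Quotient3_rel[OF Quotient3_lsq, of f g] by (auto simp: L2_rel_def)

lemma rep_abs: "f \<in> L2 \<Longrightarrow> rep_lsq (abs_lsq f) =\<^sub>a\<^sub>e f"
  using abs_eq_iff[of "rep_lsq (abs_lsq f)" f] by simp

lemma abs_cases [case_names abs, cases type: lsq]:
  obtains f where "u = abs_lsq f" "f \<in> L2"
  by (metis abs_rep rep_L2)

lemma l2_inner_cong:
  assumes "f \<in> L2" "g \<in> L2" "f' \<in> L2" "g' \<in> L2" "f =\<^sub>a\<^sub>e f'" "g =\<^sub>a\<^sub>e g'"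
  shows "l2_inner f g = l2_inner f' g'"
  unfolding l2_inner_def
proof (rule Bochner_Integration.integral_cong_AE)
  note [measurable] = assms(1-4)[THEN L2_measurable]
  show "(\<lambda>x. f x * cnj (g x)) \<in> borel_measurable lborel" "(\<lambda>x. f' x * cnj (g' x)) \<in> borel_measurable lborel"
    by measurable
  show "AE x in lborel. f x * cnj (g x) = f' x * cnj (g' x)"
    using assms(5,6) unfolding ae_eq_def by eventually_elim simp
qed

lift_definition cinner :: "'a::euclidean_space lsq \<Rightarrow> 'a lsq \<Rightarrow> complex" is l2_inner
  by (auto simp: L2_rel_def intro: l2_inner_cong)

lift_definition cscale :: "complex \<Rightarrow> 'a::euclidean_space lsq \<Rightarrow> 'a lsq" is "\<lambda>c f x. c * f x"
  by (auto simp: L2_rel_def ae_eq_def intro: L2_cmult)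

instantiation lsq :: (euclidean_space) real_vector
begin

lift_definition zero_lsq :: "'a lsq" is "\<lambda>x. 0"
  by (simp add: L2_rel_def)

lift_definition plus_lsq :: "'a lsq \<Rightarrow> 'a lsq \<Rightarrow> 'a lsq" is "\<lambda>f g x. f x + g x"
  by (auto simp: L2_rel_def ae_eq_def intro: L2_add)

lift_definition uminus_lsq :: "'a lsq \<Rightarrow> 'a lsq" is "\<lambda>f x. - f x"
  by (auto simp: L2_rel_def ae_eq_def intro: L2_minus)

lift_definition minus_lsq :: "'a lsq \<Rightarrow> 'a lsq \<Rightarrow> 'a lsq" is "\<lambda>f g x. f x - g x"
  by (auto simp: L2_rel_def ae_eq_def intro: L2_diff)

lift_definition scaleR_lsq :: "real \<Rightarrow> 'a lsq \<Rightarrow> 'a lsq" is "\<lambda>c f x. of_real c * f x"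
  by (auto simp: L2_rel_def ae_eq_def intro: L2_cmult)

instance
proof
  fix u v w :: "'a lsq" and a b :: real
  show "u + v + w = u + (v + w)"
    by transfer (rule L2_relI; simp add: L2_rel_def L2_add algebra_simps)
  show "u + v = v + u"
    by transfer (rule L2_relI; simp add: L2_rel_def L2_add algebra_simps)
  show "0 + u = u"
    by transfer (rule L2_relI; simp add: L2_rel_def)
  show "- u + u = 0"
    by transfer (rule L2_relI; simp add: L2_rel_def)
  show "u - v = u + - v"
    by transfer (rule L2_relI; simp add: L2_rel_def L2_diff)
  show "a *\<^sub>R (u + v) = a *\<^sub>R u + a *\<^sub>R v"
    by transfer (rule L2_relI; simp add: L2_rel_def ring_distribs L2_add L2_cmult)
  show "(a + b) *\<^sub>R u = a *\<^sub>R u + b *\<^sub>R u"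
    by transfer (rule L2_relI; simp add: L2_rel_def ring_distribs L2_add L2_cmult)
  show "a *\<^sub>R b *\<^sub>R u = (a * b) *\<^sub>R u"
    by transfer (rule L2_relI; simp add: L2_rel_def mult.assoc L2_cmult)
  show "1 *\<^sub>R u = u"
    by transfer (rule L2_relI; simp add: L2_rel_def)
qed

end

lemma abs_plus: "f \<in> L2 \<Longrightarrow> g \<in> L2 \<Longrightarrow> abs_lsq f + abs_lsq g = abs_lsq (\<lambda>x. f x + g x)"
  by (rule plus_lsq.abs_eq) (auto simp: L2_rel_def)

lemma abs_minus: "f \<in> L2 \<Longrightarrow> g \<in> L2 \<Longrightarrow> abs_lsq f - abs_lsq g = abs_lsq (\<lambda>x. f x - g x)"
  by (rule minus_lsq.abs_eq) (auto simp: L2_rel_def)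

lemma abs_cscale: "f \<in> L2 \<Longrightarrow> cscale c (abs_lsq f) = abs_lsq (\<lambda>x. c * f x)"
  by (rule cscale.abs_eq) (auto simp: L2_rel_def)

lemma abs_sum: "(\<And>k. k \<in> F \<Longrightarrow> u k \<in> L2) \<Longrightarrow> (\<Sum>k\<in>F. abs_lsq (u k)) = abs_lsq (\<lambda>x. \<Sum>k\<in>F. u k x)"
  by (induction F rule: infinite_finite_induct) (auto simp: zero_lsq_def abs_plus L2_sum)

lemma abs_cinner: "f \<in> L2 \<Longrightarrow> g \<in> L2 \<Longrightarrow> cinner (abs_lsq f) (abs_lsq g) = l2_inner f g"
  by (rule cinner.abs_eq) (auto simp: L2_rel_def)

lemma scaleR_cscale: "r *\<^sub>R u = cscale (of_real r) (u :: 'a::euclidean_space lsq)"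
  by transfer (auto simp: L2_rel_def intro: L2_cmult)

lemma cscale_cscale [simp]: "cscale a (cscale b u) = cscale (a * b) u"
  by transfer (auto simp: L2_rel_def mult.assoc intro: L2_cmult)

lemma cscale_add_right: "cscale a (u + v) = cscale a u + cscale a v"
  by transfer (auto simp: L2_rel_def algebra_simps intro!: L2_cmult L2_add)

lemma cscale_one [simp]: "cscale 1 u = u"
  by transfer (auto simp: L2_rel_def)

lemma cinner_add_left: "cinner (u + v) w = cinner u w + cinner v w"
proof (cases u; cases v; cases w)
  fix f g h assume *: "u = abs_lsq f" "f \<in> L2" "v = abs_lsq g" "g \<in> L2" "w = abs_lsq h" "h \<in> L2"
  then show ?thesis
    by (simp add: abs_plus abs_cinner L2_add) (simp add: l2_inner_def ring_distribs L2_inner_integrable)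
qed

lemma cinner_cscale_left: "cinner (cscale a u) v = a * cinner u v"
proof (cases u; cases v)
  fix f g assume *: "u = abs_lsq f" "f \<in> L2" "v = abs_lsq g" "g \<in> L2"
  then show ?thesis
    by (simp add: abs_cscale abs_cinner L2_cmult) (simp add: l2_inner_def mult.assoc)
qed

lemma cinner_commute: "cinner u v = cnj (cinner v u)"
proof (cases u; cases v)
  fix f g assume *: "u = abs_lsq f" "f \<in> L2" "v = abs_lsq g" "g \<in> L2"
  have "cnj (LINT x|lborel. g x * cnj (f x)) = (LINT x|lborel. cnj (g x * cnj (f x)))"
    by (rule Bochner_Integration.integral_cnj[symmetric])
  with * show ?thesis
    by (simp add: abs_cinner) (simp add: l2_inner_def mult.commute)
qed

lemma cinner_self: "f \<in> L2 \<Longrightarrow> cinner (abs_lsq f) (abs_lsq f) = of_real (LINT x|lborel. (cmod (f x))\<^sup>2)"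
  by (simp add: abs_cinner l2_inner_def complex_norm_square[symmetric] del: of_real_power)

text \<open>The real part of \<open>cinner\<close> makes the classes a real inner product space, the
  setting of the available type classes. The complex structure is carried alongside by
  \<open>cscale\<close> and \<open>cinner\<close>.\<close>

instantiation lsq :: (euclidean_space) real_inner
begin

definition "inner_lsq u v = Re (cinner u v)" for u v :: "'a lsq"
definition "norm_lsq u = sqrt (inner u u)" for u :: "'a lsq"
definition "dist_lsq u v = norm (u - v)" for u v :: "'a lsq"
definition "sgn_lsq u = inverse (norm u) *\<^sub>R u" for u :: "'a lsq"
definition "uniformity_lsq = (INF e\<in>{0 <..}. principal {(u, v). dist u (v::'a lsq) < e})"
definition "open_lsq U = (\<forall>u\<in>U. eventually (\<lambda>(u', v). u' = u \<longrightarrow> v \<in> U) uniformity)" for U :: "'a lsq set"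

instance
proof
  fix u v w :: "'a lsq" and r :: real
  show "inner u v = inner v u"
    using cinner_commute[of u v] by (simp add: inner_lsq_def)
  show "inner (u + v) w = inner u w + inner v w"
    by (simp add: inner_lsq_def cinner_add_left)
  show "inner (r *\<^sub>R u) v = r * inner u v"
    by (simp add: inner_lsq_def scaleR_cscale cinner_cscale_left)
  obtain f where f: "u = abs_lsq f" "f \<in> L2" by (cases u)
  then show "0 \<le> inner u u"
    by (simp add: inner_lsq_def cinner_self)
  have "inner u u = 0 \<longleftrightarrow> (AE x in lborel. (cmod (f x))\<^sup>2 = 0)"
    using f by (simp add: inner_lsq_def cinner_self L2_integrable integral_nonneg_eq_0_iff_AE)
  also have "\<dots> \<longleftrightarrow> u = 0"
    using f by (simp add: zero_lsq_def abs_eq_iff ae_eq_def)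
  finally show "inner u u = 0 \<longleftrightarrow> u = 0" .
qed (auto simp: norm_lsq_def dist_lsq_def sgn_lsq_def uniformity_lsq_def open_lsq_def)

end

lemma cinner_self_norm: "cinner u u = of_real ((norm u)\<^sup>2)"
  by (cases u) (simp add: power2_norm_eq_inner inner_lsq_def cinner_self)

lemma abs_norm_square: "f \<in> L2 \<Longrightarrow> (norm (abs_lsq f))\<^sup>2 = (LINT x|lborel. (cmod (f x))\<^sup>2)"
  by (simp add: power2_norm_eq_inner inner_lsq_def cinner_self)

lemma abs_norm: "f \<in> L2 \<Longrightarrow> norm (abs_lsq f) = l2_norm f"
  by (simp add: norm_eq_sqrt_inner inner_lsq_def cinner_self l2_norm_def)

lemma cinner_add_right: "cinner u (v + w) = cinner u v + cinner u w"
  using arg_cong[OF cinner_add_left[of v w u], of cnj] by (simp flip: cinner_commute)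

lemma cinner_cscale_right: "cinner u (cscale a v) = cnj a * cinner u v"
  using arg_cong[OF cinner_cscale_left[of a v u], of cnj] by (simp flip: cinner_commute)

lemma cscale_minus_one: "cscale (-1) u = - u"
  using scaleR_cscale[of "-1" u] by simp

lemma cinner_minus_left: "cinner (- u) v = - cinner u v"
  using cinner_cscale_left[of "-1" u v] by (simp add: cscale_minus_one)

lemma cinner_diff_left: "cinner (u - v) w = cinner u w - cinner v w"
  using cinner_add_left[of u "-v" w] by (simp add: cinner_minus_left)

lemma cinner_diff_right: "cinner w (u - v) = cinner w u - cinner w v"
  using arg_cong[OF cinner_diff_left[of u v w], of cnj] by (simp flip: cinner_commute)

lemma cinner_zero [simp]: "cinner 0 v = 0" "cinner v 0 = 0"
  using cinner_diff_left[of v v v] cinner_diff_right[of v v v] by simp_all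

lemma norm_cscale: "norm (cscale a u) = cmod a * norm u"
proof -
  have "complex_of_real ((norm (cscale a u))\<^sup>2) = complex_of_real ((cmod a * norm u)\<^sup>2)"
    unfolding cinner_self_norm[symmetric] cinner_cscale_left cinner_cscale_right
    by (simp add: cinner_self_norm power_mult_distrib complex_norm_square mult.assoc del: of_real_power)
  then have "(norm (cscale a u))\<^sup>2 = (cmod a * norm u)\<^sup>2"
    by (simp only: of_real_eq_iff)
  then show ?thesis
    by (rule power2_eq_imp_eq) auto
qed

text \<open>A unimodular factor \<open>c\<close> rotates the inner product onto the nonnegative real
  axis, which reduces the claim to the real Cauchy-Schwarz inequality.\<close>

lemma cmod_cinner_le: "cmod (cinner u v) \<le> norm u * norm v"
proof -
  define c where "c = (if cinner u v = 0 then 1 else cnj (sgn (cinner u v)))"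
  have c: "cmod c = 1" by (simp add: c_def norm_sgn)
  have "c * cinner u v = of_real (cmod (cinner u v))"
  proof (cases "cinner u v = 0")
    case False
    then show ?thesis
      by (simp add: c_def sgn_div_norm scaleR_conv_of_real complex_norm_square[symmetric] power2_eq_square field_simps)
  qed simp
  then have "cmod (cinner u v) = Re (cinner (cscale c u) v)"
    by (metis Re_complex_of_real cinner_cscale_left)
  also have "\<dots> \<le> norm (cscale c u) * norm v"
    using norm_cauchy_schwarz[of "cscale c u" v] by (simp add: inner_lsq_def)
  finally show ?thesis by (simp add: norm_cscale c)
qed

lemma cinner_eqI: "(\<And>w. cinner u w = cinner v w) \<Longrightarrow> u = v"
proof -
  assume "\<And>w. cinner u w = cinner v w"
  then have "inner (u - v) (u - v) = 0"
    by (simp add: inner_lsq_def cinner_diff_left)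
  then show ?thesis by simp
qed

lemma bounded_linear_cscale: "bounded_linear (cscale a)"
  by (rule bounded_linear_intro[where K="cmod a"])
    (auto simp: cscale_add_right scaleR_cscale norm_cscale mult.commute)

lemma bounded_linear_cinner_left: "bounded_linear (\<lambda>u. cinner u v)"
  by (rule bounded_linear_intro[where K="norm v"])
    (auto simp: cinner_add_left scaleR_cscale cinner_cscale_left cmod_cinner_le scaleR_conv_of_real)

section \<open>Completeness (Riesz-Fischer)\<close>

lemma nn_integral_L2: "f \<in> L2 \<Longrightarrow> (\<integral>\<^sup>+x. ennreal ((cmod (f x))\<^sup>2) \<partial>lborel) = ennreal ((norm (abs_lsq f))\<^sup>2)"
  by (subst nn_integral_eq_integral) (auto simp: L2_integrable abs_norm_square)

lemma L2_I_nn: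
  assumes [measurable]: "f \<in> borel_measurable borel"
    and "(\<integral>\<^sup>+x. ennreal ((cmod (f x))\<^sup>2) \<partial>lborel) \<le> ennreal c"
  shows "f \<in> L2"
  by (rule L2_I, measurable, rule integrableI_nonneg)
    (use assms(2) in \<open>auto simp: less_top[symmetric] top_unique\<close>)

text \<open>Increments this small force the representatives to converge almost everywhere, and
  Fatou's lemma turns the pointwise limit into a limit in norm.\<close>

lemma fast_Cauchy_convergent_lsq:
  fixes X :: "nat \<Rightarrow> 'a::euclidean_space lsq"
  assumes "Cauchy X" and fast: "\<And>n. norm (X (Suc n) - X n) \<le> (1/2)^n"
  shows "convergent X"
proof -
  define v where "v n = rep_lsq (X n)" for n
  have v: "v n \<in> L2" "abs_lsq (v n) = X n" for n
    by (simp_all add: v_def)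
  note [measurable] = v(1)[THEN L2_measurable]
  have vd: "(\<integral>\<^sup>+x. ennreal ((cmod (v m x - v n x))\<^sup>2) \<partial>lborel) = ennreal ((norm (X m - X n))\<^sup>2)" for m n
    using nn_integral_L2[OF L2_diff[OF v(1) v(1)], of m n] by (simp add: v abs_minus[symmetric])
  \<comment> \<open>The series \<open>\<Sum>n. 2^n * D n x\<close> has a finite integral, so the increments decay geometrically almost everywhere.\<close>
  define D where "D n x = (cmod (v (Suc n) x - v n x))\<^sup>2" for n x
  have [measurable]: "D n \<in> borel_measurable borel" for n
    unfolding D_def by measurable
  have "(\<integral>\<^sup>+x. (\<Sum>n. ennreal (2^n * D n x)) \<partial>lborel) = (\<Sum>n. \<integral>\<^sup>+x. ennreal (2^n * D n x) \<partial>lborel)"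
    by (rule nn_integral_suminf) measurable
  also have "\<dots> \<le> (\<Sum>n. ennreal ((1/2)^n))"
  proof (rule suminf_le)
    fix n
    have "(\<integral>\<^sup>+x. ennreal (2^n * D n x) \<partial>lborel) = ennreal (2^n) * ennreal ((norm (X (Suc n) - X n))\<^sup>2)"
      unfolding vd[symmetric] by (subst nn_integral_cmult[symmetric]) (auto simp: D_def ennreal_mult)
    also have "\<dots> = ennreal (2^n * (norm (X (Suc n) - X n))\<^sup>2)"
      by (simp add: ennreal_mult)
    also have "\<dots> \<le> ennreal (2^n * ((1/2)^n)\<^sup>2)"
      by (intro ennreal_leI mult_left_mono power_mono fast) auto
    also have "(2^n * ((1/2)^n)\<^sup>2) = ((1/2)^n :: real)"
      by (simp add: power2_eq_square power_divide)
    finally show "(\<integral>\<^sup>+x. ennreal (2^n * D n x) \<partial>lborel) \<le> ennreal ((1/2)^n)" .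
  qed auto
  also have "\<dots> < \<infinity>"
    by (subst suminf_ennreal2) (auto simp: summable_geometric)
  finally have "(\<integral>\<^sup>+x. (\<Sum>n. ennreal (2^n * D n x)) \<partial>lborel) \<noteq> \<infinity>" by simp
  then have "AE x in lborel. (\<Sum>n. ennreal (2^n * D n x)) \<noteq> \<infinity>"
    by (intro nn_integral_PInf_AE) measurable
  then have conv: "AE x in lborel. convergent (\<lambda>n. v n x)"
  proof eventually_elim
    case (elim x)
    then have "summable (\<lambda>n. 2^n * D n x)"
      by (intro summable_suminf_not_top) (auto simp: D_def)
    then have "Bseq (\<lambda>n. 2^n * D n x)"
      by (intro convergent_imp_Bseq summable_LIMSEQ_zero[THEN convergentI])
    then obtain C where C: "C > 0" "\<And>n. norm (2^n * D n x) \<le> C"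
      by (auto simp: Bseq_def)
    \<comment> \<open>The bound \<open>2^n * D n x \<le> C\<close> makes the increments decay like a
      geometric sequence of ratio \<open>1 / sqrt 2\<close>.\<close>
    have le: "cmod (v (Suc n) x - v n x) \<le> sqrt C * (1 / sqrt 2)^n" for n
    proof (rule power2_le_imp_le)
      have "2^n * D n x \<le> C" using C(2)[of n] by simp
      then have "D n x \<le> C / 2^n"
        by (simp add: field_simps)
      also have "\<dots> = (sqrt C * (1 / sqrt 2)^n)\<^sup>2"
        using C(1) power_mult[of "sqrt 2" 2 n] power_mult[of "sqrt 2" n 2]
        by (simp add: power_mult_distrib power_divide mult.commute)
      finally show "(cmod (v (Suc n) x - v n x))\<^sup>2 \<le> (sqrt C * (1 / sqrt 2)^n)\<^sup>2"
        by (simp add: D_def)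
    qed (use C in auto)
    have "summable (\<lambda>n. v (Suc n) x - v n x)"
      by (rule summable_comparison_test'[where N=0, OF _ le]) (auto intro!: summable_mult summable_geometric)
    then have "convergent (\<lambda>n. \<Sum>k<n. v (Suc k) x - v k x)"
      by (simp add: summable_iff_convergent)
    then have "convergent (\<lambda>n. (v n x - v 0 x) + v 0 x)"
      unfolding sum_lessThan_telescope[of "\<lambda>k. v k x"] by (intro convergent_add convergent_const)
    then show ?case by simp
  qed
  define f where "f x = lim (\<lambda>n. v n x)" for x
  have [measurable]: "f \<in> borel_measurable borel"
    unfolding f_def by measurable
  have lim: "AE x in lborel. (\<lambda>n. v n x) \<longlonglongrightarrow> f x"
    using conv by eventually_elim (simp add: f_def convergent_LIMSEQ_iff)
  \<comment> \<open>Fatou's lemma lets the second index tend to infinity in the Cauchy estimate,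
    which places the difference in \<open>L2\<close> and keeps the bound \<open>e\<close>.\<close>
  have fv: "(\<lambda>x. v n x - f x) \<in> L2 \<and> norm (abs_lsq (\<lambda>x. v n x - f x)) \<le> e"
    if N: "\<And>m n. m \<ge> N \<Longrightarrow> n \<ge> N \<Longrightarrow> norm (X m - X n) < e" and n: "n \<ge> N" for e N n
  proof -
    have e: "0 \<le> e" using N[of N N] by simp
    have "(\<integral>\<^sup>+x. ennreal ((cmod (v n x - f x))\<^sup>2) \<partial>lborel)
      = (\<integral>\<^sup>+x. liminf (\<lambda>m. ennreal ((cmod (v n x - v m x))\<^sup>2)) \<partial>lborel)"
    proof (rule nn_integral_cong_AE)
      show "AE x in lborel. ennreal ((cmod (v n x - f x))\<^sup>2) = liminf (\<lambda>m. ennreal ((cmod (v n x - v m x))\<^sup>2))"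
        using lim
      proof eventually_elim
        case (elim x)
        then have "(\<lambda>m. ennreal ((cmod (v n x - v m x))\<^sup>2)) \<longlonglongrightarrow> ennreal ((cmod (v n x - f x))\<^sup>2)"
          by (intro tendsto_ennrealI tendsto_intros)
        then show ?case
          by (intro lim_imp_Liminf[symmetric]) simp_all
      qed
    qed
    also have "\<dots> \<le> liminf (\<lambda>m. \<integral>\<^sup>+x. ennreal ((cmod (v n x - v m x))\<^sup>2) \<partial>lborel)"
      by (rule nn_integral_liminf) measurable
    also have "\<dots> \<le> liminf (\<lambda>m::nat. ennreal (e\<^sup>2))"
    proof (rule Liminf_mono)
      show "\<forall>\<^sub>F m in sequentially. (\<integral>\<^sup>+x. ennreal ((cmod (v n x - v m x))\<^sup>2) \<partial>lborel) \<le> ennreal (e\<^sup>2)"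
        using eventually_ge_at_top[of N]
        by eventually_elim (auto simp: vd intro!: ennreal_leI power_mono less_imp_le[OF N] n)
    qed
    finally have *: "(\<integral>\<^sup>+x. ennreal ((cmod (v n x - f x))\<^sup>2) \<partial>lborel) \<le> ennreal (e\<^sup>2)"
      by (simp add: Liminf_const)
    then have L: "(\<lambda>x. v n x - f x) \<in> L2"
      by (intro L2_I_nn) measurable
    with * have "(norm (abs_lsq (\<lambda>x. v n x - f x)))\<^sup>2 \<le> e\<^sup>2"
      by (simp add: nn_integral_L2)
    with L e show ?thesis
      using power2_le_imp_le by blast
  qed
  have "\<exists>N. \<forall>m\<ge>N. \<forall>n\<ge>N. norm (X m - X n) < e" if "e > 0" for e
    using assms(1) that unfolding Cauchy_def dist_norm by blast
  note N = this
  obtain N1 where N1: "\<And>m n. m \<ge> N1 \<Longrightarrow> n \<ge> N1 \<Longrightarrow> norm (X m - X n) < 1"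
    using N[of 1] by auto
  have "(\<lambda>x. v N1 x - (v N1 x - f x)) \<in> L2"
    using N1 by (intro L2_diff v fv[of N1 1 N1, THEN conjunct1]) auto
  then have fL2: "f \<in> L2" by simp
  have "X \<longlonglongrightarrow> abs_lsq f"
  proof (rule metric_LIMSEQ_I)
    fix e :: real assume "e > 0"
    then obtain M where M: "\<And>m n. m \<ge> M \<Longrightarrow> n \<ge> M \<Longrightarrow> norm (X m - X n) < e/2"
      using N[of "e/2"] by auto
    have "dist (X n) (abs_lsq f) < e" if "n \<ge> M" for n
    proof -
      have "dist (X n) (abs_lsq f) \<le> e/2"
        using fv[OF M that] by (simp add: dist_norm abs_minus[OF v(1) fL2, symmetric] v)
      with \<open>e > 0\<close> show ?thesis by simp
    qed
    then show "\<exists>no. \<forall>n\<ge>no. dist (X n) (abs_lsq f) < e" by blast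
  qed
  then show ?thesis by (rule convergentI)
qed

instance lsq :: (euclidean_space) complete_space
proof
  fix X :: "nat \<Rightarrow> 'a lsq" assume X: "Cauchy X"
  have "\<exists>N. \<forall>m\<ge>N. \<forall>n\<ge>N. norm (X m - X n) < (1/2)^k" for k
    using X unfolding Cauchy_def dist_norm by (metis divide_pos_pos zero_less_numeral zero_less_one zero_less_power)
  then obtain N where N: "\<And>k m n. m \<ge> N k \<Longrightarrow> n \<ge> N k \<Longrightarrow> norm (X m - X n) < (1/2)^k"
    by metis
  \<comment> \<open>The sum contains \<open>N n\<close>, so \<open>r n\<close> lies beyond that
    threshold; the added \<open>n\<close> makes \<open>r\<close> strictly increasing even where
    thresholds vanish.\<close>
  define r where "r n = (\<Sum>k\<le>n. N k) + n" for n
  have r: "strict_mono r"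
    by (rule strict_monoI_Suc) (simp add: r_def)
  have rN: "r n \<ge> N n" for n
    using member_le_sum[of n "{..n}" N] by (simp add: r_def)
  have "convergent (X \<circ> r)"
  proof (rule fast_Cauchy_convergent_lsq)
    show "Cauchy (X \<circ> r)"
      by (rule Cauchy_subseq_Cauchy[OF X r])
    fix n
    have "r n \<le> r (Suc n)" by (simp add: r_def)
    then show "norm ((X \<circ> r) (Suc n) - (X \<circ> r) n) \<le> (1/2)^n"
      using N[of n "r (Suc n)" "r n"] rN[of n] by simp
  qed
  then obtain l where "(X \<circ> r) \<longlonglongrightarrow> l" by (auto simp: convergent_def)
  then have "X \<longlonglongrightarrow> l"
    by (rule Cauchy_converges_subseq[OF X r])
  then show "convergent X" by (rule convergentI)
qed

instance lsq :: (euclidean_space) banach ..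

section \<open>Inverse square roots of positive operators\<close>

text \<open>With \<open>X = 1 - t S\<close> of norm less than one, the contraction \<open>Y \<mapsto> (X + Y\<^sup>2) / 2\<close> has a fixed point
  of norm less than one, and \<open>(1 - Y)\<^sup>2 = 1 - X = t S\<close>. The closed set on which it is iterated records
  that \<open>Y\<close> is symmetric and commutes with the commutant of \<open>S\<close>.\<close>

lemma symmetric_square_root_inverse:
  fixes S :: "'h::{real_inner,banach} \<Rightarrow>\<^sub>L 'h"
  assumes sym: "\<And>f g. inner (S f) g = inner f (S g)"
    and A: "A > 0" "\<And>f. A * (norm f)\<^sup>2 \<le> inner (S f) f"
  obtains R :: "'h \<Rightarrow>\<^sub>L 'h" where
    "\<And>f g. inner (R f) g = inner f (R g)" "\<And>f. 0 \<le> inner (R f) f"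
    "S o\<^sub>L (R o\<^sub>L R) = id_blinfun" "(R o\<^sub>L R) o\<^sub>L S = id_blinfun"
    "\<And>T :: 'h \<Rightarrow>\<^sub>L 'h. T o\<^sub>L S = S o\<^sub>L T \<Longrightarrow> T o\<^sub>L R = R o\<^sub>L T"
proof -

  \<comment> \<open>Taking the maximum guarantees \<open>A / B \<le> 1\<close>. The number
    \<open>t = A / B^2\<close> below minimises \<open>1 - 2 * t * A + t^2 * B^2\<close>, which
    bounds the squared norm of \<open>1 - t S\<close>; the minimum is \<open>r^2\<close>.\<close>
  define B where "B = max A (norm S)"
  have B: "A \<le> B" "norm S \<le> B" "0 < B" using A(1) by (auto simp: B_def)
  define t where "t = A / B\<^sup>2"
  have t: "t > 0" using A B by (simp add: t_def)
  define r where "r = sqrt (1 - (A / B)\<^sup>2)"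
  have AB: "0 < A / B" "A / B \<le> 1" using A B by auto
  then have AB2: "0 < (A / B)\<^sup>2" "(A / B)\<^sup>2 \<le> 1"
    by (auto simp: power_le_one)
  have r: "0 \<le> r" "r < 1" using AB2 by (auto simp: r_def)
  define X where "X = id_blinfun - t *\<^sub>R S"
  have X: "norm X \<le> r"
  proof (rule norm_blinfun_bound)
    fix f
    have "(norm (X f))\<^sup>2 = (norm f)\<^sup>2 - 2 * t * inner (S f) f + t\<^sup>2 * (norm (S f))\<^sup>2"
      unfolding X_def power2_norm_eq_inner
      by (simp add: blinfun.bilinear_simps inner_diff inner_commute power2_eq_square algebra_simps)
    also have "\<dots> \<le> (norm f)\<^sup>2 - 2 * t * (A * (norm f)\<^sup>2) + t\<^sup>2 * (B * norm f)\<^sup>2"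
    proof (intro add_mono diff_mono mult_left_mono power_mono order_refl A(2))
      show "norm (S f) \<le> B * norm f"
        using norm_blinfun[of S f] mult_right_mono[OF B(2) norm_ge_zero[of f]] by linarith
    qed (use t in auto)
    also have "\<dots> = (r * norm f)\<^sup>2"
    proof -
      define q where "q = (A / B)\<^sup>2"
      have h: "t * A = q" "t\<^sup>2 * B\<^sup>2 = q"
        using B(3) by (simp_all add: t_def q_def power2_eq_square)
      have r2: "r\<^sup>2 = 1 - q" using AB2(2) by (simp add: r_def q_def)
      have "(norm f)\<^sup>2 - 2 * t * (A * (norm f)\<^sup>2) + t\<^sup>2 * (B * norm f)\<^sup>2
        = (norm f)\<^sup>2 - 2 * (t * A) * (norm f)\<^sup>2 + (t\<^sup>2 * B\<^sup>2) * (norm f)\<^sup>2"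
        by (simp add: power_mult_distrib)
      also have "\<dots> = (r * norm f)\<^sup>2"
        unfolding h power_mult_distrib r2 by (simp add: algebra_simps)
      finally show ?thesis .
    qed
    finally show "norm (X f) \<le> r * norm f"
      by (rule power2_le_imp_le) (simp add: r)
  qed (rule r)
  \<comment> \<open>The smaller fixed point of the scalar map sending x to (r + x^2) / 2. It makes
    the ball of radius \<open>\<rho>\<close> invariant under \<open>\<Psi>\<close> and is also the
    contraction constant there.\<close>
  define \<rho> where "\<rho> = 1 - sqrt (1 - r)"
  have \<rho>: "0 \<le> \<rho>" "\<rho> < 1" and \<rho>_eq: "r + \<rho> * \<rho> = 2 * \<rho>"
    using r by (auto simp: \<rho>_def algebra_simps)
  define C where "C = {Y :: 'h \<Rightarrow>\<^sub>L 'h. norm Y \<le> \<rho> \<and>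
    (\<forall>f g. inner (blinfun_apply Y f) g = inner f (blinfun_apply Y g)) \<and>
    (\<forall>T. T o\<^sub>L S = S o\<^sub>L T \<longrightarrow> T o\<^sub>L Y = Y o\<^sub>L T)}"
  define \<Psi> where "\<Psi> Y = (1/2) *\<^sub>R (X + (Y o\<^sub>L Y))" for Y :: "'h \<Rightarrow>\<^sub>L 'h"
  have "\<exists>!Y. Y \<in> C \<and> \<Psi> Y = Y"
  proof (rule Banach_fix[OF _ _ \<rho>])
    have "closed C"
    proof -
      have "C = cball 0 \<rho> \<inter> (\<Inter>f. \<Inter>g. {Y. inner (blinfun_apply Y f) g = inner f (blinfun_apply Y g)})
        \<inter> (\<Inter>T\<in>{T. T o\<^sub>L S = S o\<^sub>L T}. {Y. T o\<^sub>L Y = Y o\<^sub>L T})"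
        by (auto simp: C_def dist_norm)
      also have "closed \<dots>"
        by (intro closed_Int closed_INT ballI closed_cball closed_Collect_eq continuous_intros
            bounded_bilinear.continuous_on[OF bounded_bilinear_blinfun_compose])
      finally show ?thesis .
    qed
    then show "complete C" by (simp add: complete_eq_closed)
    show "C \<noteq> {}" using \<rho> by (auto simp: C_def blinfun.bilinear_simps intro!: exI[of _ 0])
    show "\<Psi> ` C \<subseteq> C"
    proof
      fix W assume "W \<in> \<Psi> ` C"
      then obtain Y :: "'h \<Rightarrow>\<^sub>L 'h" where Y: "norm Y \<le> \<rho>" "\<And>f g. inner (Y f) g = inner f (Y g)"
        "\<And>T. T o\<^sub>L S = S o\<^sub>L T \<Longrightarrow> T o\<^sub>L Y = Y o\<^sub>L T" and W: "W = \<Psi> Y"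
        by (auto simp: C_def)
      have "norm (Y o\<^sub>L Y) \<le> \<rho> * \<rho>"
        using norm_blinfun_compose[of Y Y] mult_mono[OF Y(1) Y(1) \<rho>(1) norm_ge_zero] by linarith
      then have "norm (X + (Y o\<^sub>L Y)) \<le> r + \<rho> * \<rho>"
        using norm_triangle_ineq[of X "Y o\<^sub>L Y"] X by linarith
      then have "norm W \<le> \<rho>"
        by (simp add: W \<Psi>_def \<rho>_eq)
      moreover have "inner (W f) g = inner f (W g)" for f g
        by (simp add: W \<Psi>_def X_def blinfun.bilinear_simps inner_add inner_diff Y(2) sym)
      moreover have "T o\<^sub>L W = W o\<^sub>L T" if T: "T o\<^sub>L S = S o\<^sub>L T" for T
      proof (rule blinfun_eqI)
        fix f
        have "T (S f) = S (T f)" "T (Y f) = Y (T f)" for f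
          using arg_cong[OF T, of "\<lambda>Z. blinfun_apply Z f"] arg_cong[OF Y(3)[OF T], of "\<lambda>Z. blinfun_apply Z f"]
          by simp_all
        then show "(T o\<^sub>L W) f = (W o\<^sub>L T) f"
          by (simp add: W \<Psi>_def X_def blinfun.bilinear_simps)
      qed
      ultimately show "W \<in> C" by (simp add: C_def)
    qed
  next
    fix Y Z assume YZ: "Y \<in> C" "Z \<in> C"
    \<comment> \<open>This form of the difference of two squares is valid for operators that need
      not commute.\<close>
    have "\<Psi> Y - \<Psi> Z = (1/2) *\<^sub>R ((Y o\<^sub>L (Y - Z)) + ((Y - Z) o\<^sub>L Z))"
      by (rule blinfun_eqI) (simp add: \<Psi>_def blinfun.bilinear_simps algebra_simps)
    moreover have "norm ((Y o\<^sub>L (Y - Z)) + ((Y - Z) o\<^sub>L Z)) \<le> \<rho> * norm (Y - Z) + norm (Y - Z) * \<rho>"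
    proof -
      have "norm Y \<le> \<rho>" "norm Z \<le> \<rho>" using YZ by (auto simp: C_def)
      then have "norm Y * norm (Y - Z) \<le> \<rho> * norm (Y - Z)" "norm (Y - Z) * norm Z \<le> norm (Y - Z) * \<rho>"
        by (auto intro: mult_right_mono mult_left_mono)
      with norm_blinfun_compose[of Y "Y - Z"] norm_blinfun_compose[of "Y - Z" Z] show ?thesis
        using norm_triangle_ineq[of "Y o\<^sub>L (Y - Z)" "(Y - Z) o\<^sub>L Z"] by linarith
    qed
    ultimately show "dist (\<Psi> Y) (\<Psi> Z) \<le> \<rho> * dist Y Z"
      by (simp add: dist_norm)
  qed
  then obtain Y :: "'h \<Rightarrow>\<^sub>L 'h" where Y: "norm Y \<le> \<rho>" "\<And>f g. inner (Y f) g = inner f (Y g)"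
    "\<And>T. T o\<^sub>L S = S o\<^sub>L T \<Longrightarrow> T o\<^sub>L Y = Y o\<^sub>L T" and fix_Y: "\<Psi> Y = Y"
    by (auto simp: C_def)
  define W where "W = id_blinfun - Y"
  have WW: "W (W f) = t *\<^sub>R S f" for f
  proof -
    have "X f + Y (Y f) = 2 *\<^sub>R Y f"
      using arg_cong[OF fix_Y, of "\<lambda>Z. 2 *\<^sub>R blinfun_apply Z f"] by (simp add: \<Psi>_def blinfun.bilinear_simps)
    then show ?thesis
      by (simp add: W_def X_def blinfun.bilinear_simps scaleR_2 algebra_simps)
  qed
  have W_sym: "inner (W f) g = inner f (W g)" for f g
    by (simp add: W_def blinfun.bilinear_simps inner_diff Y(2))
  \<comment> \<open>Inversion of \<open>W = 1 - Y\<close>: the equation \<open>1 + Y Z = Z\<close>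
    says \<open>W Z = 1\<close>, and its left side is a contraction in \<open>Z\<close> because
    \<open>Y\<close> has norm at most \<open>\<rho> < 1\<close>.\<close>
  have "\<exists>!Z. id_blinfun + (Y o\<^sub>L Z) = Z"
  proof (rule banach_fix_type[OF \<rho>], intro allI)
    fix Z Z' :: "'h \<Rightarrow>\<^sub>L 'h"
    have "(id_blinfun + (Y o\<^sub>L Z)) - (id_blinfun + (Y o\<^sub>L Z')) = Y o\<^sub>L (Z - Z')"
      by (rule blinfun_eqI) (simp add: blinfun.bilinear_simps)
    moreover have "norm (Y o\<^sub>L (Z - Z')) \<le> \<rho> * norm (Z - Z')"
      using norm_blinfun_compose[of Y "Z - Z'"] mult_right_mono[OF Y(1) norm_ge_zero[of "Z - Z'"]] by linarith
    ultimately show "dist (id_blinfun + (Y o\<^sub>L Z)) (id_blinfun + (Y o\<^sub>L Z')) \<le> \<rho> * dist Z Z'"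
      by (simp add: dist_norm)
  qed
  then obtain Z where Z: "id_blinfun + (Y o\<^sub>L Z) = Z" by blast
  have WZ: "W (Z f) = f" for f
    using arg_cong[OF Z, of "\<lambda>Z. blinfun_apply Z f"] by (simp add: W_def blinfun.bilinear_simps algebra_simps)
  \<comment> \<open>A right inverse of a symmetric operator is itself symmetric, and is therefore
    also a left inverse.\<close>
  have Z_sym: "inner (Z f) g = inner f (Z g)" for f g
    by (metis WZ W_sym)
  have ZW: "Z (W f) = f" for f
    by (rule vector_eq_rdot[THEN iffD1]) (metis WZ W_sym Z_sym)
  \<comment> \<open>Writing \<open>f = W (Z f)\<close> reduces this to positivity of
    \<open>W = 1 - Y\<close>, which holds because \<open>Y\<close> does not increase norms.\<close>
  have Z_pos: "0 \<le> inner (Z f) f" for f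
  proof -
    have "inner (Z f) (Y (Z f)) \<le> norm (Z f) * norm (Y (Z f))"
      by (rule norm_cauchy_schwarz)
    also have "\<dots> \<le> norm (Z f) * (1 * norm (Z f))"
    proof (rule mult_left_mono[OF _ norm_ge_zero])
      have "norm Y * norm (Z f) \<le> 1 * norm (Z f)"
        by (rule mult_right_mono) (use Y(1) \<rho>(2) in auto)
      then show "norm (Y (Z f)) \<le> 1 * norm (Z f)"
        using norm_blinfun[of Y "Z f"] by linarith
    qed
    finally have "0 \<le> inner (Z f) (W (Z f))"
      by (simp add: W_def blinfun.bilinear_simps inner_diff_right power2_norm_eq_inner[symmetric] power2_eq_square)
    then show ?thesis by (simp add: WZ)
  qed
  \<comment> \<open>Since \<open>W W = t S\<close> and \<open>Z\<close> inverts \<open>W\<close>,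
    the square of \<open>Z\<close> is the inverse of \<open>t S\<close>; the factor
    \<open>sqrt t\<close> removes \<open>t\<close>.\<close>
  define R where "R = sqrt t *\<^sub>R Z"
  show ?thesis
  proof (rule that)
    show "inner (R f) g = inner f (R g)" "0 \<le> inner (R f) f" for f g
      using t Z_pos[of f] by (simp_all add: R_def blinfun.bilinear_simps Z_sym)
    have "S f = (1/t) *\<^sub>R W (W f)" for f
      using t by (simp add: WW)
    then show "S o\<^sub>L (R o\<^sub>L R) = id_blinfun" "(R o\<^sub>L R) o\<^sub>L S = id_blinfun"
      using t by (auto intro!: blinfun_eqI simp: R_def blinfun.bilinear_simps WZ ZW)
    fix T :: "'h \<Rightarrow>\<^sub>L 'h" assume T: "T o\<^sub>L S = S o\<^sub>L T"
    have "T (Y f) = Y (T f)" for f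
      using Y(3)[OF T] by (metis blinfun_apply_blinfun_compose)
    then have TW: "T (W f) = W (T f)" for f
      by (simp add: W_def blinfun.bilinear_simps)
    have "T (Z f) = Z (T f)" for f
      by (metis TW WZ ZW)
    then show "T o\<^sub>L R = R o\<^sub>L T"
      by (auto intro!: blinfun_eqI simp: R_def blinfun.bilinear_simps)
  qed
qed

section \<open>Translations and density\<close>

lemma AE_lborel_shift:
  fixes c :: "'a::euclidean_space"
  shows "AE x in lborel. P x \<Longrightarrow> AE x in lborel. P (c + x)"
  using AE_distrD[of "(+) c" lborel borel P, unfolded lborel_distr_plus] by simp

lemma ae_eq_shift: "f =\<^sub>a\<^sub>e g \<Longrightarrow> (\<lambda>x. f (c + x)) =\<^sub>a\<^sub>e (\<lambda>x. g (c + x))"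
  unfolding ae_eq_def by (rule AE_lborel_shift)

lemma integrable_lborel_shift:
  fixes c :: "'a::euclidean_space" and f :: "'a \<Rightarrow> 'b::{banach, second_countable_topology}"
  assumes f: "integrable lborel f"
  shows "integrable lborel (\<lambda>x. f (c + x))"
  by (rule integrable_distr[of "(+) c" lborel borel]) (use f in \<open>simp_all add: lborel_distr_plus\<close>)

lemma integral_lborel_shift:
  fixes c :: "'a::euclidean_space" and f :: "'a \<Rightarrow> 'b::{banach, second_countable_topology}"
  assumes [measurable]: "f \<in> borel_measurable borel"
  shows "(LINT x|lborel. f (c + x)) = (LINT x|lborel. f x)"
  using integral_distr[of "(+) c" lborel borel f] by (simp add: lborel_distr_plus)

lemma L2_shift: assumes "f \<in> L2" shows "(\<lambda>x. f (c + x)) \<in> L2"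
proof (rule L2_I)
  note [measurable] = L2_measurable[OF assms]
  show "(\<lambda>x. f (c + x)) \<in> borel_measurable borel" by measurable
  show "integrable lborel (\<lambda>x. (cmod (f (c + x)))\<^sup>2)"
    by (rule integrable_lborel_shift[OF L2_integrable[OF assms]])
qed

text \<open>The sign is opposite to that of \<open>translate\<close>: translation by l is
  \<open>shift (- l)\<close>.\<close>

lift_definition shift :: "'a::euclidean_space \<Rightarrow> 'a lsq \<Rightarrow> 'a lsq" is "\<lambda>c f x. f (c + x)"
  by (auto simp: L2_rel_def intro: L2_shift ae_eq_shift)

lemma abs_shift: "f \<in> L2 \<Longrightarrow> shift c (abs_lsq f) = abs_lsq (\<lambda>x. f (c + x))"
  by (rule shift.abs_eq) (auto simp: L2_rel_def)

lemma norm_shift [simp]: "norm (shift c u) = norm u"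
proof (cases u)
  fix f assume f: "u = abs_lsq f" "f \<in> L2"
  note [measurable] = L2_measurable[OF f(2)]
  have "(norm (shift c u))\<^sup>2 = (norm u)\<^sup>2"
    by (simp add: f abs_shift abs_norm_square L2_shift) (rule integral_lborel_shift[of "\<lambda>x. (cmod (f x))\<^sup>2"], measurable)
  then show ?thesis by (rule power2_eq_imp_eq) auto
qed

lemma shift_add: "shift c (u + v) = shift c u + shift c v"
  by transfer (rule L2_relI; simp add: L2_rel_def L2_add L2_shift)

lemma shift_diff: "shift c (u - v) = shift c u - shift c v"
  by transfer (rule L2_relI; simp add: L2_rel_def L2_diff L2_shift)

lemma shift_cscale: "shift c (cscale a u) = cscale a (shift c u)"
  by transfer (rule L2_relI; simp add: L2_rel_def L2_cmult L2_shift)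

lemma L2_indicator:
  assumes [measurable]: "A \<in> sets borel" and "emeasure lborel A < \<infinity>"
  shows "(indicator A :: 'a::euclidean_space \<Rightarrow> complex) \<in> L2"
proof (rule L2_I)
  have "(\<lambda>x. (cmod (indicator A x))\<^sup>2) = (indicator A :: 'a \<Rightarrow> real)"
    by (auto simp: fun_eq_iff indicator_def)
  with assms show "integrable lborel (\<lambda>x. (cmod (indicator A x :: complex))\<^sup>2)"
    by simp
qed measurable

lemma norm_indicator_square:
  assumes [measurable]: "A \<in> sets borel" and "emeasure lborel A < \<infinity>"
  shows "(norm (abs_lsq (indicator A)))\<^sup>2 = measure lborel A"
proof -
  have "(\<lambda>x. (cmod (indicator A x))\<^sup>2) = (indicator A :: 'a \<Rightarrow> real)"
    by (auto simp: fun_eq_iff indicator_def)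
  then show ?thesis
    using abs_norm_square[OF L2_indicator[OF assms]] by simp
qed

lemma L2_dominated_convergence:
  fixes g :: "'a::euclidean_space \<Rightarrow> complex"
  assumes g: "g \<in> L2" and s: "\<And>n. s n \<in> borel_measurable borel" and f: "f \<in> borel_measurable borel"
    and dom: "\<And>n x. cmod (s n x) \<le> cmod (g x)"
    and lim: "\<And>x. (\<lambda>n. s n x) \<longlonglongrightarrow> f x"
  shows "(\<lambda>n. abs_lsq (s n)) \<longlonglongrightarrow> abs_lsq f"
proof -
  note [measurable] = s f
  have le: "cmod (f x) \<le> cmod (g x)" for x
    by (rule Lim_bounded[OF tendsto_norm[OF lim]]) (use dom in auto)
  have fL2: "f \<in> L2" by (rule L2_bound[OF g f, where C=1]) (use le in auto)
  have sL2: "s n \<in> L2" for n by (rule L2_bound[OF g s, where C=1]) (use dom in auto)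
  have "(\<lambda>n. LINT x|lborel. (cmod (s n x - f x))\<^sup>2) \<longlonglongrightarrow> (LINT x|(lborel :: 'a measure). (0::real))"
  proof (rule integral_dominated_convergence)
    show "integrable lborel (\<lambda>x. 4 * (cmod (g x))\<^sup>2)"
      using L2_integrable[OF g] by simp
    show "AE x in lborel. (\<lambda>n. (cmod (s n x - f x))\<^sup>2) \<longlonglongrightarrow> 0"
    proof (rule AE_I2)
      fix x
      have "(\<lambda>n. (cmod (s n x - f x))\<^sup>2) \<longlonglongrightarrow> (cmod (f x - f x))\<^sup>2"
        by (intro tendsto_intros lim)
      then show "(\<lambda>n. (cmod (s n x - f x))\<^sup>2) \<longlonglongrightarrow> 0" by simp
    qed
    fix n
    show "AE x in lborel. norm ((cmod (s n x - f x))\<^sup>2) \<le> 4 * (cmod (g x))\<^sup>2"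
    proof (rule AE_I2)
      fix x
      have "cmod (s n x - f x) \<le> 2 * cmod (g x)"
        using norm_triangle_ineq4[of "s n x" "f x"] dom[of n x] le[of x] by linarith
      then have "(cmod (s n x - f x))\<^sup>2 \<le> (2 * cmod (g x))\<^sup>2"
        by (intro power_mono) auto
      then show "norm ((cmod (s n x - f x))\<^sup>2) \<le> 4 * (cmod (g x))\<^sup>2"
        by (simp add: power_mult_distrib)
    qed
  qed measurable
  then have "(\<lambda>n. (norm (abs_lsq (s n) - abs_lsq f))\<^sup>2) \<longlonglongrightarrow> 0"
    by (simp add: abs_minus sL2 fL2 abs_norm_square L2_diff)
  then have "(\<lambda>n. sqrt ((norm (abs_lsq (s n) - abs_lsq f))\<^sup>2)) \<longlonglongrightarrow> sqrt 0"
    by (rule tendsto_real_sqrt)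
  then show ?thesis
    by (subst tendsto_dist_iff) (simp add: dist_norm)
qed

text \<open>Reduces a closed linear property to indicators of open sets. Outer regularity reaches
  Borel sets of finite measure, linearity reaches simple functions, and dominated convergence
  reaches every class.\<close>

lemma lsq_dense_open_indicators:
  fixes U :: "'a::euclidean_space lsq set"
  assumes "closed U" and add: "\<And>u v. u \<in> U \<Longrightarrow> v \<in> U \<Longrightarrow> u + v \<in> U"
    and cscale: "\<And>a u. u \<in> U \<Longrightarrow> cscale a u \<in> U"
    and ind: "\<And>G. open G \<Longrightarrow> emeasure lborel G < \<infinity> \<Longrightarrow> abs_lsq (indicator G) \<in> U"
  shows "u \<in> U"
proof -
  have zero: "0 \<in> U"
  proof -
    have "(indicator {} :: 'a \<Rightarrow> complex) = (\<lambda>x. 0)" by (simp add: fun_eq_iff)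
    then show ?thesis using ind[of "{}"] by (simp add: zero_lsq_def)
  qed
  have sum: "(\<And>k. k \<in> F \<Longrightarrow> w k \<in> U) \<Longrightarrow> (\<Sum>k\<in>F. w k) \<in> U" for w :: "complex \<Rightarrow> 'a lsq" and F
    by (induction F rule: infinite_finite_induct) (auto intro: add zero)
  have borel: "abs_lsq (indicator A) \<in> U" if A: "A \<in> sets borel" "emeasure lborel A < \<infinity>" for A
  proof -
    have "\<exists>w\<in>U. dist w (abs_lsq (indicator A)) < e" if e: "e > 0" for e
    proof -
      obtain G where G: "open G" "A \<subseteq> G" "emeasure lborel (G - A) < ennreal (e\<^sup>2)"
        using outer_regular_lborel[OF A(1), of "e\<^sup>2"] e by auto
      note [measurable] = A(1) borel_open[OF G(1)]
      have GA: "emeasure lborel (G - A) < \<infinity>"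
        using G(3) by (rule less_trans) simp
      have "emeasure lborel G = emeasure lborel (A \<union> (G - A))"
        using G(2) by (intro arg_cong[of _ _ "emeasure lborel"]) auto
      also have "\<dots> \<le> emeasure lborel A + emeasure lborel (G - A)"
        by (rule emeasure_subadditive) auto
      also have "\<dots> < \<infinity>" using A(2) GA by simp
      finally have Gf: "emeasure lborel G < \<infinity>" .
      have "(indicator G :: 'a \<Rightarrow> complex) \<in> L2" "(indicator A :: 'a \<Rightarrow> complex) \<in> L2"
        using A Gf by (auto intro: L2_indicator)
      moreover have "(\<lambda>x. indicator G x - indicator A x) = (indicator (G - A) :: 'a \<Rightarrow> complex)"
        using G(2) by (auto simp: fun_eq_iff indicator_def)
      ultimately have "abs_lsq (indicator G) - abs_lsq (indicator A) = abs_lsq (indicator (G - A))"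
        by (simp add: abs_minus)
      then have "(dist (abs_lsq (indicator G)) (abs_lsq (indicator A)))\<^sup>2 = measure lborel (G - A)"
        using GA by (simp add: dist_norm norm_indicator_square)
      also have "\<dots> < e\<^sup>2"
        using G(3) GA by (simp add: emeasure_eq_ennreal_measure ennreal_less_iff)
      finally have "dist (abs_lsq (indicator G)) (abs_lsq (indicator A)) < e"
        using e by (intro power2_less_imp_less[where y=e]) auto
      with ind[OF G(1) Gf] show ?thesis by blast
    qed
    then have "abs_lsq (indicator A) \<in> closure U"
      by (auto simp: closure_approachable)
    with \<open>closed U\<close> show ?thesis by simp
  qed
  obtain f where f: "u = abs_lsq f" "f \<in> L2" by (cases u)
  note [measurable] = L2_measurable[OF f(2)]
  obtain s where s: "\<And>i. simple_function lborel (s i)" "\<And>x. (\<lambda>i. s i x) \<longlonglongrightarrow> f x"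
    "\<And>i x. cmod (s i x) \<le> 2 * cmod (f x)"
    using borel_measurable_implies_sequence_metric[of f lborel 0] by auto
  have [measurable]: "s i \<in> borel_measurable borel" for i
    using borel_measurable_simple_function[OF s(1)[of i]] by simp
  have sL2: "s i \<in> L2" for i
    by (rule L2_bound[OF f(2), of _ 2]) (use s(3) in auto)
  have "abs_lsq (s i) \<in> U" for i
  proof -
    have fin: "finite (range (s i))"
      using simple_functionD(1)[OF s(1)[of i]] by simp
    have lev: "s i -` {y} \<in> sets borel" for y
      using measurable_sets[of "s i" borel borel "{y}"] by simp
    have lev_fin: "emeasure lborel (s i -` {y}) < \<infinity>" if "y \<noteq> 0" for y
    proof -
      have "integrable lborel (\<lambda>x. (cmod y)\<^sup>2 * indicator (s i -` {y}) x :: real)"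
        by (rule Bochner_Integration.integrable_bound[OF L2_integrable[OF sL2[of i]]])
          (use lev in \<open>auto simp: indicator_def\<close>)
      then have "integrable lborel (indicator (s i -` {y}) :: 'a \<Rightarrow> real)"
        using that by simp
      then show ?thesis by (simp add: integrable_indicator_iff)
    qed
    \<comment> \<open>The value 0 is left out: its level set may have infinite measure, and it
      contributes nothing to the sum.\<close>
    have "s i = (\<lambda>x. \<Sum>y\<in>range (s i) - {0}. y * indicator (s i -` {y}) x)"
    proof
      fix x
      have "(\<Sum>y\<in>range (s i) - {0}. y * indicator (s i -` {y}) x) = (\<Sum>y\<in>range (s i) - {0}. if y = s i x then y else 0)"
        by (intro sum.cong) (auto simp: indicator_def)
      also have "\<dots> = s i x" using fin by simp
      finally show "s i x = (\<Sum>y\<in>range (s i) - {0}. y * indicator (s i -` {y}) x)" by simp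
    qed
    then have "abs_lsq (s i) = abs_lsq (\<lambda>x. \<Sum>y\<in>range (s i) - {0}. y * indicator (s i -` {y}) x)"
      by (rule arg_cong)
    also have "\<dots> = (\<Sum>y\<in>range (s i) - {0}. cscale y (abs_lsq (indicator (s i -` {y}))))"
    proof -
      have "(indicator (s i -` {y}) :: 'a \<Rightarrow> complex) \<in> L2" if "y \<noteq> 0" for y
        by (rule L2_indicator[OF lev lev_fin[OF that]])
      then show ?thesis
        by (subst abs_sum[symmetric]) (auto simp: abs_cscale intro!: L2_cmult sum.cong)
    qed
    also have "\<dots> \<in> U"
      by (intro sum cscale borel lev lev_fin) auto
    finally show ?thesis .
  qed
  moreover have "(\<lambda>n. abs_lsq (s n)) \<longlonglongrightarrow> u"
    unfolding f(1)
  proof (rule L2_dominated_convergence)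
    show "(\<lambda>x. 2 * f x) \<in> L2" using f(2) by (rule L2_cmult)
    show "cmod (s n x) \<le> cmod (2 * f x)" for n x using s(3) by (simp add: norm_mult)
  qed (use s(2) in auto)
  ultimately show ?thesis
    using \<open>closed U\<close> by (meson closed_sequential_limits)
qed

text \<open>For an open set, the indicator function is lower semicontinuous, which is what makes the pointwise
  limit of the correlations below available.\<close>

lemma shift_tendsto:
  fixes u :: "'a::euclidean_space lsq"
  assumes z: "z \<longlonglongrightarrow> 0"
  shows "(\<lambda>n. shift (z n) u) \<longlonglongrightarrow> u"
proof -
  define U where "U = {u. (\<lambda>n. shift (z n) u) \<longlonglongrightarrow> u}"
  have "u \<in> U"
  proof (rule lsq_dense_open_indicators)
    \<comment> \<open>Shifts are isometries, so approximation by a member of \<open>U\<close> is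
      uniform in the shift and three errors of size e/3 suffice.\<close>
    have "u \<in> U" if u: "u \<in> closure U" for u
    proof -
      have "\<exists>N. \<forall>n\<ge>N. dist (shift (z n) u) u < e" if e: "e > 0" for e
      proof -
        obtain v where v: "v \<in> U" "dist v u < e/3"
          using u e by (auto simp: closure_approachable dest!: spec[of _ "e/3"])
        then have "(\<lambda>n. shift (z n) v) \<longlonglongrightarrow> v" by (simp add: U_def)
        then obtain N where N: "\<And>n. n \<ge> N \<Longrightarrow> dist (shift (z n) v) v < e/3"
          using e by (metis lim_sequentially divide_pos_pos zero_less_numeral)
        have "dist (shift (z n) u) u < e" if "n \<ge> N" for n
        proof -
          have "dist (shift (z n) u) (shift (z n) v) = dist u v"
            by (simp add: dist_norm shift_diff[symmetric])
          with N[OF that] v(2) show ?thesis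
            using dist_triangle[of "shift (z n) u" u "shift (z n) v"] dist_triangle[of "shift (z n) v" u v]
            by (simp add: dist_commute)
        qed
        then show ?thesis by blast
      qed
      then show ?thesis by (simp add: U_def lim_sequentially)
    qed
    then show "closed U" by (metis closure_subset closure_subset_eq subsetI)
    show "u + v \<in> U" if "u \<in> U" "v \<in> U" for u v
      using that by (auto simp: U_def shift_add intro: tendsto_add)
    show "cscale a u \<in> U" if "u \<in> U" for a u
      using that by (auto simp: U_def shift_cscale intro: bounded_linear.tendsto[OF bounded_linear_cscale])
    fix G :: "'a set" assume G: "open G" "emeasure lborel G < \<infinity>"
    note [measurable] = borel_open[OF G(1)]
    let ?g = "indicator G :: 'a \<Rightarrow> complex"
    have gL2: "?g \<in> L2" by (intro L2_indicator G) measurable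
    have sL2: "(\<lambda>x. ?g (z n + x)) \<in> L2" for n by (rule L2_shift[OF gL2])
    have "(\<lambda>n. LINT x|lborel. indicator G (z n + x) * indicator G x) \<longlonglongrightarrow> (LINT x|lborel. (indicator G x :: real))"
    proof (rule integral_dominated_convergence)
      show "integrable lborel (indicator G :: 'a \<Rightarrow> real)" using G by (simp add: integrable_indicator_iff)
      show "AE x in lborel. (\<lambda>n. indicator G (z n + x) * indicator G x) \<longlonglongrightarrow> (indicator G x :: real)"
      proof (rule AE_I2)
        fix x :: 'a
        show "(\<lambda>n. indicator G (z n + x) * indicator G x) \<longlonglongrightarrow> (indicator G x :: real)"
        proof (cases "x \<in> G")
          case True
          have "(\<lambda>n. z n + x) \<longlonglongrightarrow> 0 + x"
            by (intro tendsto_intros z)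
          then have "\<forall>\<^sub>F n in sequentially. z n + x \<in> G"
            using G(1) True by (auto dest: topological_tendstoD)
          then have "\<forall>\<^sub>F n in sequentially. indicator G (z n + x) * indicator G x = (indicator G x :: real)"
            by eventually_elim simp
          then show ?thesis by (rule tendsto_eventually)
        qed simp
      qed
    qed (auto simp: indicator_def)
    moreover have "inner (shift (z n) (abs_lsq ?g)) (abs_lsq ?g) = (LINT x|lborel. indicator G (z n + x) * indicator G x)" for n
    proof -
      have "cinner (shift (z n) (abs_lsq ?g)) (abs_lsq ?g) = (LINT x|lborel. complex_of_real (indicator G (z n + x) * indicator G x))"
        by (simp add: abs_shift gL2 sL2 abs_cinner l2_inner_def)
          (intro Bochner_Integration.integral_cong; simp add: indicator_def)
      then show ?thesis by (simp add: inner_lsq_def integral_complex_of_real del: of_real_mult)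
    qed
    ultimately have lim: "(\<lambda>n. inner (shift (z n) (abs_lsq ?g)) (abs_lsq ?g)) \<longlonglongrightarrow> (norm (abs_lsq ?g))\<^sup>2"
      using G by (simp add: norm_indicator_square)
    \<comment> \<open>A shift preserves the norm, so the squared distance depends only on the
      correlation, and convergence of the correlation to the squared norm is convergence in
      norm.\<close>
    have "(\<lambda>n. (norm (shift (z n) (abs_lsq ?g) - abs_lsq ?g))\<^sup>2)
      = (\<lambda>n. 2 * (norm (abs_lsq ?g))\<^sup>2 - 2 * inner (shift (z n) (abs_lsq ?g)) (abs_lsq ?g))"
      by (simp add: power2_norm_eq_inner[of "_ - _"] inner_diff inner_commute power2_norm_eq_inner[of "shift _ _", symmetric, simplified] power2_norm_eq_inner[of "abs_lsq _", symmetric])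
    also have "\<dots> \<longlonglongrightarrow> 2 * (norm (abs_lsq ?g))\<^sup>2 - 2 * (norm (abs_lsq ?g))\<^sup>2"
      by (intro tendsto_intros lim)
    finally have "(\<lambda>n. sqrt ((norm (shift (z n) (abs_lsq ?g) - abs_lsq ?g))\<^sup>2)) \<longlonglongrightarrow> sqrt 0"
      by (intro tendsto_real_sqrt) simp
    then show "abs_lsq ?g \<in> U"
      by (simp add: U_def tendsto_dist_iff[of "\<lambda>n. shift (z n) _"] dist_norm)
  qed
  then show ?thesis by (simp add: U_def)
qed

section \<open>The Fourier transform of integrable functions\<close>

lemma expo_cis: "expo l x = cis (- (2 * pi * (l \<bullet> x)))"
  by (simp add: expo_def cis_conv_exp mult_ac)

lemma expo_commute: "expo l x = expo x l"
  by (simp add: expo_cis inner_commute)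

lemma norm_expo [simp]: "cmod (expo l x) = 1"
  by (simp add: expo_cis)

lemma expo_add_right: "expo l (x + y) = expo l x * expo l y"
  by (simp add: expo_cis cis_mult inner_add_right algebra_simps)

lemma cnj_expo: "cnj (expo l x) = expo l (- x)"
  by (simp add: expo_cis cis_cnj)

lemma expo_minus_mult: "expo l (- x) * expo l x = 1"
  by (simp add: expo_cis cis_mult)

lemma borel_measurable_expo [measurable (raw)]:
  assumes "f \<in> borel_measurable M" "g \<in> borel_measurable M"
  shows "(\<lambda>x. expo (f x) (g x)) \<in> borel_measurable M"
  by (rule borel_measurable_continuous_Pair[OF assms])
    (auto simp: expo_def intro!: continuous_intros)

lemma ft_L1_expo: "ft_L1 f w = (LINT x|lborel. f x * expo w x)"
  by (simp add: ft_L1_def expo_def inner_commute)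

lemma integrable_mult_expo:
  fixes f :: "'a::euclidean_space \<Rightarrow> complex"
  assumes "integrable lborel f"
  shows "integrable lborel (\<lambda>x. f x * expo w x)"
  by (rule Bochner_Integration.integrable_bound[OF assms])
    (use borel_measurable_integrable[OF assms] in \<open>auto simp: norm_mult\<close>)

lemma borel_measurable_ft_L1 [measurable (raw)]:
  assumes [measurable]: "f \<in> borel_measurable borel"
  shows "ft_L1 f \<in> borel_measurable borel"
  unfolding ft_L1_expo[abs_def] by measurable

lemma norm_ft_L1_le: "cmod (ft_L1 f w) \<le> (LINT x|lborel. cmod (f x))"
  unfolding ft_L1_expo using integral_norm_bound[of lborel "\<lambda>x. f x * expo w x"] by (simp add: norm_mult)

lemma integrable_ft_L1_mult:
  fixes f g :: "'a::euclidean_space \<Rightarrow> complex"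
  assumes "f \<in> borel_measurable borel" "integrable lborel g"
  shows "integrable lborel (\<lambda>w. ft_L1 f w * g w)"
proof (rule Bochner_Integration.integrable_bound)
  note [measurable] = assms(1) borel_measurable_integrable[OF assms(2)]
  show "integrable lborel (\<lambda>w. (LINT x|lborel. cmod (f x)) * cmod (g w))"
    using assms(2) by (intro integrable_mult_right integrable_norm)
  show "AE w in lborel. norm (ft_L1 f w * g w) \<le> norm ((LINT x|lborel. cmod (f x)) * cmod (g w))"
    by (auto simp: norm_mult intro!: mult_right_mono norm_ft_L1_le order_trans[OF norm_ft_L1_le abs_ge_self])
qed (use assms in measurable)

text \<open>Fubini's theorem, together with the symmetry of the kernel \<open>expo w x\<close> in
  its two arguments.\<close>

lemma ft_L1_multiplication:
  fixes f g :: "'a::euclidean_space \<Rightarrow> complex"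
  assumes f: "integrable lborel f" and g: "integrable lborel g"
  shows "(LINT w|lborel. ft_L1 f w * g w) = (LINT x|lborel. f x * ft_L1 g x)"
proof -
  note [measurable] = borel_measurable_integrable[OF f] borel_measurable_integrable[OF g]
  have int: "integrable (lborel \<Otimes>\<^sub>M lborel) (\<lambda>(x, w). f x * g w * expo w x)"
  proof (rule lborel_pair.Fubini_integrable)
    show "integrable lborel (\<lambda>x. LINT w|lborel. norm (case (x, w) of (x, w) \<Rightarrow> f x * g w * expo w x))"
      using f by (simp add: norm_mult integrable_norm)
    show "AE x in lborel. integrable lborel (\<lambda>w. case (x, w) of (x, w) \<Rightarrow> f x * g w * expo w x)"
    proof (rule AE_I2)
      fix x
      show "integrable lborel (\<lambda>w. case (x, w) of (x, w) \<Rightarrow> f x * g w * expo w x)"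
        using integrable_mult_right[OF integrable_mult_expo[OF g, of x], of "f x"]
        by (simp add: expo_commute[of x] mult.assoc)
    qed
  qed measurable
  have "(LINT w|lborel. ft_L1 f w * g w) = (LINT w|lborel. LINT x|lborel. f x * g w * expo w x)"
  proof (rule Bochner_Integration.integral_cong[OF refl])
    fix w
    show "ft_L1 f w * g w = (LINT x|lborel. f x * g w * expo w x)"
      unfolding ft_L1_expo Bochner_Integration.integral_mult_left_zero[symmetric]
      by (simp only: mult_ac)
  qed
  also have "\<dots> = (LINT x|lborel. LINT w|lborel. f x * g w * expo w x)"
    by (rule lborel_pair.Fubini_integral[OF int])
  also have "\<dots> = (LINT x|lborel. f x * ft_L1 g x)"
    by (simp add: ft_L1_expo mult.assoc expo_commute)
  finally show ?thesis .
qed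

text \<open>The function \<open>a\<close> is the convolution of f with the reflected conjugate of f,
  so its transform is the product of the transform of f with its own conjugate. It presents
  \<open>|ft_L1 f|^2\<close> as the transform of an integrable function, to which the multiplication
  formula applies.\<close>

lemma autocorrelation:
  fixes f :: "'a::euclidean_space \<Rightarrow> complex"
  assumes f: "integrable lborel f"
  defines "a \<equiv> \<lambda>z. LINT x|lborel. f (x + z) * cnj (f x)"
  shows "integrable lborel a" "ft_L1 a w = of_real ((cmod (ft_L1 f w))\<^sup>2)"
proof -
  note [measurable] = borel_measurable_integrable[OF f]
  have sh: "integrable lborel (\<lambda>z. f (x + z))" for x
    by (rule integrable_lborel_shift[OF f])
  have int: "integrable (lborel \<Otimes>\<^sub>M lborel) (\<lambda>(x, z). f (x + z) * cnj (f x) * expo w z)" for w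
  proof (rule lborel_pair.Fubini_integrable)
    have "(LINT z|lborel. cmod (f (x + z))) = (LINT z|lborel. cmod (f z))" for x
      by (rule integral_lborel_shift[of "\<lambda>z. cmod (f z)"]) measurable
    then show "integrable lborel (\<lambda>x. LINT z|lborel. norm (case (x, z) of (x, z) \<Rightarrow> f (x + z) * cnj (f x) * expo w z))"
      using f by (simp add: norm_mult integrable_norm)
    show "AE x in lborel. integrable lborel (\<lambda>z. case (x, z) of (x, z) \<Rightarrow> f (x + z) * cnj (f x) * expo w z)"
    proof (rule AE_I2)
      fix x
      show "integrable lborel (\<lambda>z. case (x, z) of (x, z) \<Rightarrow> f (x + z) * cnj (f x) * expo w z)"
        using integrable_mult_left[OF integrable_mult_expo[OF sh[of x], of w], of "cnj (f x)"]
        by (simp add: mult_ac)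
    qed
  qed measurable
  \<comment> \<open>At frequency 0 the exponential is 1, so the joint integrability just shown gives
    that of \<open>a\<close>.\<close>
  have "integrable lborel (\<lambda>z. LINT x|lborel. f (x + z) * cnj (f x) * expo 0 z)"
    using lborel_pair.integrable_snd[OF int[of 0]] by simp
  then show "integrable lborel a"
    by (simp add: a_def expo_cis)
  have "ft_L1 a w = (LINT z|lborel. LINT x|lborel. f (x + z) * cnj (f x) * expo w z)"
    by (simp add: ft_L1_expo a_def flip: Bochner_Integration.integral_mult_left_zero)
  also have "\<dots> = (LINT x|lborel. LINT z|lborel. f (x + z) * cnj (f x) * expo w z)"
    by (rule lborel_pair.Fubini_integral[OF int])
  also have "\<dots> = (LINT x|lborel. cnj (f x * expo w x) * ft_L1 f w)"
  proof (rule Bochner_Integration.integral_cong[OF refl])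
    fix x
    have "(LINT z|lborel. f (x + z) * cnj (f x) * expo w z) = (LINT z|lborel. cnj (f x * expo w x) * (f (x + z) * expo w (x + z)))"
    proof (rule Bochner_Integration.integral_cong[OF refl])
      fix z
      have "expo w z = cnj (expo w x) * expo w (x + z)"
        by (simp add: expo_add_right cnj_expo expo_minus_mult flip: mult.assoc)
      then show "f (x + z) * cnj (f x) * expo w z = cnj (f x * expo w x) * (f (x + z) * expo w (x + z))"
        by (simp add: mult_ac)
    qed
    also have "\<dots> = cnj (f x * expo w x) * (LINT z|lborel. f (x + z) * expo w (x + z))"
      by (rule integral_mult_right_zero)
    also have "(LINT z|lborel. f (x + z) * expo w (x + z)) = ft_L1 f w"
      unfolding ft_L1_expo by (rule integral_lborel_shift) measurable
    finally show "(LINT z|lborel. f (x + z) * cnj (f x) * expo w z) = cnj (f x * expo w x) * ft_L1 f w" .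
  qed
  also have "\<dots> = cnj (ft_L1 f w) * ft_L1 f w"
    unfolding ft_L1_expo Bochner_Integration.integral_mult_left_zero
    by (simp only: Bochner_Integration.integral_cnj)
  also have "\<dots> = of_real ((cmod (ft_L1 f w))\<^sup>2)"
    by (simp add: complex_norm_square[symmetric] mult.commute del: of_real_power)
  finally show "ft_L1 a w = of_real ((cmod (ft_L1 f w))\<^sup>2)" .
qed

section \<open>Gaussians and their Fourier transforms\<close>

lemma lborel_prod_Basis:
  fixes h :: "'a::euclidean_space \<Rightarrow> real \<Rightarrow> 'b::{real_normed_field,banach,second_countable_topology}"
  assumes h: "\<And>b. b \<in> Basis \<Longrightarrow> integrable lborel (h b)"
  shows "integrable (lborel :: 'a measure) (\<lambda>x. \<Prod>b\<in>Basis. h b (x \<bullet> b))"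
    and "(LINT x|(lborel :: 'a measure). (\<Prod>b\<in>Basis. h b (x \<bullet> b))) = (\<Prod>b\<in>Basis. (LINT t|lborel. h b t))"
proof -
  interpret product_sigma_finite "\<lambda>_::'a. lborel :: real measure" ..
  \<comment> \<open>Lebesgue measure is the image of the product of one-dimensional Lebesgue
    measures under this coordinate map, so a product of functions of single coordinates integrates
    factor by factor.\<close>
  let ?T = "\<lambda>f. \<Sum>b\<in>Basis. f b *\<^sub>R b :: 'a"
  have T: "?T \<in> (\<Pi>\<^sub>M b\<in>Basis. lborel) \<rightarrow>\<^sub>M borel" by measurable
  have m [measurable]: "h b \<in> borel_measurable borel" if "b \<in> Basis" for b
    using borel_measurable_integrable[OF h[OF that]] by simp
  have meas: "(\<lambda>x. \<Prod>b\<in>Basis. h b (x \<bullet> b)) \<in> borel_measurable borel"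
    by measurable
  have *: "(\<Prod>b\<in>Basis. h b (?T f \<bullet> b)) = (\<Prod>b\<in>Basis. h b (f b))" for f
    by (intro prod.cong refl) (simp add: inner_sum_left_Basis)
  show "integrable (lborel :: 'a measure) (\<lambda>x. \<Prod>b\<in>Basis. h b (x \<bullet> b))"
    unfolding lborel_eq[where 'a='a]
    by (subst integrable_distr_eq[OF T meas]) (simp add: * product_integrable_prod h)
  show "(LINT x|(lborel :: 'a measure). (\<Prod>b\<in>Basis. h b (x \<bullet> b))) = (\<Prod>b\<in>Basis. (LINT t|lborel. h b t))"
    unfolding lborel_eq[where 'a='a]
    by (subst integral_distr[OF T meas]) (simp add: * product_integral_prod h)
qed

text \<open>All three facts are read off the standard normal distribution: its density integrates to
  1, and its characteristic function is known.\<close>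

lemma gaussian_1d:
  shows "integrable lborel (\<lambda>x. exp (- x\<^sup>2 / 2) :: real)"
    and "(LINT x|lborel. exp (- x\<^sup>2 / 2) :: real) = sqrt (2 * pi)"
    and "(LINT x|lborel. complex_of_real (exp (- x\<^sup>2 / 2)) * cis (s * x)) = of_real (sqrt (2 * pi) * exp (- s\<^sup>2 / 2))"
proof -
  have eq: "exp (- x\<^sup>2 / 2) = sqrt (2 * pi) * std_normal_density x" for x
    by (simp add: std_normal_density_def)
  show "integrable lborel (\<lambda>x. exp (- x\<^sup>2 / 2) :: real)"
    unfolding eq using integrable_normal_density[of 1 0] by simp
  show "(LINT x|lborel. exp (- x\<^sup>2 / 2) :: real) = sqrt (2 * pi)"
    unfolding eq using integral_normal_density[of 1 0] by simp
  have "char std_normal_distribution s = (LINT x|lborel. complex_of_real (std_normal_density x) * cis (s * x))"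
    unfolding char_def by (subst integral_density) (auto simp: cis_conv_exp scaleR_conv_of_real)
  then have "(LINT x|lborel. complex_of_real (std_normal_density x) * cis (s * x)) = of_real (exp (- s\<^sup>2 / 2))"
    by (simp add: char_std_normal_distribution)
  then show "(LINT x|lborel. complex_of_real (exp (- x\<^sup>2 / 2)) * cis (s * x)) = of_real (sqrt (2 * pi) * exp (- s\<^sup>2 / 2))"
    unfolding eq of_real_mult mult.assoc integral_mult_right_zero by simp
qed

definition gaussian :: "'a::euclidean_space \<Rightarrow> real" where
  "gaussian x = exp (- (norm x)\<^sup>2 / 2)"

text \<open>This is (2 pi)^(d/2) exp(-2 pi^2 |z|^2), the Fourier transform of
  \<open>gaussian\<close>, kept as a product over coordinates so that its integral factors.\<close>

definition gaussian_ft :: "'a::euclidean_space \<Rightarrow> real" where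
  "gaussian_ft z = (\<Prod>b\<in>Basis. sqrt (2 * pi) * exp (- (2 * pi * (z \<bullet> b))\<^sup>2 / 2))"

lemma gaussian_prod: "gaussian x = (\<Prod>b\<in>Basis. exp (- (x \<bullet> b)\<^sup>2 / 2))"
proof -
  have "(norm x)\<^sup>2 = (\<Sum>b\<in>Basis. (x \<bullet> b)\<^sup>2)"
    unfolding power2_norm_eq_inner by (subst euclidean_inner) (simp add: power2_eq_square)
  then show ?thesis
    by (simp add: gaussian_def exp_sum sum_negf sum_divide_distrib flip: exp_sum)
qed

lemma borel_measurable_gaussian [measurable]: "gaussian \<in> borel_measurable borel"
  unfolding gaussian_def[abs_def] by measurable

lemma integrable_gaussian: "integrable lborel (gaussian :: 'a::euclidean_space \<Rightarrow> real)"
  unfolding gaussian_prod[abs_def] by (rule lborel_prod_Basis(1)[OF gaussian_1d(1)])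

lemma borel_measurable_cis [measurable]: "cis \<in> borel_measurable borel"
  by (rule borel_measurable_continuous_onI) (intro continuous_intros)

lemma cis_sum: "cis (\<Sum>i\<in>I. t i) = (\<Prod>i\<in>I. cis (t i))"
  by (induction I rule: infinite_finite_induct) (auto simp: cis_mult[symmetric])

lemma ft_L1_gaussian: "ft_L1 (\<lambda>x. of_real (gaussian x)) z = of_real (gaussian_ft z)"
proof -
  have "expo z x = (\<Prod>b\<in>Basis. cis (- (2 * pi * (z \<bullet> b)) * (x \<bullet> b)))" for x
    by (simp add: expo_cis euclidean_inner[of z x] sum_distrib_left mult.assoc flip: cis_sum sum_negf)
  then have "of_real (gaussian x) * expo z x
      = (\<Prod>b\<in>Basis. complex_of_real (exp (- (x \<bullet> b)\<^sup>2 / 2)) * cis (- (2 * pi * (z \<bullet> b)) * (x \<bullet> b)))" for x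
    by (simp add: gaussian_prod prod.distrib)
  moreover have int: "integrable lborel (\<lambda>t. complex_of_real (exp (- t\<^sup>2 / 2)) * cis (s * t))" for s
  proof (rule Bochner_Integration.integrable_bound[OF gaussian_1d(1)])
    show "AE t in lborel. norm (complex_of_real (exp (- t\<^sup>2 / 2)) * cis (s * t)) \<le> norm (exp (- t\<^sup>2 / 2))"
      by (simp add: norm_mult)
    show "(\<lambda>t. complex_of_real (exp (- t\<^sup>2 / 2)) * cis (s * t)) \<in> borel_measurable lborel"
      by measurable
  qed
  ultimately have "ft_L1 (\<lambda>x. of_real (gaussian x)) z
      = (\<Prod>b\<in>Basis. (LINT t|lborel. complex_of_real (exp (- t\<^sup>2 / 2)) * cis (- (2 * pi * (z \<bullet> b)) * t)))"
    unfolding ft_L1_expo by (simp only: lborel_prod_Basis(2)[OF int])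
  then show ?thesis
    by (simp only: gaussian_1d(3) gaussian_ft_def of_real_prod power2_minus)
qed

lemma gaussian_ft_nonneg: "0 \<le> gaussian_ft z"
  by (auto simp: gaussian_ft_def intro!: prod_nonneg)

text \<open>The mass equals \<open>gaussian 0\<close>, as Fourier inversion predicts. Unit mass is
  what makes the dilates of this function an averaging kernel in Plancherel's theorem.\<close>

lemma gaussian_ft_integral:
  "integrable lborel (gaussian_ft :: 'a::euclidean_space \<Rightarrow> real)"
  "(LINT z|lborel. gaussian_ft (z :: 'a)) = 1"
proof -
  have int: "integrable lborel (\<lambda>t::real. sqrt (2 * pi) * exp (- (2 * pi * t)\<^sup>2 / 2))"
    using lborel_integrable_real_affine[OF gaussian_1d(1), of "2 * pi" 0] by simp
  have "(LINT t|lborel. sqrt (2 * pi) * exp (- (2 * pi * t)\<^sup>2 / 2)) = 1"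
  proof -
    define J where "J = (LINT t|lborel. exp (- (2 * pi * t)\<^sup>2 / 2))"
    have "sqrt (2 * pi) = 2 * pi * J"
      using lborel_integral_real_affine[of "2 * pi" "\<lambda>x. exp (- x\<^sup>2 / 2)" 0]
      unfolding gaussian_1d(2) J_def by simp
    then have "sqrt (2 * pi) * sqrt (2 * pi) = 2 * pi * (sqrt (2 * pi) * J)"
      by (simp only: mult_ac)
    then have "sqrt (2 * pi) * J = 1"
      by simp
    then show ?thesis
      by (simp only: J_def integral_mult_right_zero)
  qed
  then show "(LINT z|lborel. gaussian_ft (z :: 'a)) = 1"
    unfolding gaussian_ft_def[abs_def] by (subst lborel_prod_Basis(2)[OF int]) simp
  show "integrable lborel (gaussian_ft :: 'a \<Rightarrow> real)"
    unfolding gaussian_ft_def[abs_def] by (rule lborel_prod_Basis(1)[OF int])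
qed

section \<open>Plancherel's theorem\<close>

lemma integral_lborel_scale:
  fixes f :: "'a::euclidean_space \<Rightarrow> 'b::{banach, second_countable_topology}"
  assumes [measurable]: "f \<in> borel_measurable borel" and "e > 0"
  shows "(LINT x|lborel. f x) = e ^ DIM('a) *\<^sub>R (LINT x|lborel. f (e *\<^sub>R x))"
  using assms(2) by (subst lborel_affine[of e 0]) (simp_all add: integral_density integral_distr)

lemma ft_L1_scale:
  assumes [measurable]: "f \<in> borel_measurable borel" and "e > 0"
  shows "ft_L1 f w = e ^ DIM('a) *\<^sub>R ft_L1 (\<lambda>x. f (e *\<^sub>R x)) (e *\<^sub>R w :: 'a::euclidean_space)"
  unfolding ft_L1_expo
  by (subst integral_lborel_scale[OF _ assms(2)]) (simp_all add: expo_cis mult_ac)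

lemma tendsto_gaussian_weight: "(\<lambda>n. gaussian ((1 / real (Suc n)) *\<^sub>R w)) \<longlonglongrightarrow> 1"
proof -
  have "(\<lambda>n. exp (- (norm ((1 / real (Suc n)) *\<^sub>R w))\<^sup>2 / 2)) \<longlonglongrightarrow> exp (- (norm (0 *\<^sub>R w))\<^sup>2 / 2)"
    by (intro tendsto_intros LIMSEQ_inverse_real_of_nat[unfolded inverse_eq_divide]) auto
  then show ?thesis by (simp add: gaussian_def)
qed

lemma mono_gaussian_weight: "mono (\<lambda>n. gaussian ((1 / real (Suc n)) *\<^sub>R w))"
proof (rule monoI)
  fix m n :: nat assume "m \<le> n"
  then have "norm ((1 / real (Suc n)) *\<^sub>R w) \<le> norm ((1 / real (Suc m)) *\<^sub>R w)"
    by (auto simp: divide_simps intro!: mult_left_mono)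
  then show "gaussian ((1 / real (Suc m)) *\<^sub>R w) \<le> gaussian ((1 / real (Suc n)) *\<^sub>R w)"
    by (auto simp: gaussian_def intro!: power_mono)
qed

text \<open>\<open>ft_L1 f\<close> is so far only known to be bounded; the Gaussian weight makes its
  square integrable. The multiplication formula then moves the transform from the autocorrelation to
  the weight, and the autocorrelation at z is an inner product of f with its shift by z.\<close>

lemma plancherel_weighted:
  fixes f :: "'a::euclidean_space \<Rightarrow> complex"
  assumes f: "integrable lborel f" and f2: "f \<in> L2" and e: "e > 0"
  shows "integrable lborel (\<lambda>w. gaussian (e *\<^sub>R w) * (cmod (ft_L1 f w))\<^sup>2)"
    and "complex_of_real (LINT w|lborel. gaussian (e *\<^sub>R w) * (cmod (ft_L1 f w))\<^sup>2)
      = (LINT u|lborel. cinner (shift (e *\<^sub>R u) (abs_lsq f)) (abs_lsq f) * of_real (gaussian_ft u))"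
proof -
  note [measurable] = L2_measurable[OF f2]
  define a where "a z = (LINT x|lborel. f (x + z) * cnj (f x))" for z
  have a: "integrable lborel a" "\<And>w. ft_L1 a w = of_real ((cmod (ft_L1 f w))\<^sup>2)"
    using autocorrelation[OF f] by (simp_all add: a_def[abs_def])
  note [measurable] = borel_measurable_integrable[OF a(1), simplified]
  have a_inner: "cinner (shift z (abs_lsq f)) (abs_lsq f) = a z" for z
    by (simp add: abs_shift abs_cinner f2 L2_shift l2_inner_def a_def) (simp add: add.commute)
  have int_scale: "integrable lborel (\<lambda>x. g (e *\<^sub>R x))"
    if "integrable lborel g" for g :: "'a \<Rightarrow> complex"
  proof -
    have [measurable]: "g \<in> borel_measurable borel"
      using borel_measurable_integrable[OF that] by simp
    have "integrable (density (distr lborel borel (\<lambda>x. 0 + e *\<^sub>R x)) (\<lambda>_. ennreal (\<bar>e\<bar> ^ DIM('a)))) g"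
      using that e by (subst (asm) lborel_affine[of e 0]) simp_all
    then have "integrable (distr lborel borel (\<lambda>x. 0 + e *\<^sub>R x)) (\<lambda>x. \<bar>e\<bar> ^ DIM('a) *\<^sub>R g x)"
      by (subst (asm) integrable_density) simp_all
    then have "integrable lborel (\<lambda>x. \<bar>e\<bar> ^ DIM('a) *\<^sub>R g (0 + e *\<^sub>R x))"
      by (subst (asm) integrable_distr_eq) simp_all
    then have "integrable lborel (\<lambda>x. inverse (\<bar>e\<bar> ^ DIM('a)) *\<^sub>R \<bar>e\<bar> ^ DIM('a) *\<^sub>R g (0 + e *\<^sub>R x))"
      by (rule integrable_scaleR_right)
    then show ?thesis
      using e by simp
  qed
  have K: "integrable lborel (\<lambda>w. complex_of_real (gaussian (w :: 'a)))"
    by (rule integrable_of_real[OF integrable_gaussian])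
  note Ke = int_scale[OF K]
  have eq: "complex_of_real (gaussian (e *\<^sub>R w) * (cmod (ft_L1 f w))\<^sup>2) = ft_L1 a w * of_real (gaussian (e *\<^sub>R w))" for w
    by (simp add: a mult.commute)
  have "integrable lborel (\<lambda>w. complex_of_real (gaussian (e *\<^sub>R w) * (cmod (ft_L1 f w))\<^sup>2))"
    unfolding eq by (rule integrable_ft_L1_mult[OF _ Ke]) measurable
  then show "integrable lborel (\<lambda>w. gaussian (e *\<^sub>R w) * (cmod (ft_L1 f w))\<^sup>2)"
    by (simp only: complex_of_real_integrable_eq)
  have "complex_of_real (LINT w|lborel. gaussian (e *\<^sub>R w) * (cmod (ft_L1 f w))\<^sup>2)
      = (LINT w|lborel. complex_of_real (gaussian (e *\<^sub>R w) * (cmod (ft_L1 f w))\<^sup>2))"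
    by (rule integral_complex_of_real[symmetric])
  also have "\<dots> = (LINT z|lborel. a z * ft_L1 (\<lambda>w. of_real (gaussian (e *\<^sub>R w))) z)"
    unfolding eq by (rule ft_L1_multiplication[OF a(1) Ke])
  also have "\<dots> = e ^ DIM('a) *\<^sub>R (LINT u|lborel. a (e *\<^sub>R u) * ft_L1 (\<lambda>w. of_real (gaussian (e *\<^sub>R w))) (e *\<^sub>R u))"
    by (rule integral_lborel_scale[OF _ e]) measurable
  also have "\<dots> = (LINT u|lborel. a (e *\<^sub>R u) * (e ^ DIM('a) *\<^sub>R ft_L1 (\<lambda>w. of_real (gaussian (e *\<^sub>R w))) (e *\<^sub>R u)))"
    by (simp flip: integral_scaleR_right)
  \<comment> \<open>The scaling rule for the transform, read backwards: the Jacobian and the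
    dilation cancel and leave the transform of the undilated Gaussian, independent of
    \<open>e\<close>.\<close>
  also have "\<dots> = (LINT u|lborel. a (e *\<^sub>R u) * of_real (gaussian_ft u))"
    by (subst ft_L1_scale[OF _ e, symmetric]) (simp_all add: ft_L1_gaussian)
  finally show "complex_of_real (LINT w|lborel. gaussian (e *\<^sub>R w) * (cmod (ft_L1 f w))\<^sup>2)
      = (LINT u|lborel. cinner (shift (e *\<^sub>R u) (abs_lsq f)) (abs_lsq f) * of_real (gaussian_ft u))"
    by (simp add: a_inner)
qed

text \<open>The transform of the autocorrelation of \<open>f\<close> is \<open>|ft_L1 f|\<^sup>2\<close>; integrating it against ever wider
  Gaussians amounts to averaging the autocorrelation near its value \<open>\<parallel>f\<parallel>\<^sup>2\<close> at the origin.\<close>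

theorem plancherel_L1:
  fixes f :: "'a::euclidean_space \<Rightarrow> complex"
  assumes f: "integrable lborel f" and f2: "f \<in> L2"
  shows "ft_L1 f \<in> L2" "norm (abs_lsq (ft_L1 f)) = norm (abs_lsq f)"
proof -
  note [measurable] = L2_measurable[OF f2]
  define F where "F = abs_lsq f"
  define e where "e n = 1 / real (Suc n)" for n
  have e: "e n > 0" for n by (simp add: e_def)
  have e0: "e \<longlonglongrightarrow> 0"
    unfolding e_def by (rule LIMSEQ_inverse_real_of_nat[unfolded inverse_eq_divide])
  define I where "I n = (LINT w|lborel. gaussian (e n *\<^sub>R w) * (cmod (ft_L1 f w))\<^sup>2)" for n
  have meas: "(\<lambda>u. cinner (shift (c *\<^sub>R u) F) F) \<in> borel_measurable borel" for c
    by (simp add: F_def abs_shift abs_cinner f2 L2_shift l2_inner_def) measurable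
  have [measurable]: "(gaussian_ft :: 'a \<Rightarrow> real) \<in> borel_measurable borel"
    using borel_measurable_integrable[OF gaussian_ft_integral(1)] by simp
  have "(\<lambda>n. LINT u|lborel. cinner (shift (e n *\<^sub>R u) F) F * of_real (gaussian_ft u))
    \<longlonglongrightarrow> (LINT u|lborel. cinner F F * of_real (gaussian_ft (u :: 'a)))"
  proof (rule integral_dominated_convergence)
    show "integrable lborel (\<lambda>u. norm F * norm F * gaussian_ft (u :: 'a))"
      by (intro integrable_mult_right gaussian_ft_integral)
    show "AE u in lborel. (\<lambda>n. cinner (shift (e n *\<^sub>R u) F) F * of_real (gaussian_ft u)) \<longlonglongrightarrow> cinner F F * of_real (gaussian_ft u)"
    proof (rule AE_I2)
      fix u :: 'a
      have "(\<lambda>n. e n *\<^sub>R u) \<longlonglongrightarrow> 0 *\<^sub>R u"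
        by (intro tendsto_intros e0)
      then have "(\<lambda>n. shift (e n *\<^sub>R u) F) \<longlonglongrightarrow> F"
        by (intro shift_tendsto) simp
      then show "(\<lambda>n. cinner (shift (e n *\<^sub>R u) F) F * of_real (gaussian_ft u)) \<longlonglongrightarrow> cinner F F * of_real (gaussian_ft u)"
        by (intro tendsto_intros bounded_linear.tendsto[OF bounded_linear_cinner_left])
    qed
    fix n
    show "AE u in lborel. norm (cinner (shift (e n *\<^sub>R u) F) F * of_real (gaussian_ft u)) \<le> norm F * norm F * gaussian_ft u"
      using cmod_cinner_le[of "shift (e n *\<^sub>R _) F" F]
      by (auto simp: norm_mult gaussian_ft_nonneg intro!: mult_right_mono)
  qed (use meas in measurable)
  moreover have "(LINT u|lborel. cinner F F * of_real (gaussian_ft (u :: 'a))) = of_real ((norm F)\<^sup>2)"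
    by (simp only: integral_mult_right_zero integral_complex_of_real gaussian_ft_integral(2) cinner_self_norm) simp
  ultimately have "(\<lambda>n. complex_of_real (I n)) \<longlonglongrightarrow> of_real ((norm F)\<^sup>2)"
    unfolding I_def plancherel_weighted(2)[OF f f2 e] F_def by simp
  then have lim: "I \<longlonglongrightarrow> (norm F)\<^sup>2"
    by (simp only: tendsto_of_real_iff)
  have ft [measurable]: "ft_L1 f \<in> borel_measurable borel" by measurable
  \<comment> \<open>The weights increase to 1, so monotone convergence yields integrability and the
    value of the integral at once.\<close>
  have *: "integrable lborel (\<lambda>w. (cmod (ft_L1 f w))\<^sup>2)" "(LINT w|lborel. (cmod (ft_L1 f w))\<^sup>2) = (norm F)\<^sup>2"
  proof -
    have 1: "\<And>n. integrable lborel (\<lambda>w. gaussian (e n *\<^sub>R w) * (cmod (ft_L1 f w))\<^sup>2)"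
      by (rule plancherel_weighted(1)[OF f f2 e])
    have 2: "AE w in lborel. mono (\<lambda>n. gaussian (e n *\<^sub>R w) * (cmod (ft_L1 f w))\<^sup>2)"
    proof (rule AE_I2)
      fix w :: 'a
      have "mono (\<lambda>n. gaussian (e n *\<^sub>R w))"
        using mono_gaussian_weight[of w] by (simp only: e_def)
      then show "mono (\<lambda>n. gaussian (e n *\<^sub>R w) * (cmod (ft_L1 f w))\<^sup>2)"
        by (auto simp: mono_def intro!: mult_right_mono)
    qed
    have 3: "AE w in lborel. (\<lambda>n. gaussian (e n *\<^sub>R w) * (cmod (ft_L1 f w))\<^sup>2) \<longlonglongrightarrow> (cmod (ft_L1 f w))\<^sup>2"
    proof (rule AE_I2)
      fix w :: 'a
      have "(\<lambda>n. gaussian (e n *\<^sub>R w)) \<longlonglongrightarrow> 1"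
        using tendsto_gaussian_weight[of w] by (simp only: e_def)
      then show "(\<lambda>n. gaussian (e n *\<^sub>R w) * (cmod (ft_L1 f w))\<^sup>2) \<longlonglongrightarrow> (cmod (ft_L1 f w))\<^sup>2"
        using tendsto_mult_right[of _ 1 sequentially "(cmod (ft_L1 f w))\<^sup>2"] by simp
    qed
    have 4: "(\<lambda>n. LINT w|lborel. gaussian (e n *\<^sub>R w) * (cmod (ft_L1 f w))\<^sup>2) \<longlonglongrightarrow> (norm F)\<^sup>2"
      using lim by (simp add: I_def[abs_def])
    show "integrable lborel (\<lambda>w. (cmod (ft_L1 f w))\<^sup>2)" "(LINT w|lborel. (cmod (ft_L1 f w))\<^sup>2) = (norm F)\<^sup>2"
      using integrable_monotone_convergence[OF 1 2 3 4] integral_monotone_convergence[OF 1 2 3 4] by simp_all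
  qed
  show "ft_L1 f \<in> L2" by (rule L2_I[OF ft *(1)])
  then have "(norm (abs_lsq (ft_L1 f)))\<^sup>2 = (norm F)\<^sup>2"
    by (simp add: abs_norm_square *(2))
  then show "norm (abs_lsq (ft_L1 f)) = norm (abs_lsq f)"
    unfolding F_def by (rule power2_eq_imp_eq) auto
qed

section \<open>The Fourier transform on the Hilbert space\<close>

lemma bounded_bilinear_cinner: "bounded_bilinear (cinner :: 'a::euclidean_space lsq \<Rightarrow> _)"
proof
  show "\<exists>K. \<forall>u v :: 'a lsq. norm (cinner u v) \<le> norm u * norm v * K"
    by (rule exI[of _ 1]) (simp add: cmod_cinner_le)
qed (simp_all add: cinner_add_left cinner_add_right scaleR_cscale cinner_cscale_left
    cinner_cscale_right scaleR_conv_of_real)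

text \<open>The complex inner product is recovered from the real one, so an isometry commuting with
  \<open>cscale\<close> preserves it too.\<close>

lemma cinner_eq_inner: "cinner u v = Complex (inner u v) (inner u (cscale \<i> v))"
  by (simp add: inner_lsq_def cinner_cscale_right complex_eq_iff)

text \<open>Conjugation translates the bilinear multiplication formula into the sesquilinear inner
  product.\<close>

lift_definition lconj :: "'a::euclidean_space lsq \<Rightarrow> 'a lsq" is "\<lambda>f x. cnj (f x)"
  by (auto simp: L2_rel_def ae_eq_def intro: L2_cnj)

lemma abs_lconj: "f \<in> L2 \<Longrightarrow> lconj (abs_lsq f) = abs_lsq (\<lambda>x. cnj (f x))"
  by (rule lconj.abs_eq) (auto simp: L2_rel_def)

lemma lconj_lconj [simp]: "lconj (lconj u) = u"
  by (cases u) (simp add: abs_lconj L2_cnj)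

lemma norm_lconj [simp]: "norm (lconj u) = norm u"
  by (cases u) (simp add: abs_lconj L2_cnj abs_norm l2_norm_def)

lemma lconj_diff: "lconj (u - v) = lconj u - lconj v"
  by transfer (rule L2_relI; simp add: L2_rel_def L2_diff L2_cnj)

lemma tendsto_lconj: "(u \<longlongrightarrow> v) F \<Longrightarrow> ((\<lambda>n. lconj (u n)) \<longlongrightarrow> lconj v) F"
  unfolding tendsto_dist_iff[of u] tendsto_dist_iff[of "\<lambda>n. lconj (u n)"]
  by (simp add: dist_norm flip: lconj_diff)

lemma l2_norm_diff: "f \<in> L2 \<Longrightarrow> g \<in> L2 \<Longrightarrow> l2_norm (\<lambda>x. f x - g x) = norm (abs_lsq f - abs_lsq g)"
  by (simp add: abs_minus abs_norm L2_diff)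

text \<open>Both limits become convergence in the Hilbert space, and Plancherel's theorem supplies
  the square integrability of the transforms.\<close>

lemma has_fourier_iff:
  "has_fourier f g \<longleftrightarrow> f \<in> L2 \<and> g \<in> L2 \<and>
    (\<exists>h. (\<forall>n::nat. h n \<in> L2 \<and> integrable lborel (h n)) \<and>
      (\<lambda>n. abs_lsq (h n)) \<longlonglongrightarrow> abs_lsq f \<and> (\<lambda>n. abs_lsq (ft_L1 (h n))) \<longlonglongrightarrow> abs_lsq g)"
proof -
  have "(\<lambda>n. l2_norm (\<lambda>x. h n x - f x)) \<longlonglongrightarrow> 0 \<longleftrightarrow> (\<lambda>n. abs_lsq (h n)) \<longlonglongrightarrow> abs_lsq f"
    if "\<forall>n. h n \<in> L2" "f \<in> L2" for h :: "nat \<Rightarrow> 'a \<Rightarrow> complex" and f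
    using that by (simp add: l2_norm_diff tendsto_dist_iff[of "\<lambda>n. abs_lsq (h n)"] dist_norm)
  note lim = this
  have "(\<forall>n. h n \<in> L2 \<and> integrable lborel (h n) \<and> ft_L1 (h n) \<in> L2) \<and>
      (\<lambda>n. l2_norm (\<lambda>x. h n x - f x)) \<longlonglongrightarrow> 0 \<and> (\<lambda>n. l2_norm (\<lambda>w. ft_L1 (h n) w - g w)) \<longlonglongrightarrow> 0
    \<longleftrightarrow> (\<forall>n. h n \<in> L2 \<and> integrable lborel (h n)) \<and>
      (\<lambda>n. abs_lsq (h n)) \<longlonglongrightarrow> abs_lsq f \<and> (\<lambda>n. abs_lsq (ft_L1 (h n))) \<longlonglongrightarrow> abs_lsq g"
    if "f \<in> L2" "g \<in> L2" for h :: "nat \<Rightarrow> 'a \<Rightarrow> complex"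
  proof (cases "\<forall>n. h n \<in> L2 \<and> integrable lborel (h n)")
    case True
    then have "\<forall>n. ft_L1 (h n) \<in> L2" by (simp add: plancherel_L1)
    with True that lim[of h f] lim[of "\<lambda>n. ft_L1 (h n)" g] show ?thesis by simp
  qed auto
  then show ?thesis
    unfolding has_fourier_def by (simp cong: conj_cong)
qed

lemma ft_L1_diff:
  assumes "integrable lborel f" "integrable lborel g"
  shows "ft_L1 (\<lambda>x. f x - g x) = (\<lambda>w. ft_L1 f w - ft_L1 g w)"
  by (simp add: fun_eq_iff ft_L1_expo left_diff_distrib integrable_mult_expo assms)

lemma norm_ft_L1_diff:
  assumes "f \<in> L2" "integrable lborel f" "g \<in> L2" "integrable lborel g"
  shows "norm (abs_lsq (ft_L1 f) - abs_lsq (ft_L1 g)) = norm (abs_lsq f - abs_lsq g)"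
  using plancherel_L1(2)[of "\<lambda>x. f x - g x"] assms
  by (simp add: abs_minus plancherel_L1(1) ft_L1_diff L2_diff)

text \<open>The isometry passes to limits of approximating sequences. With \<open>f = f'\<close> it
  shows that the transform is unique up to null sets, so the choice in \<open>fourier\<close> is
  harmless.\<close>

lemma has_fourier_dist:
  assumes "has_fourier f g" "has_fourier f' g'"
  shows "norm (abs_lsq g - abs_lsq g') = norm (abs_lsq f - abs_lsq f')"
proof -
  obtain h where h: "\<And>n. h n \<in> L2" "\<And>n. integrable lborel (h n)"
    "(\<lambda>n. abs_lsq (h n)) \<longlonglongrightarrow> abs_lsq f" "(\<lambda>n. abs_lsq (ft_L1 (h n))) \<longlonglongrightarrow> abs_lsq g"
    using assms(1) by (auto simp: has_fourier_iff)
  obtain h' where h': "\<And>n. h' n \<in> L2" "\<And>n. integrable lborel (h' n)"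
    "(\<lambda>n. abs_lsq (h' n)) \<longlonglongrightarrow> abs_lsq f'" "(\<lambda>n. abs_lsq (ft_L1 (h' n))) \<longlonglongrightarrow> abs_lsq g'"
    using assms(2) by (auto simp: has_fourier_iff)
  have "(\<lambda>n. norm (abs_lsq (h n) - abs_lsq (h' n))) \<longlonglongrightarrow> norm (abs_lsq f - abs_lsq f')"
    by (intro tendsto_intros h h')
  moreover have "(\<lambda>n. norm (abs_lsq (ft_L1 (h n)) - abs_lsq (ft_L1 (h' n)))) \<longlonglongrightarrow> norm (abs_lsq g - abs_lsq g')"
    by (intro tendsto_intros h h')
  ultimately show ?thesis
    by (simp add: norm_ft_L1_diff h h' LIMSEQ_unique)
qed

lemma L2_truncate:
  fixes f :: "'a::euclidean_space \<Rightarrow> complex"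
  assumes f: "f \<in> L2"
  obtains h where "\<And>n::nat. h n \<in> L2" "\<And>n. integrable lborel (h n)" "(\<lambda>n. abs_lsq (h n)) \<longlonglongrightarrow> abs_lsq f"
proof
  note [measurable] = L2_measurable[OF f]
  define h where "h n x = f x * indicator (cball 0 (real n)) x" for n x
  have ind: "(indicator (cball 0 (real n)) :: 'a \<Rightarrow> complex) \<in> L2" for n
    using emeasure_bounded_finite[OF bounded_cball] by (intro L2_indicator) auto
  show "h n \<in> L2" for n
    by (rule L2_bound[OF f, where C=1]) (auto simp: h_def[abs_def] indicator_def)
  show "integrable lborel (h n)" for n
    unfolding h_def[abs_def] by (rule L2_mult_integrable[OF f ind])
  show "(\<lambda>n. abs_lsq (h n)) \<longlonglongrightarrow> abs_lsq f"
  proof (rule L2_dominated_convergence[OF f])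
    show "(\<lambda>n. h n x) \<longlonglongrightarrow> f x" for x
    proof (rule tendsto_eventually)
      obtain N where "norm x \<le> real N" using real_arch_simple by blast
      then have "h n x = f x" if "n \<ge> N" for n
        using that by (simp add: h_def)
      then show "\<forall>\<^sub>F n in sequentially. h n x = f x"
        by (auto simp: eventually_sequentially)
    qed
  qed (auto simp: h_def[abs_def] indicator_def)
qed

text \<open>The transforms of integrable approximants form a Cauchy sequence by the isometry, and
  completeness provides the limit.\<close>

lemma has_fourier_exists:
  assumes f: "f \<in> L2" shows "\<exists>g. has_fourier f g"
proof -
  obtain h where h: "\<And>n::nat. h n \<in> L2" "\<And>n. integrable lborel (h n)" "(\<lambda>n. abs_lsq (h n)) \<longlonglongrightarrow> abs_lsq f"
    using L2_truncate[OF f] by blast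
  have "Cauchy (\<lambda>n. abs_lsq (h n))"
    using h(3) by (rule LIMSEQ_imp_Cauchy)
  then have "Cauchy (\<lambda>n. abs_lsq (ft_L1 (h n)))"
    by (simp add: Cauchy_def dist_norm norm_ft_L1_diff h)
  then obtain v where "(\<lambda>n. abs_lsq (ft_L1 (h n))) \<longlonglongrightarrow> v"
    by (metis Cauchy_convergent convergentD)
  then have "has_fourier f (rep_lsq v)"
    using f h by (auto simp: has_fourier_iff)
  then show ?thesis by blast
qed

lemma has_fourier_fourier: "f \<in> L2 \<Longrightarrow> has_fourier f (fourier f)"
  unfolding fourier_def by (rule someI_ex[OF has_fourier_exists])

lemma fourier_L2: "f \<in> L2 \<Longrightarrow> fourier f \<in> L2"
  using has_fourier_fourier by (auto simp: has_fourier_def)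

definition Fop :: "'a::euclidean_space lsq \<Rightarrow> 'a lsq" where
  "Fop u = abs_lsq (fourier (rep_lsq u))"

lemma has_fourier_Fop: "has_fourier f g \<Longrightarrow> Fop (abs_lsq f) = abs_lsq g"
proof -
  assume fg: "has_fourier f g"
  then have f: "f \<in> L2" by (simp add: has_fourier_def)
  have "norm (Fop (abs_lsq f) - abs_lsq g) = 0"
    unfolding Fop_def using has_fourier_dist[OF has_fourier_fourier[OF rep_L2] fg, of "abs_lsq f"] by simp
  then show ?thesis by simp
qed

lemma Fop_abs: "f \<in> L2 \<Longrightarrow> Fop (abs_lsq f) = abs_lsq (fourier f)"
  by (intro has_fourier_Fop has_fourier_fourier)

lemma dist_Fop: "norm (Fop u - Fop v) = norm (u - v)"
  by (cases u; cases v) (simp add: Fop_abs has_fourier_dist[OF has_fourier_fourier has_fourier_fourier])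

lemma Fop_ft_L1: "f \<in> L2 \<Longrightarrow> integrable lborel f \<Longrightarrow> Fop (abs_lsq f) = abs_lsq (ft_L1 f)"
  by (rule has_fourier_Fop) (auto simp: has_fourier_iff plancherel_L1 intro!: exI[of _ "\<lambda>_. f"])

lemma lsq_approx_L1:
  obtains h where "\<And>n::nat. h n \<in> L2" "\<And>n. integrable lborel (h n)" "(\<lambda>n. abs_lsq (h n)) \<longlonglongrightarrow> u"
  by (metis L2_truncate abs_rep rep_L2)

lemma tendsto_Fop: "(u \<longlongrightarrow> v) F \<Longrightarrow> ((\<lambda>n. Fop (u n)) \<longlongrightarrow> Fop v) F"
  unfolding tendsto_dist_iff[of u] tendsto_dist_iff[of "\<lambda>n. Fop (u n)"]
  by (simp add: dist_norm dist_Fop)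

lemma Fop_linear: "Fop (cscale a u + v) = cscale a (Fop u) + Fop v"
proof -
  obtain h where h: "\<And>n::nat. h n \<in> L2" "\<And>n. integrable lborel (h n)" "(\<lambda>n. abs_lsq (h n)) \<longlonglongrightarrow> u"
    using lsq_approx_L1 by blast
  obtain k where k: "\<And>n::nat. k n \<in> L2" "\<And>n. integrable lborel (k n)" "(\<lambda>n. abs_lsq (k n)) \<longlonglongrightarrow> v"
    using lsq_approx_L1 by blast
  have "Fop (cscale a (abs_lsq (h n)) + abs_lsq (k n)) = cscale a (Fop (abs_lsq (h n))) + Fop (abs_lsq (k n))" for n
  proof -
    have "ft_L1 (\<lambda>x. a * h n x + k n x) = (\<lambda>w. a * ft_L1 (h n) w + ft_L1 (k n) w)"
      by (simp add: fun_eq_iff ft_L1_expo distrib_right mult.assoc integrable_mult_expo h k)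
    then show ?thesis
      by (simp add: abs_cscale abs_plus Fop_ft_L1 h k plancherel_L1 L2_cmult L2_add)
  qed
  moreover have "(\<lambda>n. Fop (cscale a (abs_lsq (h n)) + abs_lsq (k n))) \<longlonglongrightarrow> Fop (cscale a u + v)"
    by (intro tendsto_Fop tendsto_add bounded_linear.tendsto[OF bounded_linear_cscale] h k)
  moreover have "(\<lambda>n. cscale a (Fop (abs_lsq (h n))) + Fop (abs_lsq (k n))) \<longlonglongrightarrow> cscale a (Fop u) + Fop v"
    by (intro tendsto_Fop tendsto_add bounded_linear.tendsto[OF bounded_linear_cscale] h k)
  ultimately show ?thesis
    using LIMSEQ_unique by simp
qed

lemma Fop_add: "Fop (u + v) = Fop u + Fop v"
  using Fop_linear[of 1 u v] by simp

lemma Fop_zero [simp]: "Fop 0 = 0"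
  using Fop_add[of 0 0] by simp

lemma Fop_cscale: "Fop (cscale a u) = cscale a (Fop u)"
  using Fop_linear[of a u 0] by simp

lemma norm_Fop [simp]: "norm (Fop u) = norm u"
  using dist_Fop[of u 0] by simp

lemma inner_norm: "inner u v = ((norm (u + v))\<^sup>2 - (norm u)\<^sup>2 - (norm v)\<^sup>2) / 2" for u v :: "'b::real_inner"
  by (simp add: power2_norm_eq_inner inner_add inner_commute[of v u])

lemma cinner_Fop: "cinner (Fop u) (Fop v) = cinner u v"
proof -
  have "inner (Fop u) (Fop v) = inner u v" for u v :: "'a lsq"
    unfolding inner_norm[of "Fop u"] inner_norm[of u] Fop_add[symmetric] norm_Fop ..
  then show ?thesis
    unfolding cinner_eq_inner by (simp flip: Fop_cscale)
qed

lemma Fop_multiplication: "cinner (Fop u) (lconj v) = cinner u (lconj (Fop v))"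
proof -
  obtain h where h: "\<And>n::nat. h n \<in> L2" "\<And>n. integrable lborel (h n)" "(\<lambda>n. abs_lsq (h n)) \<longlonglongrightarrow> u"
    using lsq_approx_L1 by blast
  obtain k where k: "\<And>n::nat. k n \<in> L2" "\<And>n. integrable lborel (k n)" "(\<lambda>n. abs_lsq (k n)) \<longlonglongrightarrow> v"
    using lsq_approx_L1 by blast
  have "cinner (Fop (abs_lsq (h n))) (lconj (abs_lsq (k n))) = cinner (abs_lsq (h n)) (lconj (Fop (abs_lsq (k n))))" for n
    by (simp add: Fop_ft_L1 h k abs_lconj plancherel_L1 abs_cinner L2_cnj l2_inner_def ft_L1_multiplication)
  moreover have "(\<lambda>n. cinner (Fop (abs_lsq (h n))) (lconj (abs_lsq (k n)))) \<longlonglongrightarrow> cinner (Fop u) (lconj v)"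
    by (intro bounded_bilinear.tendsto[OF bounded_bilinear_cinner] tendsto_Fop tendsto_lconj h k)
  moreover have "(\<lambda>n. cinner (abs_lsq (h n)) (lconj (Fop (abs_lsq (k n))))) \<longlonglongrightarrow> cinner u (lconj (Fop v))"
    by (intro bounded_bilinear.tendsto[OF bounded_bilinear_cinner] tendsto_Fop tendsto_lconj h k)
  ultimately show ?thesis
    using LIMSEQ_unique by simp
qed

text \<open>The multiplication formula identifies the adjoint of \<open>Fop\<close> as its conjugate by \<open>lconj\<close>. The adjoint
  is thus isometric too, which makes \<open>Fop\<close> unitary.\<close>

definition Finv :: "'a::euclidean_space lsq \<Rightarrow> 'a lsq" where
  "Finv w = lconj (Fop (lconj w))"

lemma cinner_Finv_right: "cinner u (Finv w) = cinner (Fop u) w"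
  using Fop_multiplication[of u "lconj w"] by (simp add: Finv_def)

lemma Finv_Fop [simp]: "Finv (Fop v) = v"
proof -
  have "cinner (Finv (Fop v)) w = cinner v w" for w
    by (subst (1 2) cinner_commute) (simp add: cinner_Finv_right cinner_Fop)
  then show ?thesis by (rule cinner_eqI)
qed

text \<open>\<open>Fop (Finv w)\<close> has the norm of \<open>w\<close>, and its inner product with
  \<open>w\<close> is again the squared norm of \<open>w\<close>; expanding the squared distance
  therefore gives zero.\<close>

lemma Fop_Finv [simp]: "Fop (Finv w) = w"
proof -
  have "norm (Finv w) = norm w" by (simp add: Finv_def)
  moreover have "inner (Fop (Finv w)) w = (norm (Finv w))\<^sup>2"
    by (simp add: inner_lsq_def cinner_Finv_right[symmetric] cinner_self_norm)
  moreover have "(norm (v - w))\<^sup>2 = (norm v)\<^sup>2 - 2 * inner v w + (norm w)\<^sup>2" for v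
    by (simp add: power2_norm_eq_inner inner_diff inner_commute[of w v])
  ultimately have "(norm (Fop (Finv w) - w))\<^sup>2 = 0"
    by simp
  then show ?thesis by simp
qed

text \<open>Surjectivity of \<open>Fop\<close> provides a witness for the choice, and injectivity
  determines the class of whatever is chosen.\<close>

lemma inv_fourier:
  assumes g: "g \<in> L2"
  shows "inv_fourier g \<in> L2" "abs_lsq (inv_fourier g) = Finv (abs_lsq g)"
proof -
  let ?f = "rep_lsq (Finv (abs_lsq g))"
  have "abs_lsq (fourier ?f) = abs_lsq g"
    using Fop_abs[of ?f] by simp
  then have "?f \<in> L2 \<and> fourier ?f =\<^sub>a\<^sub>e g"
    by (simp add: abs_eq_iff fourier_L2 g)
  then have *: "inv_fourier g \<in> L2 \<and> fourier (inv_fourier g) =\<^sub>a\<^sub>e g"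
    unfolding inv_fourier_def by (rule someI[of "\<lambda>f. f \<in> L2 \<and> fourier f =\<^sub>a\<^sub>e g" ?f])
  then show "inv_fourier g \<in> L2" by simp
  from * have "Fop (abs_lsq (inv_fourier g)) = abs_lsq g"
    by (simp add: Fop_abs abs_eq_iff fourier_L2 g)
  then show "abs_lsq (inv_fourier g) = Finv (abs_lsq g)"
    by (metis Finv_Fop)
qed

section \<open>Multiplication operators\<close>

definition bdd_mult :: "('a::euclidean_space \<Rightarrow> complex) \<Rightarrow> real \<Rightarrow> bool" where
  "bdd_mult m C \<longleftrightarrow> m \<in> borel_measurable borel \<and> (AE x in lborel. cmod (m x) \<le> C)"

text \<open>Meaningful for essentially bounded \<open>m\<close> only: \<^const>\<open>abs_lsq\<close> is unspecified outside \<^const>\<open>L2\<close>.\<close>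

definition mulf :: "('a::euclidean_space \<Rightarrow> complex) \<Rightarrow> 'a lsq \<Rightarrow> 'a lsq" where
  "mulf m u = abs_lsq (\<lambda>x. m x * rep_lsq u x)"

lemma L2_mult:
  assumes "bdd_mult m C" "f \<in> L2" shows "(\<lambda>x. m x * f x) \<in> L2"
proof (rule L2_bound[OF assms(2)])
  show "(\<lambda>x. m x * f x) \<in> borel_measurable borel"
    using assms L2_measurable by (auto simp: bdd_mult_def)
  show "AE x in lborel. cmod (m x * f x) \<le> C * cmod (f x)"
  proof -
    have "AE x in lborel. cmod (m x) \<le> C" using assms(1) by (simp add: bdd_mult_def)
    then show ?thesis by eventually_elim (simp add: norm_mult mult_right_mono)
  qed
qed

lemma mulf_abs:
  assumes "bdd_mult m C" "f \<in> L2" shows "mulf m (abs_lsq f) = abs_lsq (\<lambda>x. m x * f x)"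
  unfolding mulf_def using rep_abs[OF assms(2)]
  by (subst abs_eq_iff) (auto simp: L2_mult[OF assms(1)] assms(2) ae_eq_def elim!: AE_mp)

lemma mulf_add: assumes "bdd_mult m C" shows "mulf m (u + v) = mulf m u + mulf m v"
  by (cases u; cases v) (simp add: abs_plus mulf_abs[OF assms] L2_mult[OF assms] L2_add distrib_left)

lemma mulf_cscale: assumes "bdd_mult m C" shows "mulf m (cscale a u) = cscale a (mulf m u)"
  by (cases u) (simp add: abs_cscale mulf_abs[OF assms] L2_mult[OF assms] L2_cmult mult.left_commute)

lemma norm_mulf_le:
  assumes m: "bdd_mult m C" and "0 \<le> C" shows "norm (mulf m u) \<le> C * norm u"
proof (cases u)
  fix f assume f: "u = abs_lsq f" "f \<in> L2"
  have "(norm (mulf m u))\<^sup>2 = (LINT x|lborel. (cmod (m x * f x))\<^sup>2)"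
    by (simp add: f mulf_abs[OF m] abs_norm_square L2_mult[OF m])
  also have "\<dots> \<le> (LINT x|lborel. C\<^sup>2 * (cmod (f x))\<^sup>2)"
  proof (rule integral_mono_AE)
    show "integrable lborel (\<lambda>x. (cmod (m x * f x))\<^sup>2)"
      by (rule L2_integrable[OF L2_mult[OF m f(2)]])
    show "integrable lborel (\<lambda>x. C\<^sup>2 * (cmod (f x))\<^sup>2)"
      by (intro integrable_mult_right L2_integrable f)
    have "AE x in lborel. cmod (m x) \<le> C" using m by (simp add: bdd_mult_def)
    then show "AE x in lborel. (cmod (m x * f x))\<^sup>2 \<le> C\<^sup>2 * (cmod (f x))\<^sup>2"
      by eventually_elim (auto simp: norm_mult power_mult_distrib intro!: mult_right_mono power_mono)
  qed
  also have "\<dots> = (C * norm u)\<^sup>2"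
    by (simp add: f abs_norm_square power_mult_distrib)
  finally show ?thesis
    by (rule power2_le_imp_le) (simp add: assms(2))
qed

lemma mulf_mulf:
  assumes "bdd_mult m C" "bdd_mult m' C'" "bdd_mult (\<lambda>x. m x * m' x) C''"
  shows "mulf m (mulf m' u) = mulf (\<lambda>x. m x * m' x) u"
  by (cases u) (simp add: mulf_abs[OF assms(1)] mulf_abs[OF assms(2)] mulf_abs[OF assms(3)] L2_mult[OF assms(2)] mult.assoc)

lemma cinner_mulf_left:
  assumes "bdd_mult m C" "bdd_mult (\<lambda>x. cnj (m x)) C'"
  shows "cinner (mulf m u) v = cinner u (mulf (\<lambda>x. cnj (m x)) v)"
  by (cases u; cases v)
    (simp add: mulf_abs[OF assms(1)] mulf_abs[OF assms(2)] L2_mult[OF assms(1)] L2_mult[OF assms(2)]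
      abs_cinner l2_inner_def, simp add: mult_ac)

lemma bounded_linear_mulf: assumes "bdd_mult m C" "0 \<le> C" shows "bounded_linear (mulf m)"
  by (rule bounded_linear_intro[where K=C])
    (auto simp: mulf_add[OF assms(1)] scaleR_cscale mulf_cscale[OF assms(1)] norm_mulf_le[OF assms] mult.commute)

lemma bdd_mult_expo: "bdd_mult (expo l) 1"
  unfolding bdd_mult_def by (auto intro: borel_measurable_expo)

text \<open>For integrable functions this is a change of variable; both sides are continuous, so it
  extends by density.\<close>

lemma Fop_shift: "Fop (shift (- l) u) = mulf (expo l) (Fop u)"
proof -
  obtain h where h: "\<And>n::nat. h n \<in> L2" "\<And>n. integrable lborel (h n)" "(\<lambda>n. abs_lsq (h n)) \<longlonglongrightarrow> u"
    using lsq_approx_L1 by blast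
  have "Fop (shift (- l) (abs_lsq (h n))) = mulf (expo l) (Fop (abs_lsq (h n)))" for n
  proof -
    note [measurable] = L2_measurable[OF h(1)[of n]]
    have "ft_L1 (\<lambda>x. h n (- l + x)) w = expo l w * ft_L1 (h n) w" for w
    proof -
      have "ft_L1 (\<lambda>x. h n (- l + x)) w = (LINT x|lborel. expo l w * (h n (- l + x) * expo w (- l + x)))"
        unfolding ft_L1_expo
      proof (rule Bochner_Integration.integral_cong[OF refl])
        fix x
        have "expo w x = expo l w * expo w (- l + x)"
          using expo_add_right[of w l "- l + x"] by (simp add: expo_commute[of w l])
        then show "h n (- l + x) * expo w x = expo l w * (h n (- l + x) * expo w (- l + x))" by simp
      qed
      also have "\<dots> = expo l w * ft_L1 (h n) w"
        unfolding ft_L1_expo integral_mult_right_zero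
        by (subst integral_lborel_shift[of "\<lambda>x. h n x * expo w x"]) measurable
      finally show ?thesis .
    qed
    then have "ft_L1 (\<lambda>x. h n (- l + x)) = (\<lambda>w. expo l w * ft_L1 (h n) w)" by (simp add: fun_eq_iff)
    then show ?thesis
      by (simp only: abs_shift h Fop_ft_L1 L2_shift integrable_lborel_shift mulf_abs[OF bdd_mult_expo] plancherel_L1)
  qed
  moreover have "(\<lambda>n. Fop (shift (- l) (abs_lsq (h n)))) \<longlonglongrightarrow> Fop (shift (- l) u)"
  proof (rule tendsto_Fop)
    show "(\<lambda>n. shift (- l) (abs_lsq (h n))) \<longlonglongrightarrow> shift (- l) u"
      using h(3) unfolding tendsto_dist_iff[of "\<lambda>n. abs_lsq (h n)"] tendsto_dist_iff[of "\<lambda>n. shift (- l) (abs_lsq (h n))"]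
      by (simp add: dist_norm flip: shift_diff)
  qed
  moreover have "(\<lambda>n. mulf (expo l) (Fop (abs_lsq (h n)))) \<longlonglongrightarrow> mulf (expo l) (Fop u)"
    by (intro bounded_linear.tendsto[OF bounded_linear_mulf[OF bdd_mult_expo]] tendsto_Fop h) simp
  ultimately show ?thesis
    using LIMSEQ_unique by simp
qed

section \<open>Frames\<close>

text \<open>The squared norm of a partial sum outside a finite set is controlled by the tail of a
  convergent scalar series, so the net of finite partial sums is Cauchy.\<close>

lemma summable_on_Bessel:
  fixes w :: "'k \<Rightarrow> 'h::banach" and d :: "'k \<Rightarrow> real"
  assumes d: "d summable_on UNIV" "\<And>k. 0 \<le> d k" and C: "0 \<le> C"
    and bound: "\<And>F. finite F \<Longrightarrow> (norm (\<Sum>k\<in>F. w k))\<^sup>2 \<le> C * (\<Sum>k\<in>F. d k)"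
  shows "w summable_on UNIV"
proof -
  let ?G = "filtermap (sum w) (finite_subsets_at_top UNIV)"
  have "cauchy_filter ?G"
    unfolding cauchy_filter_metric
  proof (intro allI impI)
    fix e :: real assume e: "e > 0"
    define D where "D = infsum d UNIV"
    have "(sum d \<longlongrightarrow> D) (finite_subsets_at_top UNIV)"
      using has_sum_infsum[OF d(1)] by (simp add: has_sum_def D_def)
    \<comment> \<open>The threshold is chosen so that \<open>C\<close> times it stays below
      \<open>(e/2)^2\<close>; adding 1 to \<open>C\<close> keeps the inequality strict and covers
      \<open>C = 0\<close>.\<close>
    then have "\<forall>\<^sub>F F in finite_subsets_at_top UNIV. D - (e/2)\<^sup>2 / (C + 1) < sum d F"
      by (rule order_tendstoD) (use e C in \<open>simp add: field_simps\<close>)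
    then obtain F0 where F0: "finite F0" "D - (e/2)\<^sup>2 / (C + 1) < sum d F0"
      unfolding eventually_finite_subsets_at_top by blast
    have near: "dist (sum w F) (sum w F0) < e/2" if F: "finite F" "F0 \<subseteq> F" for F
    proof -
      have "sum w F - sum w F0 = sum w (F - F0)"
        using F by (simp add: sum_diff)
      then have "(norm (sum w F - sum w F0))\<^sup>2 \<le> C * sum d (F - F0)"
        using bound[of "F - F0"] F by simp
      also have "sum d (F - F0) = sum d F - sum d F0"
        using F by (simp add: sum_diff)
      also have "C * (sum d F - sum d F0) \<le> C * (D - sum d F0)"
        using finite_sum_le_infsum[OF d(1) F(1)] d(2) C unfolding D_def by (intro mult_left_mono) auto
      also have "\<dots> \<le> C * ((e/2)\<^sup>2 / (C + 1))"
        using F0 C by (intro mult_left_mono) auto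
      also have "\<dots> < (e/2)\<^sup>2"
        using e C by (simp add: field_simps)
      finally show ?thesis
        unfolding dist_norm by (rule power2_less_imp_less) (use e in simp)
    qed
    show "\<exists>P. eventually P ?G \<and> (\<forall>x y. P x \<and> P y \<longrightarrow> dist x y < e)"
    proof (intro exI conjI allI impI)
      show "\<forall>\<^sub>F x in ?G. dist x (sum w F0) < e/2"
        unfolding eventually_filtermap eventually_finite_subsets_at_top
        using F0(1) near by blast
      fix x y assume "dist x (sum w F0) < e/2 \<and> dist y (sum w F0) < e/2"
      then show "dist x y < e" using dist_triangle_half_l by blast
    qed
  qed
  then obtain x where "?G \<le> nhds x"
    using cauchy_filter_complete_converges[of ?G UNIV] complete_UNIV by (auto simp: filtermap_bot_iff)
  then show ?thesis
    by (auto simp: summable_on_def has_sum_def filterlim_def)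
qed

lemma cscale_diff_right: "cscale a (v - w) = cscale a v - cscale a w"
  by (rule linear_diff[OF bounded_linear.linear[OF bounded_linear_cscale]])

lemma sum_mult_le_sqrt:
  fixes a b :: "'k \<Rightarrow> real"
  shows "(\<Sum>k\<in>F. a k * b k) \<le> sqrt (\<Sum>k\<in>F. (a k)\<^sup>2) * sqrt (\<Sum>k\<in>F. (b k)\<^sup>2)"
  using Cauchy_Schwarz_ineq_sum[of a b F] real_le_rsqrt by (simp add: real_sqrt_mult[symmetric])

section \<open>Closed subspaces and frame operators\<close>

definition lsq_frame_bounds :: "real \<Rightarrow> real \<Rightarrow> 'a::euclidean_space lsq set \<Rightarrow> ('k \<Rightarrow> 'a lsq) \<Rightarrow> bool" where
  "lsq_frame_bounds A B H \<psi> \<longleftrightarrow> 0 < A \<and> 0 < B \<and> (\<forall>k. \<psi> k \<in> H) \<and>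
     (\<forall>u\<in>H. (\<lambda>k. (cmod (cinner u (\<psi> k)))\<^sup>2) summable_on UNIV \<and>
        A * (norm u)\<^sup>2 \<le> (\<Sum>\<^sub>\<infinity>k. (cmod (cinner u (\<psi> k)))\<^sup>2) \<and>
        (\<Sum>\<^sub>\<infinity>k. (cmod (cinner u (\<psi> k)))\<^sup>2) \<le> B * (norm u)\<^sup>2)"

text \<open>A closed subspace is presented by its orthogonal projection. For the two subspaces of
  interest it is explicit: multiplication by an indicator, and the conjugate of that by the Fourier
  transform.\<close>

locale lsq_projection =
  fixes P :: "'a::euclidean_space lsq \<Rightarrow> 'a lsq" and H :: "'a lsq set"
  assumes P_linear: "bounded_linear P"
    and P_idem: "P (P u) = P u"
    and P_sym: "cinner (P u) v = cinner u (P v)"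
    and H_eq: "H = {u. P u = u}"
begin

lemma P_add: "P (u + v) = P u + P v" and P_diff: "P (u - v) = P u - P v"
  using P_linear by (simp_all add: linear_simps)

text \<open>\<open>bounded_linear\<close> provides real homogeneity; complex homogeneity comes from
  symmetry for the complex inner product.\<close>

lemma P_cscale: "P (cscale a u) = cscale a (P u)"
  by (rule cinner_eqI) (simp add: P_sym cinner_cscale_left)

lemma P_H [simp]: "P u \<in> H"
  by (simp add: H_eq P_idem)

lemma H_P: "u \<in> H \<Longrightarrow> P u = u"
  by (simp add: H_eq)

lemma H_add: "u \<in> H \<Longrightarrow> v \<in> H \<Longrightarrow> u + v \<in> H" and H_diff: "u \<in> H \<Longrightarrow> v \<in> H \<Longrightarrow> u - v \<in> H"
  and H_cscale: "u \<in> H \<Longrightarrow> cscale a u \<in> H"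
  by (simp_all add: H_eq P_add P_diff P_cscale)

lemma H_zero: "0 \<in> H"
  using P_diff[of 0 0] by (simp add: H_eq)

lemma norm_P_le: "norm (P u) \<le> norm u"
proof -
  have "norm (P u) * norm (P u) = Re (cinner (P u) (P u))"
    by (simp add: cinner_self_norm power2_eq_square)
  also have "\<dots> = Re (cinner u (P u))"
    by (metis P_sym P_idem)
  also have "\<dots> \<le> norm u * norm (P u)"
    using complex_Re_le_cmod cmod_cinner_le order_trans by blast
  finally show ?thesis
    by (cases "norm (P u) = 0") (auto simp: mult_le_cancel_right)
qed

lemma closed_H: "closed H"
  unfolding H_eq by (intro closed_Collect_eq linear_continuous_on P_linear continuous_on_id)

end

locale lsq_frame = lsq_projection P H
  for P :: "'a::euclidean_space lsq \<Rightarrow> 'a lsq" and H :: "'a lsq set" +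
  fixes A B :: real and \<psi> :: "'k \<Rightarrow> 'a lsq"
  assumes frame: "lsq_frame_bounds A B H \<psi>"
begin

lemma A_pos: "0 < A" and B_pos: "0 < B" and psi_H [simp]: "\<psi> k \<in> H"
  using frame by (auto simp: lsq_frame_bounds_def)

lemma P_psi [simp]: "P (\<psi> k) = \<psi> k"
  by (simp add: H_P)

text \<open>The frame vectors lie in \<open>H\<close>, so \<open>u\<close> and its projection have
  the same coefficients. This extends the frame inequalities to vectors outside
  \<open>H\<close>.\<close>

lemma cinner_psi_P: "cinner (P u) (\<psi> k) = cinner u (\<psi> k)"
  by (simp add: P_sym)

lemma coeff_summable: "(\<lambda>k. (cmod (cinner u (\<psi> k)))\<^sup>2) summable_on UNIV"
  using frame P_H[of u] unfolding lsq_frame_bounds_def cinner_psi_P[symmetric, of u] by blast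

lemma coeff_le: "(\<Sum>\<^sub>\<infinity>k. (cmod (cinner u (\<psi> k)))\<^sup>2) \<le> B * (norm u)\<^sup>2"
proof -
  have "(\<Sum>\<^sub>\<infinity>k. (cmod (cinner u (\<psi> k)))\<^sup>2) \<le> B * (norm (P u))\<^sup>2"
    using frame P_H[of u] unfolding lsq_frame_bounds_def cinner_psi_P[symmetric, of u] by blast
  also have "\<dots> \<le> B * (norm u)\<^sup>2"
    using B_pos norm_P_le by (intro mult_left_mono power_mono) auto
  finally show ?thesis .
qed

lemma coeff_ge: "A * (norm (P u))\<^sup>2 \<le> (\<Sum>\<^sub>\<infinity>k. (cmod (cinner u (\<psi> k)))\<^sup>2)"
  using frame P_H[of u] unfolding lsq_frame_bounds_def cinner_psi_P[symmetric, of u] by blast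

lemma coeff_finite_le: "finite F \<Longrightarrow> (\<Sum>k\<in>F. (cmod (cinner u (\<psi> k)))\<^sup>2) \<le> B * (norm u)\<^sup>2"
  by (rule order_trans[OF finite_sum_le_infsum[OF coeff_summable] coeff_le]) auto

text \<open>Synthesis is adjoint to analysis, so it inherits the upper bound: pairing the sum g with
  itself and applying Cauchy-Schwarz leaves a factor \<open>norm g\<close> on both sides to
  cancel.\<close>

lemma synthesis_le:
  assumes F: "finite F"
  shows "(norm (\<Sum>k\<in>F. cscale (c k) (\<psi> k)))\<^sup>2 \<le> B * (\<Sum>k\<in>F. (cmod (c k))\<^sup>2)"
proof -
  define g where "g = (\<Sum>k\<in>F. cscale (c k) (\<psi> k))"
  have "(norm g)\<^sup>2 = cmod (cinner g g)"
    by (simp add: cinner_self_norm norm_power)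
  also have "cinner g g = (\<Sum>k\<in>F. c k * cinner (\<psi> k) g)"
    by (subst (1) g_def)
      (simp add: linear_sum[OF bounded_linear.linear[OF bounded_linear_cinner_left]] cinner_cscale_left)
  also have "cmod \<dots> \<le> (\<Sum>k\<in>F. cmod (c k) * cmod (cinner g (\<psi> k)))"
    by (rule sum_norm_le) (metis cinner_commute complex_mod_cnj norm_mult order_refl)
  also have "\<dots> \<le> sqrt (\<Sum>k\<in>F. (cmod (c k))\<^sup>2) * sqrt (\<Sum>k\<in>F. (cmod (cinner g (\<psi> k)))\<^sup>2)"
    by (rule sum_mult_le_sqrt)
  also have "\<dots> \<le> sqrt (\<Sum>k\<in>F. (cmod (c k))\<^sup>2) * sqrt (B * (norm g)\<^sup>2)"
    by (intro mult_left_mono real_sqrt_le_mono coeff_finite_le[OF F]) (auto intro: sum_nonneg)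
  also have "\<dots> = sqrt (B * (\<Sum>k\<in>F. (cmod (c k))\<^sup>2)) * norm g"
    by (simp add: real_sqrt_mult)
  finally have "norm g * norm g \<le> sqrt (B * (\<Sum>k\<in>F. (cmod (c k))\<^sup>2)) * norm g"
    by (simp add: power2_eq_square)
  then have "norm g \<le> sqrt (B * (\<Sum>k\<in>F. (cmod (c k))\<^sup>2))"
    using B_pos by (cases "norm g = 0") (auto simp: mult_le_cancel_right intro!: mult_nonneg_nonneg sum_nonneg)
  then have "(norm g)\<^sup>2 \<le> (sqrt (B * (\<Sum>k\<in>F. (cmod (c k))\<^sup>2)))\<^sup>2"
    by (intro power_mono) auto
  also have "\<dots> = B * (\<Sum>k\<in>F. (cmod (c k))\<^sup>2)"
    using B_pos by (simp add: sum_nonneg)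
  finally show ?thesis by (simp add: g_def)
qed

text \<open>\<open>S\<close> is defined on the whole space and vanishes on the orthogonal complement of \<open>H\<close>; to invert it,
  \<open>A\<close> times the complementary projection is added below.\<close>

definition S :: "'a lsq \<Rightarrow> 'a lsq" where
  "S u = (\<Sum>\<^sub>\<infinity>k. cscale (cinner u (\<psi> k)) (\<psi> k))"

lemma S_has_sum: "((\<lambda>k. cscale (cinner u (\<psi> k)) (\<psi> k)) has_sum S u) UNIV"
  unfolding S_def
  by (rule has_sum_infsum, rule summable_on_Bessel[OF coeff_summable[of u] _ less_imp_le[OF B_pos] synthesis_le]) auto

lemma S_eqI: "((\<lambda>k. cscale (cinner u (\<psi> k)) (\<psi> k)) has_sum v) UNIV \<Longrightarrow> S u = v"
  using S_has_sum has_sum_unique by blast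

lemma S_add: "S (u + v) = S u + S v"
proof (rule S_eqI)
  have "cscale (cinner (u + v) (\<psi> k)) (\<psi> k) = cscale (cinner u (\<psi> k)) (\<psi> k) + cscale (cinner v (\<psi> k)) (\<psi> k)" for k
    by (rule cinner_eqI) (simp add: cinner_add_left cinner_cscale_left distrib_right)
  then show "((\<lambda>k. cscale (cinner (u + v) (\<psi> k)) (\<psi> k)) has_sum (S u + S v)) UNIV"
    by (simp only:) (intro has_sum_add S_has_sum)
qed

lemma S_cscale: "S (cscale a u) = cscale a (S u)"
proof (rule S_eqI)
  show "((\<lambda>k. cscale (cinner (cscale a u) (\<psi> k)) (\<psi> k)) has_sum cscale a (S u)) UNIV"
    using has_sum_bounded_linear[OF bounded_linear_cscale[of a] S_has_sum[of u]] by (simp add: cinner_cscale_left)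
qed

lemma S_P: "S (P u) = S u"
  by (simp add: S_def cinner_psi_P)

lemma P_S: "P (S u) = S u"
  using S_eqI[OF has_sum_bounded_linear[OF P_linear S_has_sum[of u], simplified P_cscale P_psi]] by simp

lemma S_H [simp]: "S u \<in> H"
  by (simp add: H_eq P_S)

lemma cinner_S: "((\<lambda>k. cinner u (\<psi> k) * cnj (cinner v (\<psi> k))) has_sum cinner (S u) v) UNIV"
  using has_sum_bounded_linear[OF bounded_linear_cinner_left[of v] S_has_sum[of u]]
  by (simp add: cinner_cscale_left cinner_commute[of "\<psi> _" v])

lemma S_sym: "cinner (S u) v = cinner u (S v)"
proof -
  have "((\<lambda>k. cnj (cinner v (\<psi> k) * cnj (cinner u (\<psi> k)))) has_sum cnj (cinner (S v) u)) UNIV"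
    using cinner_S[of v u] by (subst has_sum_cnj_iff)
  then have "((\<lambda>k. cinner u (\<psi> k) * cnj (cinner v (\<psi> k))) has_sum cinner u (S v)) UNIV"
    by (simp add: mult.commute cinner_commute[of u "S v"])
  then show ?thesis using cinner_S has_sum_unique by blast
qed

lemma S_self: "cinner (S u) u = of_real (\<Sum>\<^sub>\<infinity>k. (cmod (cinner u (\<psi> k)))\<^sup>2)"
proof -
  have "((\<lambda>k. complex_of_real ((cmod (cinner u (\<psi> k)))\<^sup>2)) has_sum of_real (\<Sum>\<^sub>\<infinity>k. (cmod (cinner u (\<psi> k)))\<^sup>2)) UNIV"
    by (intro has_sum_of_real has_sum_infsum coeff_summable)
  then show ?thesis
    using cinner_S[of u u] by (intro has_sum_unique[OF cinner_S]) (simp only: complex_norm_square)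
qed

lemma norm_S_le: "norm (S u) \<le> B * norm u"
proof -
  have "norm (\<Sum>k\<in>F. cscale (cinner u (\<psi> k)) (\<psi> k)) \<le> B * norm u" if "finite F" for F
  proof (rule power2_le_imp_le)
    have "(norm (\<Sum>k\<in>F. cscale (cinner u (\<psi> k)) (\<psi> k)))\<^sup>2 \<le> B * (\<Sum>k\<in>F. (cmod (cinner u (\<psi> k)))\<^sup>2)"
      by (rule synthesis_le[OF that])
    also have "\<dots> \<le> B * (B * (norm u)\<^sup>2)"
      using B_pos by (intro mult_left_mono coeff_finite_le[OF that]) auto
    finally show "(norm (\<Sum>k\<in>F. cscale (cinner u (\<psi> k)) (\<psi> k)))\<^sup>2 \<le> (B * norm u)\<^sup>2"
      by (simp add: power2_eq_square mult_ac)
  qed (use B_pos in auto)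
  then show ?thesis
    using S_has_sum[of u] unfolding has_sum_def
    by (intro Lim_norm_ubound[of "finite_subsets_at_top UNIV"]) (auto intro: eventually_finite_subsets_at_top_weakI)
qed

lemma bounded_linear_S: "bounded_linear S"
  by (rule bounded_linear_intro[where K=B])
    (auto simp: S_add scaleR_cscale S_cscale norm_S_le mult.commute)

lemma norm_Pythagoras: "(norm u)\<^sup>2 = (norm (P u))\<^sup>2 + (norm (u - P u))\<^sup>2"
proof -
  have "inner (P u) (u - P u) = 0"
    by (simp add: inner_lsq_def P_sym P_diff P_idem)
  then have "inner (P u) u = inner (P u) (P u)"
    by (simp add: inner_diff_right)
  then show ?thesis
    by (simp add: power2_norm_eq_inner inner_diff inner_commute[of u "P u"])
qed

text \<open>The root of the extended operator commutes with everything that operator commutes with.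
  Applied to \<open>P\<close>, this keeps \<open>H\<close> invariant; applied to
  \<open>cscale\<close>, it makes a root of a real-linear operator complex linear, so that its
  quadratic form is real.\<close>

lemma S_inverse_sqrt:
  obtains R :: "'a lsq \<Rightarrow> 'a lsq" where "bounded_linear R" "\<And>a u. R (cscale a u) = cscale a (R u)"
    "\<And>u. u \<in> H \<Longrightarrow> R u \<in> H" "\<And>u. 0 \<le> Re (cinner (R u) u)" "\<And>u. Im (cinner (R u) u) = 0"
    "\<And>u. u \<in> H \<Longrightarrow> R (R (S u)) = u" "\<And>u. u \<in> H \<Longrightarrow> S (R (R u)) = u"
proof -
  define T where "T u = S u + A *\<^sub>R (u - P u)" for u
  have T_bl: "bounded_linear T"
    unfolding T_def[abs_def]
    by (intro bounded_linear_add bounded_linear_S bounded_linear_const_scaleR bounded_linear_sub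
        bounded_linear_ident P_linear)
  have T_cscale: "T (cscale a u) = cscale a (T u)" for a u
    by (simp add: T_def S_cscale P_cscale scaleR_cscale cscale_add_right cscale_diff_right mult.commute)
  have T_P: "T (P u) = P (T u)" for u
    by (simp add: T_def S_P P_S P_add scaleR_cscale P_cscale P_diff P_idem)
  have T_S: "T u = S u" if "u \<in> H" for u
    using H_P[OF that] by (simp add: T_def)
  have T_sym: "cinner (T u) v = cinner u (T v)" for u v
    by (simp add: T_def S_sym cinner_add_left cinner_add_right scaleR_cscale cinner_cscale_left
        cinner_cscale_right cinner_diff_left cinner_diff_right P_sym)
  define TT where "TT = Blinfun T"
  have TT: "blinfun_apply TT = T"
    by (simp add: TT_def bounded_linear_Blinfun_apply T_bl)
  obtain R :: "'a lsq \<Rightarrow>\<^sub>L 'a lsq" where R: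
    "\<And>f g. inner (R f) g = inner f (R g)" "\<And>f. 0 \<le> inner (R f) f"
    "TT o\<^sub>L (R o\<^sub>L R) = id_blinfun" "(R o\<^sub>L R) o\<^sub>L TT = id_blinfun"
    "\<And>V :: 'a lsq \<Rightarrow>\<^sub>L 'a lsq. V o\<^sub>L TT = TT o\<^sub>L V \<Longrightarrow> V o\<^sub>L R = R o\<^sub>L V"
  proof (rule symmetric_square_root_inverse[of TT A])
    show "inner (TT f) g = inner f (TT g)" for f g
      by (simp add: TT inner_lsq_def T_sym)
    show "A > 0" by (rule A_pos)
    show "A * (norm f)\<^sup>2 \<le> inner (TT f) f" for f
    proof -
      have "A * (norm f)\<^sup>2 = A * (norm (P f))\<^sup>2 + A * (norm (f - P f))\<^sup>2"
        by (simp add: norm_Pythagoras[of f] distrib_left)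
      also have "\<dots> \<le> inner (S f) f + A * (norm (f - P f))\<^sup>2"
        using coeff_ge[of f] by (simp add: inner_lsq_def S_self)
      also have "(norm (f - P f))\<^sup>2 = inner (f - P f) f"
      proof -
        have "inner (f - P f) (P f) = 0"
          by (simp add: inner_lsq_def P_sym[symmetric] P_diff P_idem)
        then show ?thesis by (simp add: power2_norm_eq_inner inner_diff_right)
      qed
      finally show ?thesis by (simp add: TT T_def inner_add_left)
    qed
  qed blast
  have comm: "V (R u) = R (V u)" if V: "bounded_linear V" "\<And>u. V (T u) = T (V u)" for V u
  proof -
    have "Blinfun V o\<^sub>L TT = TT o\<^sub>L Blinfun V"
      by (rule blinfun_eqI) (simp add: TT bounded_linear_Blinfun_apply V)
    then have "Blinfun V o\<^sub>L R = R o\<^sub>L Blinfun V" by (rule R(5))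
    then have "blinfun_apply (Blinfun V o\<^sub>L R) u = blinfun_apply (R o\<^sub>L Blinfun V) u" by simp
    then show ?thesis by (simp add: bounded_linear_Blinfun_apply V)
  qed
  have R_cscale: "R (cscale a u) = cscale a (R u)" for a u
    using comm[of "cscale a" u] by (simp add: bounded_linear_cscale T_cscale)
  have R_P: "P (R u) = R (P u)" for u
    by (rule comm) (simp_all add: P_linear T_P)
  have TR: "T (R (R u)) = u" "R (R (T u)) = u" for u
    using arg_cong[OF R(3), of "\<lambda>Z. blinfun_apply Z u"] arg_cong[OF R(4), of "\<lambda>Z. blinfun_apply Z u"]
    by (simp_all add: TT)
  show thesis
  proof (rule that)
    show "bounded_linear (blinfun_apply R)" by (rule blinfun.bounded_linear_right)
    show "R (cscale a u) = cscale a (R u)" for a u by (rule R_cscale)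
    show RH: "R u \<in> H" if "u \<in> H" for u
      using that by (simp add: H_eq R_P)
    show "0 \<le> Re (cinner (R u) u)" for u
      using R(2)[of u] by (simp add: inner_lsq_def)
    show "Im (cinner (R u) u) = 0" for u
    proof -
      have "inner (R u) (cscale \<i> u) = inner u (cscale \<i> (R u))"
        by (simp add: R(1) R_cscale)
      then show ?thesis
        using cinner_commute[of "R u" u] by (simp add: inner_lsq_def cinner_cscale_right complex_eq_iff)
    qed
    show "R (R (S u)) = u" if "u \<in> H" for u
      using TR(2)[of u] T_S[OF that] by simp
    show "S (R (R u)) = u" if "u \<in> H" for u
      using TR(1)[of u] T_S[OF RH[OF RH[OF that]]] by simp
  qed
qed

end

definition cspan :: "('k \<Rightarrow> 'a::euclidean_space lsq) \<Rightarrow> 'a lsq set" where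
  "cspan \<psi> = {u. \<forall>\<epsilon>>0. \<exists>F c. finite F \<and> norm (u - (\<Sum>k\<in>F. cscale (c k) (\<psi> k))) < \<epsilon>}"

text \<open>One inclusion is closedness of \<open>H\<close>; the other is frame reconstruction,
  which expands u in the coefficients of its image under the inverse of \<open>S\<close>.\<close>

lemma (in lsq_frame) cspan_frame: "cspan \<psi> = H"
proof (intro equalityI subsetI)
  fix u assume u: "u \<in> cspan \<psi>"
  have "(\<Sum>k\<in>F. cscale (c k) (\<psi> k)) \<in> H" for F and c :: "'k \<Rightarrow> complex"
    by (induction F rule: infinite_finite_induct) (simp_all add: H_add H_cscale H_zero)
  moreover have "\<exists>F c. finite F \<and> norm ((\<Sum>k\<in>F. cscale (c k) (\<psi> k)) - u) < e" if "e > 0" for e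
    using u that by (simp add: cspan_def norm_minus_commute)
  ultimately have "u \<in> closure H"
    unfolding closure_approachable dist_norm by blast
  then show "u \<in> H" using closed_H by simp
next
  fix u assume u: "u \<in> H"
  obtain R where R: "\<And>u. u \<in> H \<Longrightarrow> S (R (R u)) = u"
    using S_inverse_sqrt by metis
  \<comment> \<open>On \<open>H\<close> the operator \<open>R R\<close> is the inverse of
    \<open>S\<close>, so these are the coefficients of u against the canonical dual frame.\<close>
  define c where "c k = cinner (R (R u)) (\<psi> k)" for k
  have "((\<lambda>k. cscale (c k) (\<psi> k)) has_sum u) UNIV"
    using S_has_sum[of "R (R u)"] R[OF u] by (simp add: c_def)
  then have lim: "((\<lambda>F. \<Sum>k\<in>F. cscale (c k) (\<psi> k)) \<longlongrightarrow> u) (finite_subsets_at_top UNIV)"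
    by (simp add: has_sum_def)
  have "\<exists>F c. finite F \<and> norm (u - (\<Sum>k\<in>F. cscale (c k) (\<psi> k))) < e" if "e > 0" for e
  proof -
    have "\<forall>\<^sub>F F in finite_subsets_at_top UNIV. dist (\<Sum>k\<in>F. cscale (c k) (\<psi> k)) u < e"
      using lim that by (rule tendstoD)
    then obtain F where "finite F" "dist (\<Sum>k\<in>F. cscale (c k) (\<psi> k)) u < e"
      unfolding eventually_finite_subsets_at_top by blast
    then show ?thesis by (auto simp: dist_norm norm_minus_commute)
  qed
  then show "u \<in> cspan \<psi>" by (simp add: cspan_def)
qed

section \<open>Frames of functions and the canonical tight frame\<close>

text \<open>The root inside the canonical tight frame is selected by choice and is known only
  through these properties. It is therefore an arbitrary \<open>r\<close> rather than the root
  constructed above.\<close>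

locale lsq_inverse_sqrt = lsq_frame P H A B \<psi>
  for P :: "'a::euclidean_space lsq \<Rightarrow> 'a lsq" and H A B and \<psi> :: "'k \<Rightarrow> 'a lsq" +
  fixes r :: "'a lsq \<Rightarrow> 'a lsq" and C :: real
  assumes r_H [simp]: "u \<in> H \<Longrightarrow> r u \<in> H"
    and r_add: "u \<in> H \<Longrightarrow> v \<in> H \<Longrightarrow> r (u + v) = r u + r v"
    and r_cscale: "u \<in> H \<Longrightarrow> r (cscale a u) = cscale a (r u)"
    and r_bound: "u \<in> H \<Longrightarrow> norm (r u) \<le> C * norm u"
    and r_pos: "u \<in> H \<Longrightarrow> 0 \<le> Re (cinner (r u) u)"
    and r_real: "u \<in> H \<Longrightarrow> Im (cinner (r u) u) = 0"
    and r_r_S: "u \<in> H \<Longrightarrow> r (r (S u)) = u"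
    and S_r_r: "u \<in> H \<Longrightarrow> S (r (r u)) = u"
begin

text \<open>On a complex space, a real quadratic form forces the operator to be symmetric.\<close>

lemma r_sym:
  assumes u: "u \<in> H" and v: "v \<in> H"
  shows "cinner (r u) v = cinner u (r v)"
proof -
  have *: "Im (cinner (r u) v) + Im (cinner (r v) u) = 0" if "u \<in> H" for u
    using r_real[OF H_add[OF that v]] r_real[OF that] r_real[OF v]
    by (simp add: r_add that v cinner_add_left cinner_add_right)
  have "Re (cinner (r u) v) = Re (cinner (r v) u)"
    using *[OF H_cscale[OF u, of \<i>]] by (simp add: r_cscale u cinner_cscale_left cinner_cscale_right)
  with *[OF u] have "cinner (r u) v = cnj (cinner (r v) u)"
    by (simp add: complex_eq_iff)
  then show ?thesis by (simp flip: cinner_commute)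
qed

text \<open>\<open>S\<close> is the inverse of \<open>r r\<close> on \<open>H\<close>, hence
  commutes with \<open>r\<close>.\<close>

lemma r_S_r: assumes u: "u \<in> H" shows "r (S (r u)) = u"
proof -
  have "S (r (r (r (S u)))) = r (S u)"
    by (rule S_r_r) simp
  then have "S (r u) = r (S u)" by (simp add: r_r_S u)
  then show ?thesis by (simp add: r_r_S u)
qed

lemma parseval: "lsq_frame_bounds 1 1 H (\<lambda>k. r (\<psi> k))"
  unfolding lsq_frame_bounds_def
proof (intro conjI allI ballI)
  fix u assume u: "u \<in> H"
  have eq: "(\<lambda>k. (cmod (cinner u (r (\<psi> k))))\<^sup>2) = (\<lambda>k. (cmod (cinner (r u) (\<psi> k)))\<^sup>2)"
    by (simp add: r_sym u)
  show "(\<lambda>k. (cmod (cinner u (r (\<psi> k))))\<^sup>2) summable_on UNIV"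
    unfolding eq by (rule coeff_summable)
  have "complex_of_real (\<Sum>\<^sub>\<infinity>k. (cmod (cinner (r u) (\<psi> k)))\<^sup>2) = cinner (r (S (r u))) u"
    using S_self[of "r u"] r_sym[of "S (r u)" u] u by simp
  then have "(\<Sum>\<^sub>\<infinity>k. (cmod (cinner (r u) (\<psi> k)))\<^sup>2) = (norm u)\<^sup>2"
    unfolding r_S_r[OF u] cinner_self_norm by (simp only: of_real_eq_iff)
  then show "1 * (norm u)\<^sup>2 \<le> (\<Sum>\<^sub>\<infinity>k. (cmod (cinner u (r (\<psi> k))))\<^sup>2)"
    "(\<Sum>\<^sub>\<infinity>k. (cmod (cinner u (r (\<psi> k))))\<^sup>2) \<le> 1 * (norm u)\<^sup>2"
    unfolding eq by simp_all
qed simp_all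

text \<open>Tightness says that the quadratic form of the symmetric operator
  \<open>D = S - c\<close> vanishes on \<open>H\<close>. Evaluated at \<open>u + D u\<close>, it
  leaves twice the squared norm of \<open>D u\<close>.\<close>

lemma tight_S:
  assumes tight: "lsq_frame_bounds c c H \<psi>" and u: "u \<in> H"
  shows "S u = cscale (of_real c) u"
proof -
  define D where "D u = S u - c *\<^sub>R u" for u
  have D_sym: "inner (D u) v = inner u (D v)" for u v
    by (simp add: D_def inner_diff_left inner_diff_right) (simp add: inner_lsq_def S_sym)
  have D_add: "D (u + v) = D u + D v" for u v
    by (simp add: D_def S_add scaleR_add_right)
  have D_zero: "inner (D u) u = 0" if "u \<in> H" for u
  proof -
    have "(\<Sum>\<^sub>\<infinity>k. (cmod (cinner u (\<psi> k)))\<^sup>2) = c * (norm u)\<^sup>2"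
      using tight that unfolding lsq_frame_bounds_def by (meson order_antisym)
    then have "inner (S u) u = c * (norm u)\<^sup>2"
      by (simp add: inner_lsq_def S_self)
    then show ?thesis
      by (simp add: D_def inner_diff_left power2_norm_eq_inner)
  qed
  have DH: "D u \<in> H"
    by (simp add: D_def scaleR_cscale H_diff H_cscale u)
  have "inner (D (u + D u)) (u + D u) = 0"
    by (rule D_zero[OF H_add[OF u DH]])
  then have "inner (D u) (D u) = 0"
    using D_zero[OF u] D_zero[OF DH]
    by (simp add: D_add inner_add D_sym[of "D u" u])
  then show ?thesis by (simp add: D_def scaleR_cscale)
qed

text \<open>Positivity selects the root: since \<open>r r\<close> is multiplication by
  \<open>s^2\<close>, the vector \<open>w = r u - s u\<close> satisfies \<open>r w = - s w\<close>,
  and a positive operator has no negative eigenvalue.\<close>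

lemma tight_r:
  assumes tight: "lsq_frame_bounds c c H \<psi>" and u: "u \<in> H"
  shows "r u = cscale (of_real (1 / sqrt c)) u"
proof -
  have c: "c > 0" using tight by (simp add: lsq_frame_bounds_def)
  define s where "s = 1 / sqrt c"
  have s: "s > 0" "s * s * c = 1" using c by (simp_all add: s_def)
  have "cscale (of_real c) (r (r u)) = u"
    using r_r_S[OF u] by (simp add: tight_S[OF tight u] r_cscale u)
  then have "cscale (of_real (s * s)) (cscale (of_real c) (r (r u))) = cscale (of_real (s * s)) u"
    by simp
  then have rr: "r (r u) = cscale (of_real (s * s)) u"
    by (simp add: s(2) flip: of_real_mult)
  define w where "w = r u + cscale (of_real (- s)) u"
  have wH: "w \<in> H" by (simp add: w_def H_add H_cscale u)
  have "r w = cscale (of_real (- s)) w"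
    by (simp add: w_def r_add r_cscale H_cscale u rr cscale_add_right add.commute flip: of_real_mult)
  then have "Re (cinner (r w) w) = - (s * (norm w)\<^sup>2)"
    by (simp add: cinner_cscale_left cinner_self_norm)
  with r_pos[OF wH] have "s * (norm w)\<^sup>2 \<le> 0" by simp
  then have "w = 0" using s(1) by (simp add: mult_le_0_iff)
  then have "r u = - cscale (of_real (- s)) u"
    by (simp only: w_def eq_neg_iff_add_eq_0)
  also have "\<dots> = cscale (of_real s) u"
    unfolding scaleR_cscale[symmetric] by simp
  finally show ?thesis by (simp only: s_def)
qed

end

section \<open>From classes back to functions\<close>

definition fset_of :: "'a::euclidean_space lsq set \<Rightarrow> ('a \<Rightarrow> complex) set" where
  "fset_of K = {f \<in> L2. abs_lsq f \<in> K}"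

lemma fset_of_rep [simp]: "u \<in> K \<Longrightarrow> rep_lsq u \<in> fset_of K"
  by (simp add: fset_of_def)

lemma frame_with_bounds_iff:
  "frame_with_bounds A B (fset_of K) \<psi> \<longleftrightarrow>
    (\<forall>k. \<psi> k \<in> L2) \<and> lsq_frame_bounds A B K (\<lambda>k. abs_lsq (\<psi> k))"
proof -
  have "(\<forall>f\<in>fset_of K. Q (abs_lsq f)) \<longleftrightarrow> (\<forall>u\<in>K. Q u)" for Q
    by (metis (mono_tags, lifting) abs_rep fset_of_def fset_of_rep mem_Collect_eq)
  note ball = this
  let ?Q = "\<lambda>u. (\<lambda>k. (cmod (cinner u (abs_lsq (\<psi> k))))\<^sup>2) summable_on UNIV \<and>
        A * (norm u)\<^sup>2 \<le> (\<Sum>\<^sub>\<infinity>k. (cmod (cinner u (abs_lsq (\<psi> k))))\<^sup>2) \<and>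
        (\<Sum>\<^sub>\<infinity>k. (cmod (cinner u (abs_lsq (\<psi> k))))\<^sup>2) \<le> B * (norm u)\<^sup>2"
  have "frame_with_bounds A B (fset_of K) \<psi> \<longleftrightarrow>
    0 < A \<and> 0 < B \<and> (\<forall>k. \<psi> k \<in> fset_of K) \<and> (\<forall>f\<in>fset_of K. ?Q (abs_lsq f))"
    unfolding frame_with_bounds_def
    by (auto simp: fset_of_def abs_cinner abs_norm cong: conj_cong)
  also have "\<dots> \<longleftrightarrow> 0 < A \<and> 0 < B \<and> (\<forall>k. \<psi> k \<in> fset_of K) \<and> (\<forall>u\<in>K. ?Q u)"
    by (simp only: ball[of ?Q])
  also have "\<dots> \<longleftrightarrow> (\<forall>k. \<psi> k \<in> L2) \<and> lsq_frame_bounds A B K (\<lambda>k. abs_lsq (\<psi> k))"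
    unfolding lsq_frame_bounds_def fset_of_def by blast
  finally show ?thesis .
qed

lemma closed_span_eq:
  assumes "\<And>k. \<psi> k \<in> L2"
  shows "closed_span \<psi> = fset_of (cspan (\<lambda>k. abs_lsq (\<psi> k)))"
proof -
  have "l2_norm (\<lambda>x. f x - (\<Sum>k\<in>F. c k * \<psi> k x)) = norm (abs_lsq f - (\<Sum>k\<in>F. cscale (c k) (abs_lsq (\<psi> k))))"
    if "f \<in> L2" for f F c
    by (simp add: l2_norm_diff that L2_sum L2_cmult assms abs_cscale abs_sum)
  then show ?thesis
    unfolding closed_span_def cspan_def fset_of_def by (auto cong: conj_cong)
qed

lemma l2_has_sum_iff:
  "l2_has_sum w g \<longleftrightarrow> (\<forall>k. w k \<in> L2) \<and> g \<in> L2 \<and> ((\<lambda>k. abs_lsq (w k)) has_sum abs_lsq g) UNIV"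
proof -
  have "((\<lambda>F. l2_norm (\<lambda>x. g x - (\<Sum>k\<in>F. w k x))) \<longlongrightarrow> 0) (finite_subsets_at_top UNIV)
    \<longleftrightarrow> ((\<lambda>k. abs_lsq (w k)) has_sum abs_lsq g) UNIV" if "\<forall>k. w k \<in> L2" "g \<in> L2"
    using that unfolding has_sum_def tendsto_dist_iff[of "sum (\<lambda>k. abs_lsq (w k))"]
    by (simp add: l2_norm_diff L2_sum abs_sum dist_norm norm_minus_commute)
  then show ?thesis
    unfolding l2_has_sum_def by blast
qed

context lsq_projection
begin

text \<open>An operator on functions is linear only modulo null sets. Boundedness, applied to the
  difference of two representatives of one class, shows that their images agree, so the operator
  descends to classes.\<close>

lemma bounded_op_lift:
  assumes T: "bounded_op (fset_of H) T"
  defines "t \<equiv> \<lambda>u. abs_lsq (T (rep_lsq u))"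
  shows "f \<in> fset_of H \<Longrightarrow> T f \<in> L2" "f \<in> fset_of H \<Longrightarrow> abs_lsq (T f) = t (abs_lsq f)"
    "u \<in> H \<Longrightarrow> t u \<in> H" "u \<in> H \<Longrightarrow> v \<in> H \<Longrightarrow> t (u + v) = t u + t v"
    "u \<in> H \<Longrightarrow> t (cscale a u) = cscale a (t u)"
    "\<exists>C. \<forall>u\<in>H. norm (t u) \<le> C * norm u"
proof -
  have TH: "T f \<in> L2 \<and> abs_lsq (T f) \<in> H" if "f \<in> fset_of H" for f
    using T that by (auto simp: bounded_op_def fset_of_def)
  show TL: "T f \<in> L2" if "f \<in> fset_of H" for f using TH that by blast
  show tH: "t u \<in> H" if "u \<in> H" for u using TH that by (simp add: t_def)
  have comb: "(\<lambda>x. a * f x + b * g x) \<in> fset_of H" if "f \<in> fset_of H" "g \<in> fset_of H" for a b f g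
    using that by (auto simp: fset_of_def L2_add L2_cmult abs_plus[symmetric] abs_cscale[symmetric] H_add H_cscale)
  have lin: "abs_lsq (T (\<lambda>x. a * f x + b * g x)) = cscale a (abs_lsq (T f)) + cscale b (abs_lsq (T g))"
    if f: "f \<in> fset_of H" and g: "g \<in> fset_of H" for a b f g
  proof -
    have "T (\<lambda>x. a * f x + b * g x) =\<^sub>a\<^sub>e (\<lambda>x. a * T f x + b * T g x)"
      using T f g by (simp add: bounded_op_def)
    then have "abs_lsq (T (\<lambda>x. a * f x + b * g x)) = abs_lsq (\<lambda>x. a * T f x + b * T g x)"
      using TL[OF comb[OF f g]] TL[OF f] TL[OF g] by (simp add: abs_eq_iff L2_add L2_cmult)
    then show ?thesis
      using TL[OF f] TL[OF g] by (simp add: abs_plus abs_cscale L2_cmult)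
  qed
  obtain C where C: "\<And>f. f \<in> fset_of H \<Longrightarrow> norm (abs_lsq (T f)) \<le> C * norm (abs_lsq f)"
    using T TH by (auto simp: bounded_op_def abs_norm fset_of_def)
  have cong: "abs_lsq (T f) = abs_lsq (T g)" if f: "f \<in> fset_of H" and g: "g \<in> fset_of H" and eq: "abs_lsq f = abs_lsq g" for f g
  proof -
    have fg: "f \<in> L2" "g \<in> L2" using f g by (auto simp: fset_of_def)
    have "abs_lsq (\<lambda>x. 1 * f x + (- 1) * g x) = abs_lsq f + cscale (-1) (abs_lsq g)"
      by (simp only: abs_plus[symmetric] abs_cscale[symmetric] L2_cmult fg cscale_one)
    also have "\<dots> = 0" by (simp add: eq cscale_minus_one)
    finally have "norm (cscale 1 (abs_lsq (T f)) + cscale (- 1) (abs_lsq (T g))) \<le> C * 0"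
      using C[OF comb[OF f g, of 1 "-1"]] lin[OF f g, of 1 "-1"] by simp
    then show ?thesis by (simp add: cscale_minus_one)
  qed
  show abs: "abs_lsq (T f) = t (abs_lsq f)" if f: "f \<in> fset_of H" for f
    unfolding t_def using f by (intro cong) (auto simp: fset_of_def)
  have t_lin: "t (cscale a u + cscale b v) = cscale a (t u) + cscale b (t v)" if u: "u \<in> H" and v: "v \<in> H" for a b u v
  proof -
    have "abs_lsq (\<lambda>x. a * rep_lsq u x + b * rep_lsq v x) = cscale a u + cscale b v"
      by (simp add: abs_plus[symmetric] abs_cscale[symmetric] L2_cmult)
    then show ?thesis
      using abs[OF comb[OF fset_of_rep[OF u] fset_of_rep[OF v]], of a b]
        lin[OF fset_of_rep[OF u] fset_of_rep[OF v], of a b] by (simp add: t_def)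
  qed
  show "t (u + v) = t u + t v" if "u \<in> H" "v \<in> H" for u v
    using t_lin[OF that, of 1 1] by simp
  show "t (cscale a u) = cscale a (t u)" if u: "u \<in> H" for a u
  proof -
    have "cscale 0 v = 0" for v :: "'a lsq"
      using scaleR_cscale[of 0 v] by simp
    then show ?thesis using t_lin[OF u u, of a 0] by simp
  qed
  show "\<exists>C. \<forall>u\<in>H. norm (t u) \<le> C * norm u"
    using C[OF fset_of_rep] by (auto simp: t_def)
qed

lemma bounded_op_rep:
  assumes t: "\<And>u. u \<in> H \<Longrightarrow> t u \<in> H" "\<And>u v. u \<in> H \<Longrightarrow> v \<in> H \<Longrightarrow> t (u + v) = t u + t v"
    "\<And>a u. u \<in> H \<Longrightarrow> t (cscale a u) = cscale a (t u)" "\<And>u. u \<in> H \<Longrightarrow> norm (t u) \<le> C * norm u"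
  shows "bounded_op (fset_of H) (\<lambda>f. rep_lsq (t (abs_lsq f)))"
  unfolding bounded_op_def
proof (intro conjI ballI allI exI[of _ C])
  fix f assume f: "f \<in> fset_of H"
  then have fH: "f \<in> L2" "abs_lsq f \<in> H" by (auto simp: fset_of_def)
  show "rep_lsq (t (abs_lsq f)) \<in> fset_of H" using fH t(1) by simp
  show "l2_norm (rep_lsq (t (abs_lsq f))) \<le> C * l2_norm f"
    using t(4)[OF fH(2)] fH(1) by (simp flip: abs_norm)
  fix g a b assume g: "g \<in> fset_of H"
  then have gH: "g \<in> L2" "abs_lsq g \<in> H" by (auto simp: fset_of_def)
  show "rep_lsq (t (abs_lsq (\<lambda>x. a * f x + b * g x))) =\<^sub>a\<^sub>e
      (\<lambda>x. a * rep_lsq (t (abs_lsq f)) x + b * rep_lsq (t (abs_lsq g)) x)"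
    using fH gH by (subst abs_eq_iff[symmetric])
      (simp_all add: L2_add L2_cmult abs_plus[symmetric] abs_cscale[symmetric] t H_cscale)
qed

end

text \<open>Sums in the Hilbert space are unique, so the function chosen by \<open>frame_op\<close>
  is determined up to null sets.\<close>

lemma frame_op_lsq:
  assumes "lsq_frame P H A B (\<lambda>k. abs_lsq (\<psi> k))" "\<And>k. \<psi> k \<in> L2" "f \<in> L2"
  shows "frame_op \<psi> f \<in> L2" "abs_lsq (frame_op \<psi> f) = lsq_frame.S (\<lambda>k. abs_lsq (\<psi> k)) (abs_lsq f)"
proof -
  interpret lsq_frame P H A B "\<lambda>k. abs_lsq (\<psi> k)" by fact
  have eq: "abs_lsq (\<lambda>x. l2_inner f (\<psi> k) * \<psi> k x) = cscale (cinner (abs_lsq f) (abs_lsq (\<psi> k))) (abs_lsq (\<psi> k))" for k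
    by (simp add: abs_cscale abs_cinner assms)
  have "l2_has_sum (\<lambda>k x. l2_inner f (\<psi> k) * \<psi> k x) (rep_lsq (S (abs_lsq f)))"
    unfolding l2_has_sum_iff eq using S_has_sum by (auto intro: L2_cmult assms)
  then have *: "l2_has_sum (\<lambda>k x. l2_inner f (\<psi> k) * \<psi> k x) (frame_op \<psi> f)"
    unfolding frame_op_def by (rule someI[where P="l2_has_sum (\<lambda>k x. l2_inner f (\<psi> k) * \<psi> k x)"])
  then show "frame_op \<psi> f \<in> L2" by (simp add: l2_has_sum_iff)
  show "abs_lsq (frame_op \<psi> f) = S (abs_lsq f)"
    using * unfolding l2_has_sum_iff eq using S_eqI by metis
qed

text \<open>The constructed \<open>R\<close> supplies the witnesses for both choices:
  \<open>R R\<close> for the inverse and \<open>R\<close> for its root. The inverse is thereby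
  identified on classes, while the root retains the properties collected in
  \<open>lsq_inverse_sqrt\<close>.\<close>

lemma canonical_tight_frame_lsq:
  assumes "lsq_frame P H A B (\<lambda>k. abs_lsq (\<psi> k))" and \<psi>: "\<And>k. \<psi> k \<in> L2"
  obtains r C where "lsq_inverse_sqrt P H A B (\<lambda>k. abs_lsq (\<psi> k)) r C"
    "\<And>k. canonical_tight_frame (fset_of H) \<psi> k \<in> L2"
    "\<And>k. abs_lsq (canonical_tight_frame (fset_of H) \<psi> k) = r (abs_lsq (\<psi> k))"
proof -
  interpret lsq_frame P H A B "\<lambda>k. abs_lsq (\<psi> k)" by fact
  note fop = frame_op_lsq[OF assms]
  obtain R where R: "bounded_linear R" "\<And>a u. R (cscale a u) = cscale a (R u)"
    "\<And>u. u \<in> H \<Longrightarrow> R u \<in> H" "\<And>u. 0 \<le> Re (cinner (R u) u)" "\<And>u. Im (cinner (R u) u) = 0"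
    "\<And>u. u \<in> H \<Longrightarrow> R (R (S u)) = u" "\<And>u. u \<in> H \<Longrightarrow> S (R (R u)) = u"
    by (rule S_inverse_sqrt) blast
  obtain K where K: "\<And>u. norm (R u) \<le> norm u * K" "0 \<le> K"
    using bounded_linear.nonneg_bounded[OF R(1)] by metis
  have R_add: "R (u + v) = R u + R v" for u v
    using R(1) by (simp add: linear_simps)
  have memL2: "f \<in> L2" "abs_lsq f \<in> H" if "f \<in> fset_of H" for f
    using that by (auto simp: fset_of_def)
  define V where "V = op_inverse (fset_of H) (frame_op \<psi>)"
  have "is_op_inverse (fset_of H) (frame_op \<psi>) (\<lambda>f. rep_lsq (R (R (abs_lsq f))))"
    unfolding is_op_inverse_def
  proof (intro conjI ballI)
    show "bounded_op (fset_of H) (\<lambda>f. rep_lsq (R (R (abs_lsq f))))"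
    proof (rule bounded_op_rep[where C="K * K"])
      fix u
      have "norm (R (R u)) \<le> norm (R u) * K" by (rule K)
      also have "\<dots> \<le> norm u * K * K" by (intro mult_right_mono K)
      finally show "norm (R (R u)) \<le> K * K * norm u" by (simp add: mult_ac)
    qed (simp_all add: R R_add)
    fix f assume f: "f \<in> fset_of H"
    show "rep_lsq (R (R (abs_lsq (frame_op \<psi> f)))) =\<^sub>a\<^sub>e f"
      using memL2[OF f] by (subst abs_eq_iff[symmetric]) (simp_all add: fop R)
    show "frame_op \<psi> (rep_lsq (R (R (abs_lsq f)))) =\<^sub>a\<^sub>e f"
      using memL2[OF f] by (subst abs_eq_iff[symmetric]) (simp_all add: fop R)
  qed
  then have V: "is_op_inverse (fset_of H) (frame_op \<psi>) V"
    unfolding V_def op_inverse_def by (rule someI[where P="is_op_inverse (fset_of H) (frame_op \<psi>)"])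
  then have Vb: "bounded_op (fset_of H) V" by (simp add: is_op_inverse_def)
  define v where "v u = abs_lsq (V (rep_lsq u))" for u
  note Vl = bounded_op_lift[OF Vb, folded v_def]
  have v_S: "v (S u) = u" if u: "u \<in> H" for u
  proof -
    have "frame_op \<psi> (rep_lsq u) \<in> fset_of H" by (simp add: fset_of_def fop)
    then have "abs_lsq (V (frame_op \<psi> (rep_lsq u))) = v (S u)" "V (frame_op \<psi> (rep_lsq u)) \<in> L2"
      using Vl(1,2) by (simp_all add: fop)
    moreover have "V (frame_op \<psi> (rep_lsq u)) =\<^sub>a\<^sub>e rep_lsq u"
      using V u by (simp add: is_op_inverse_def)
    ultimately show ?thesis by (metis abs_eq_iff abs_rep rep_L2)
  qed
  \<comment> \<open>A left inverse of \<open>S\<close> evaluated at \<open>S (R (R u)) = u\<close>;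
    this pins down the chosen inverse on classes.\<close>
  have v_R: "v u = R (R u)" if u: "u \<in> H" for u
    using v_S[of "R (R u)"] by (simp add: R u)
  define r0 where "r0 = op_sqrt (fset_of H) V"
  have "positive_op (fset_of H) (\<lambda>f. rep_lsq (R (abs_lsq f))) \<and>
    (\<forall>f\<in>fset_of H. rep_lsq (R (abs_lsq (rep_lsq (R (abs_lsq f))))) =\<^sub>a\<^sub>e V f)"
    unfolding positive_op_def
  proof (intro conjI ballI)
    show "bounded_op (fset_of H) (\<lambda>f. rep_lsq (R (abs_lsq f)))"
      by (rule bounded_op_rep[where C=K]) (use K(1) in \<open>simp_all add: R R_add mult.commute\<close>)
    fix f assume f: "f \<in> fset_of H"
    show "Im (l2_inner (rep_lsq (R (abs_lsq f))) f) = 0" "0 \<le> Re (l2_inner (rep_lsq (R (abs_lsq f))) f)"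
      using R(4,5)[of "abs_lsq f"] memL2[OF f] by (simp_all flip: abs_cinner)
    show "rep_lsq (R (abs_lsq (rep_lsq (R (abs_lsq f))))) =\<^sub>a\<^sub>e V f"
      using memL2[OF f] Vl(1,2)[OF f] by (subst abs_eq_iff[symmetric]) (simp_all add: v_R)
  qed
  then have r0: "positive_op (fset_of H) r0 \<and> (\<forall>f\<in>fset_of H. r0 (r0 f) =\<^sub>a\<^sub>e V f)"
    unfolding r0_def op_sqrt_def
    by (rule someI[where P="\<lambda>R. positive_op (fset_of H) R \<and> (\<forall>f\<in>fset_of H. R (R f) =\<^sub>a\<^sub>e V f)"])
  then have r0b: "bounded_op (fset_of H) r0" by (simp add: positive_op_def)
  define r where "r u = abs_lsq (r0 (rep_lsq u))" for u
  note rl = bounded_op_lift[OF r0b, folded r_def]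
  obtain C where C: "\<And>u. u \<in> H \<Longrightarrow> norm (r u) \<le> C * norm u"
    using rl(6) by blast
  \<comment> \<open>The chosen root is compared with \<open>R\<close> only through their squares,
    which both represent the inverse of \<open>S\<close>.\<close>
  have rr: "r (r u) = R (R u)" if u: "u \<in> H" for u
  proof -
    have f: "rep_lsq u \<in> fset_of H" using u by simp
    have r0f: "r0 (rep_lsq u) \<in> fset_of H"
      using rl(1)[OF f] rl(3)[OF u] by (simp add: fset_of_def r_def)
    have "r0 (r0 (rep_lsq u)) =\<^sub>a\<^sub>e V (rep_lsq u)" using r0 f by blast
    then have "abs_lsq (r0 (r0 (rep_lsq u))) = abs_lsq (V (rep_lsq u))"
      using rl(1)[OF r0f] Vl(1)[OF f] by (simp add: abs_eq_iff)
    then show ?thesis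
      using rl(2)[OF r0f] rl(2)[OF f] Vl(2)[OF f] v_R[OF u] by simp
  qed
  show thesis
  proof (rule that)
    show "lsq_inverse_sqrt P H A B (\<lambda>k. abs_lsq (\<psi> k)) r C"
    proof unfold_locales
      fix u assume u: "u \<in> H"
      have "l2_inner (r0 (rep_lsq u)) (rep_lsq u) = cinner (r u) u"
        using rl(1)[of "rep_lsq u"] u abs_cinner[of "r0 (rep_lsq u)" "rep_lsq u"] by (simp add: r_def)
      then show "0 \<le> Re (cinner (r u) u)" "Im (cinner (r u) u) = 0"
        using r0 u unfolding positive_op_def by (metis fset_of_rep)+
      show "r (r (S u)) = u" "S (r (r u)) = u"
        using u by (simp_all add: rr R)
    qed (use rl C in simp_all)
    fix k
    have f: "\<psi> k \<in> fset_of H" using \<psi> psi_H[of k] by (simp add: fset_of_def)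
    show "canonical_tight_frame (fset_of H) \<psi> k \<in> L2"
      "abs_lsq (canonical_tight_frame (fset_of H) \<psi> k) = r (abs_lsq (\<psi> k))"
      unfolding canonical_tight_frame_def r0_def[unfolded V_def, symmetric]
      using rl(1,2)[OF f] by simp_all
  qed
qed

section \<open>Shifted frames of exponentials\<close>

lemma Finv_cscale: "Finv (cscale a u) = cscale a (Finv u)"
  by (metis Fop_Finv Fop_cscale Finv_Fop)

lemma Finv_add: "Finv (u + v) = Finv u + Finv v"
  by (metis Fop_Finv Fop_add Finv_Fop)

lemma norm_Finv [simp]: "norm (Finv u) = norm u"
  by (simp add: Finv_def)

lemma cinner_Finv_left: "cinner (Finv u) v = cinner u (Fop v)"
  using cinner_Finv_right[of v u] by (metis cinner_commute)

lemma bdd_mult_cnj: "bdd_mult m C \<Longrightarrow> bdd_mult (\<lambda>x. cnj (m x)) C"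
  by (auto simp: bdd_mult_def intro: borel_measurable_cnj)

lemma bdd_mult_mult:
  assumes "bdd_mult m C" "bdd_mult m' C'" "0 \<le> C"
  shows "bdd_mult (\<lambda>x. m x * m' x) (C * C')"
proof -
  have "AE x in lborel. cmod (m x) \<le> C" "AE x in lborel. cmod (m' x) \<le> C'"
    using assms by (auto simp: bdd_mult_def)
  then have "AE x in lborel. cmod (m x * m' x) \<le> C * C'"
    by eventually_elim (use assms(3) in \<open>simp add: norm_mult mult_mono\<close>)
  then show ?thesis using assms by (auto simp: bdd_mult_def intro: borel_measurable_times)
qed

lemma mulf_mulf_eq:
  assumes "bdd_mult m C" "bdd_mult m' C'" "0 \<le> C" "\<And>x. m x * m' x = k x"
  shows "mulf m (mulf m' u) = mulf k u"
  using mulf_mulf[OF assms(1,2) bdd_mult_mult[OF assms(1-3)]] by (simp add: assms(4))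

text \<open>The coefficients of u against the image frame are those of \<open>M' u\<close> against
  the original one, where \<open>M'\<close> acts as the adjoint of \<open>M\<close>. Two-sided norm
  estimates for \<open>M'\<close> thus enter the frame bounds squared.\<close>

lemma lsq_frame_bounds_transfer:
  assumes fr: "lsq_frame_bounds A B H \<psi>" and c: "0 < c" "0 < c'"
    and M: "\<And>k. M (\<psi> k) \<in> H'" and adj: "\<And>u k. u \<in> H' \<Longrightarrow> cinner u (M (\<psi> k)) = cinner (M' u) (\<psi> k)"
    and M': "\<And>u. u \<in> H' \<Longrightarrow> M' u \<in> H" "\<And>u. u \<in> H' \<Longrightarrow> c * norm u \<le> norm (M' u)"
      "\<And>u. u \<in> H' \<Longrightarrow> norm (M' u) \<le> c' * norm u"
  shows "lsq_frame_bounds (A * c\<^sup>2) (B * c'\<^sup>2) H' (\<lambda>k. M (\<psi> k))"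
  unfolding lsq_frame_bounds_def
proof (intro conjI allI ballI M)
  have AB: "0 < A" "0 < B" using fr by (auto simp: lsq_frame_bounds_def)
  then show "0 < A * c\<^sup>2" "0 < B * c'\<^sup>2" using c by auto
  fix u assume u: "u \<in> H'"
  have eq: "(\<lambda>k. (cmod (cinner u (M (\<psi> k))))\<^sup>2) = (\<lambda>k. (cmod (cinner (M' u) (\<psi> k)))\<^sup>2)"
    by (simp add: adj u)
  have b: "(\<lambda>k. (cmod (cinner (M' u) (\<psi> k)))\<^sup>2) summable_on UNIV"
    "A * (norm (M' u))\<^sup>2 \<le> (\<Sum>\<^sub>\<infinity>k. (cmod (cinner (M' u) (\<psi> k)))\<^sup>2)"
    "(\<Sum>\<^sub>\<infinity>k. (cmod (cinner (M' u) (\<psi> k)))\<^sup>2) \<le> B * (norm (M' u))\<^sup>2"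
    using fr M'(1)[OF u] unfolding lsq_frame_bounds_def by blast+
  show "(\<lambda>k. (cmod (cinner u (M (\<psi> k))))\<^sup>2) summable_on UNIV"
    unfolding eq by (rule b)
  have "(c * norm u)\<^sup>2 \<le> (norm (M' u))\<^sup>2"
    using c by (intro power_mono M' u) auto
  then have "A * (c * norm u)\<^sup>2 \<le> A * (norm (M' u))\<^sup>2"
    using AB by (intro mult_left_mono) auto
  with b(2) show "A * c\<^sup>2 * (norm u)\<^sup>2 \<le> (\<Sum>\<^sub>\<infinity>k. (cmod (cinner u (M (\<psi> k))))\<^sup>2)"
    unfolding eq by (simp add: power_mult_distrib)
  have "(norm (M' u))\<^sup>2 \<le> (c' * norm u)\<^sup>2"
    by (intro power_mono M' u) auto
  then have "B * (norm (M' u))\<^sup>2 \<le> B * (c' * norm u)\<^sup>2"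
    using AB by (intro mult_left_mono) auto
  with b(3) show "(\<Sum>\<^sub>\<infinity>k. (cmod (cinner u (M (\<psi> k))))\<^sup>2) \<le> B * c'\<^sup>2 * (norm u)\<^sup>2"
    unfolding eq by (simp add: power_mult_distrib)
qed

lemma bdd_mult_indicator: "S \<in> sets borel \<Longrightarrow> bdd_mult (indicator S) 1"
  by (auto simp: bdd_mult_def indicator_def)

lemma lsq_projection_indicator:
  assumes S: "S \<in> sets borel"
  shows "lsq_projection (mulf (indicator S)) {u. mulf (indicator S) u = u}"
proof (rule lsq_projection.intro)
  note b = bdd_mult_indicator[OF S]
  show "bounded_linear (mulf (indicator S))" by (rule bounded_linear_mulf[OF b]) simp
  show "mulf (indicator S) (mulf (indicator S) u) = mulf (indicator S) u" for u
    by (rule mulf_mulf_eq[OF b b]) (auto simp: indicator_def)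
  have "(\<lambda>x. cnj (indicator S x)) = indicator S" by (auto simp: indicator_def)
  then show "cinner (mulf (indicator S) u) v = cinner u (mulf (indicator S) v)" for u v
    using cinner_mulf_left[OF b bdd_mult_cnj[OF b]] by simp
qed simp

text \<open>Conjugation by a unitary operator preserves orthogonal projections; the symmetry uses
  that \<open>Finv\<close> is the adjoint of \<open>Fop\<close>.\<close>

lemma lsq_projection_Fourier:
  assumes "lsq_projection P H"
  shows "lsq_projection (\<lambda>u. Finv (P (Fop u))) {u. Finv (P (Fop u)) = u}"
proof -
  interpret lsq_projection P H by fact
  show ?thesis
  proof (rule lsq_projection.intro)
    show "bounded_linear (\<lambda>u. Finv (P (Fop u)))"
      by (rule bounded_linear_intro[where K=1])
        (use norm_P_le[of "Fop _"] in \<open>simp_all add: Fop_add P_add Finv_add scaleR_cscale Fop_cscale P_cscale Finv_cscale\<close>)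
  qed (simp_all add: P_idem cinner_Finv_left cinner_Finv_right P_sym)
qed

lemma L2_on_eq:
  assumes S: "S \<in> sets borel"
  shows "L2_on S = fset_of {u. mulf (indicator S) u = u}"
proof -
  note b = bdd_mult_indicator[OF S]
  have "(AE x in lborel. x \<notin> S \<longrightarrow> f x = 0) \<longleftrightarrow> mulf (indicator S) (abs_lsq f) = abs_lsq f" if "f \<in> L2" for f
  proof -
    have "(x \<notin> S \<longrightarrow> f x = 0) \<longleftrightarrow> indicator S x * f x = f x" for x
      by (auto simp: indicator_def)
    then show ?thesis
      unfolding mulf_abs[OF b that] abs_eq_iff[OF L2_mult[OF b that] that] ae_eq_def by (simp only:)
  qed
  then show ?thesis
    by (auto simp: L2_on_def fset_of_def)
qed

text \<open>Frame bounds refer to squared norms, so an A_e-tight frame has frame operator A_e times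
  the identity, whose inverse square root contributes the factor A_e^(-1/2). The factor 1/A_e of the
  verbal form would agree with the Parseval property on a nonzero span only for A_e = 1.\<close>

theorem theorem5p11:
  fixes E :: "'a::euclidean_space set" and \<phi> :: "'a \<Rightarrow> complex" and \<Phi> :: "'a \<Rightarrow> real"
    and lam :: "int \<Rightarrow> 'a" and p P :: real
    and e_sharp \<theta> :: "int \<Rightarrow> 'a \<Rightarrow> complex" and q :: "'a \<Rightarrow> complex"
  assumes "bounded E"
    and "\<phi> \<in> PW E"
    and "\<Phi> = (\<lambda>w. (cmod (fourier \<phi> w))\<^sup>2)"
    and "is_frame (L2_on (supp (fourier \<phi>))) (expo_family lam (supp (fourier \<phi>)))"
    and "p > 0" and "P > 0"
    and "AE w in lborel. w \<in> supp (fourier \<phi>) \<longrightarrow> p \<le> \<Phi> w \<and> \<Phi> w \<le> P"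
    and "e_sharp = canonical_tight_frame (L2_on (supp (fourier \<phi>)))
                     (expo_family lam (supp (fourier \<phi>)))"
    and "q = (\<lambda>w. if w \<in> supp \<Phi> then fourier \<phi> w / of_real (sqrt (\<Phi> w)) else 0)"
    and "\<theta> = (\<lambda>k. inv_fourier (\<lambda>w. if w \<in> supp \<Phi>
             then fourier \<phi> w / of_real (sqrt (\<Phi> w)) * e_sharp k w else 0))"
  shows "is_parseval_frame (closed_span \<theta>) \<theta> \<and>
         closed_span \<theta> = closed_span (\<lambda>k. translate (lam k) \<phi>) \<and>
         is_frame (closed_span (\<lambda>k. translate (lam k) \<phi>)) (\<lambda>k. translate (lam k) \<phi>) \<and>
         equivalent_frames (closed_span (\<lambda>k. translate (lam k) \<phi>)) \<theta> (\<lambda>k. translate (lam k) \<phi>) \<and>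
         (\<forall>A\<^sub>e. is_tight_frame A\<^sub>e (L2_on (supp (fourier \<phi>))) (expo_family lam (supp (fourier \<phi>))) \<longrightarrow>
            (\<exists>A. is_tight_frame A (closed_span \<theta>) \<theta>) \<and>
            (\<forall>k. \<theta> k =\<^sub>a\<^sub>e translate (lam k) (\<lambda>x. of_real (1 / sqrt A\<^sub>e) * inv_fourier q x)))"
proof -
  have \<phi>: "\<phi> \<in> L2" using assms(2) by (simp add: PW_def)
  define m where "m = fourier \<phi>"
  have mL2: "m \<in> L2" unfolding m_def by (rule fourier_L2[OF \<phi>])
  note [measurable] = L2_measurable[OF mL2]
  define T where "T = supp m"
  have T_iff: "w \<in> T \<longleftrightarrow> m w \<noteq> 0" for w by (simp add: T_def supp_def)
  have Tb [measurable]: "T \<in> sets borel"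
    unfolding T_def supp_def by measurable
  define \<psi> where "\<psi> = expo_family lam T"
  have \<psi>_def': "\<psi> k = (\<lambda>x. expo (lam k) x * indicator T x)" for k
    by (simp add: \<psi>_def expo_family_def fun_eq_iff)
  have \<Phi>: "\<Phi> w = (cmod (m w))\<^sup>2" for w using assms(3) by (simp add: m_def)
  have supp_\<Phi>: "w \<in> supp \<Phi> \<longleftrightarrow> m w \<noteq> 0" for w by (simp add: supp_def \<Phi>)
  have bounds: "AE w in lborel. m w \<noteq> 0 \<longrightarrow> p \<le> (cmod (m w))\<^sup>2 \<and> (cmod (m w))\<^sup>2 \<le> P"
    using assms(7) by (simp add: m_def[symmetric] supp_def \<Phi>)
  \<comment> \<open>The convention \<open>inverse 0 = 0\<close> makes \<open>g\<close> vanish off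
    \<open>T\<close>, so it is a pseudo-inverse of the multiplier \<open>m\<close>.\<close>
  define g where "g w = inverse (m w)" for w
  \<comment> \<open>The square root of \<open>\<Phi>\<close> is the modulus of \<open>m\<close>, so
    \<open>q\<close> is the phase of \<open>m\<close>; division by zero returns 0, in agreement with
    the convention off the support.\<close>
  have q: "q w = m w / of_real (cmod (m w))" for w
    using assms(9) by (simp add: m_def[symmetric] supp_\<Phi> \<Phi>)
  have [measurable]: "g \<in> borel_measurable borel" "q \<in> borel_measurable borel"
    unfolding g_def[abs_def] q[abs_def] by measurable
  have bm: "bdd_mult m (sqrt P)"
    unfolding bdd_mult_def
  proof
    show "AE w in lborel. cmod (m w) \<le> sqrt P"
      using bounds by eventually_elim (use assms(6) in \<open>auto intro: real_le_rsqrt\<close>)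
  qed measurable
  have bg: "bdd_mult g (1 / sqrt p)"
    unfolding bdd_mult_def
  proof
    show "AE w in lborel. cmod (g w) \<le> 1 / sqrt p"
      using bounds
    proof eventually_elim
      case (elim w)
      show ?case
      proof (cases "m w = 0")
        case False
        then have "sqrt p \<le> cmod (m w)" using elim by (intro real_le_lsqrt) auto
        then show ?thesis
          using assms(5) False by (simp add: g_def norm_divide inverse_eq_divide frac_le)
      qed (use assms(5) in \<open>simp add: g_def\<close>)
    qed
  qed measurable
  have bq: "bdd_mult q 1"
    unfolding bdd_mult_def by (auto simp: q norm_divide)
  let ?P = "mulf (indicator T) :: 'a lsq \<Rightarrow> 'a lsq"
  define H where "H = {u. ?P u = u}"
  have bT: "bdd_mult (indicator T) 1" by (rule bdd_mult_indicator[OF Tb])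
  interpret H: lsq_projection ?P H
    unfolding H_def by (rule lsq_projection_indicator[OF Tb])
  have L2_on: "L2_on T = fset_of H"
    unfolding H_def by (rule L2_on_eq[OF Tb])
  have frame: "is_frame (fset_of H) \<psi>"
    using assms(4) by (simp add: m_def[symmetric] T_def[symmetric] \<psi>_def[symmetric] L2_on)
  then obtain A B where "frame_with_bounds A B (fset_of H) \<psi>" by (auto simp: is_frame_def)
  then have \<psi>L2: "\<And>k. \<psi> k \<in> L2" and fr: "lsq_frame_bounds A B H (\<lambda>k. abs_lsq (\<psi> k))"
    by (auto simp: frame_with_bounds_iff)
  have lf: "lsq_frame ?P H A B (\<lambda>k. abs_lsq (\<psi> k))"
    by unfold_locales (rule fr)
  obtain r C where "lsq_inverse_sqrt ?P H A B (\<lambda>k. abs_lsq (\<psi> k)) r C"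
    and es: "\<And>k. e_sharp k \<in> L2" "\<And>k. abs_lsq (e_sharp k) = r (abs_lsq (\<psi> k))"
    using canonical_tight_frame_lsq[OF lf \<psi>L2] assms(8)
    unfolding m_def[symmetric] T_def[symmetric] \<psi>_def[symmetric] L2_on by blast
  then interpret R: lsq_inverse_sqrt ?P H A B "\<lambda>k. abs_lsq (\<psi> k)" r C by blast
  have into_H: "mulf n u \<in> H" if n: "bdd_mult n c" "\<And>w. m w = 0 \<Longrightarrow> n w = 0" for n c u
    unfolding H_def mem_Collect_eq
    by (rule mulf_mulf_eq[OF bT n(1)]) (auto simp: indicator_def T_iff n(2))
  \<comment> \<open>Multipliers reciprocal on \<open>T\<close>, the outer one vanishing elsewhere,
    compose to the indicator of \<open>T\<close>, which is the identity on \<open>H\<close>.\<close>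
  have inv: "mulf n (mulf n' u) = u" if "bdd_mult n c" "bdd_mult n' c'" "0 \<le> c"
    "\<And>w. m w \<noteq> 0 \<Longrightarrow> n w * n' w = 1" "\<And>w. m w = 0 \<Longrightarrow> n w = 0" and u: "u \<in> H" for n c n' c' u
  proof -
    have "mulf n (mulf n' u) = ?P u"
      by (rule mulf_mulf_eq[OF that(1-3)]) (use that(4,5) in \<open>auto simp: indicator_def T_iff\<close>)
    then show ?thesis by (simp add: H.H_P u)
  qed
  let ?m' = "\<lambda>w. cnj (m w)" and ?q' = "\<lambda>w. cnj (q w)" and ?g' = "\<lambda>w. cnj (g w)"
  note bm' = bdd_mult_cnj[OF bm] and bq' = bdd_mult_cnj[OF bq] and bg' = bdd_mult_cnj[OF bg]
  have sP: "0 \<le> sqrt P" "0 \<le> 1 / sqrt p" using assms(5,6) by auto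
  have zero: "m w = 0 \<Longrightarrow> q w = 0" "m w = 0 \<Longrightarrow> g w = 0" for w
    by (simp_all add: q g_def)
  have qq: "m w \<noteq> 0 \<Longrightarrow> q w * ?q' w = 1" for w
    by (simp add: q complex_norm_square[symmetric] power2_eq_square[symmetric] divide_simps
        flip: of_real_power)
  have qq': "m w \<noteq> 0 \<Longrightarrow> ?q' w * q w = 1" for w
    using qq[of w] by (simp add: mult.commute)
  have gm: "m w \<noteq> 0 \<Longrightarrow> g w * m w = 1" "m w \<noteq> 0 \<Longrightarrow> m w * g w = 1" for w
    by (simp_all add: g_def)
  have gm': "m w \<noteq> 0 \<Longrightarrow> ?g' w * ?m' w = 1" for w
    by (simp add: g_def)
  \<comment> \<open>The functions whose transform is concentrated on \<open>T\<close>, that is, the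
    preimage of \<open>H\<close> under the Fourier transform. This turns out to be the closed span
    of both families.\<close>
  define W where "W = {u. Finv (?P (Fop u)) = u}"
  interpret W: lsq_projection "\<lambda>u. Finv (?P (Fop u))" W
    unfolding W_def by (rule lsq_projection_Fourier[OF H.lsq_projection_axioms])
  have W_iff: "u \<in> W \<longleftrightarrow> Fop u \<in> H" for u
    unfolding W_def H_def mem_Collect_eq by (metis Finv_Fop Fop_Finv)
  have Finv_W: "Finv u \<in> W \<longleftrightarrow> u \<in> H" for u by (simp add: W_iff)

  have \<theta>: "\<theta> k \<in> L2" "abs_lsq (\<theta> k) = Finv (mulf q (r (abs_lsq (\<psi> k))))" for k
  proof -
    have "\<theta> k = inv_fourier (\<lambda>w. q w * e_sharp k w)"
      unfolding assms(10) m_def[symmetric] by (rule arg_cong[of _ _ inv_fourier]) (auto simp: supp_\<Phi> \<Phi> q)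
    then show "\<theta> k \<in> L2" "abs_lsq (\<theta> k) = Finv (mulf q (r (abs_lsq (\<psi> k))))"
      using inv_fourier[OF L2_mult[OF bq es(1)[of k]]] by (simp_all add: mulf_abs[OF bq es(1)] flip: es(2))
  qed
  have tr: "translate l f = (\<lambda>x. f (- l + x))" for l and f :: "'a \<Rightarrow> complex"
    by (simp add: translate_def fun_eq_iff)
  define \<tau> where "\<tau> k = translate (lam k) \<phi>" for k
  have \<tau>: "\<tau> k \<in> L2" "abs_lsq (\<tau> k) = Finv (mulf m (abs_lsq (\<psi> k)))" for k
  proof -
    show "\<tau> k \<in> L2" unfolding \<tau>_def tr by (rule L2_shift[OF \<phi>])
    have "Fop (abs_lsq (\<tau> k)) = mulf (expo (lam k)) (abs_lsq m)"
      unfolding \<tau>_def tr abs_shift[OF \<phi>, symmetric] Fop_shift Fop_abs[OF \<phi>] m_def ..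
    also have "\<dots> = mulf m (abs_lsq (\<psi> k))"
      unfolding mulf_abs[OF bdd_mult_expo mL2] mulf_abs[OF bm \<psi>L2]
      by (rule arg_cong[of _ _ abs_lsq]) (auto simp: \<psi>_def' fun_eq_iff indicator_def T_iff)
    finally show "abs_lsq (\<tau> k) = Finv (mulf m (abs_lsq (\<psi> k)))" by (metis Finv_Fop)
  qed

  have \<theta>_frame: "lsq_frame_bounds 1 1 W (\<lambda>k. abs_lsq (\<theta> k))"
  proof -
    have "lsq_frame_bounds (1 * 1\<^sup>2) (1 * 1\<^sup>2) W (\<lambda>k. Finv (mulf q (r (abs_lsq (\<psi> k)))))"
    \<comment> \<open>The adjoint multiplies by the conjugate phase, which is an isometry on
      \<open>H\<close>; both Parseval bounds therefore stay equal to 1.\<close>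
    proof (rule lsq_frame_bounds_transfer[OF R.parseval, where M="\<lambda>u. Finv (mulf q u)" and M'="\<lambda>u. mulf ?q' (Fop u)"])
      show "Finv (mulf q (r (abs_lsq (\<psi> k)))) \<in> W" for k
        unfolding Finv_W by (rule into_H[OF bq zero(1)])
      fix u assume u: "u \<in> W"
      show "cinner u (Finv (mulf q (r (abs_lsq (\<psi> k))))) = cinner (mulf ?q' (Fop u)) (r (abs_lsq (\<psi> k)))" for k
        using cinner_mulf_left[OF bq', of 1] bq by (simp add: cinner_Finv_right)
      show "mulf ?q' (Fop u) \<in> H" by (rule into_H[OF bq']) (simp add: zero)
      show "norm (mulf ?q' (Fop u)) \<le> 1 * norm u"
        using norm_mulf_le[OF bq', of "Fop u"] by simp
      have "mulf q (mulf ?q' (Fop u)) = Fop u"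
        by (rule inv[OF bq bq']) (use u W_iff zero qq in auto)
      then show "1 * norm u \<le> norm (mulf ?q' (Fop u))"
        using norm_mulf_le[OF bq, of "mulf ?q' (Fop u)"] by simp
    qed simp_all
    then show ?thesis by (simp add: \<theta>)
  qed
  have \<tau>_frame: "lsq_frame_bounds (A * (sqrt p)\<^sup>2) (B * (sqrt P)\<^sup>2) W (\<lambda>k. abs_lsq (\<tau> k))"
    unfolding \<tau>(2)
  proof (rule lsq_frame_bounds_transfer[OF fr, where M="\<lambda>u. Finv (mulf m u)" and M'="\<lambda>u. mulf ?m' (Fop u)"])
    show "Finv (mulf m (abs_lsq (\<psi> k))) \<in> W" for k
      unfolding Finv_W by (rule into_H[OF bm])
    fix u assume u: "u \<in> W"
    show "cinner u (Finv (mulf m (abs_lsq (\<psi> k)))) = cinner (mulf ?m' (Fop u)) (abs_lsq (\<psi> k))" for k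
      using cinner_mulf_left[OF bm', of "sqrt P"] bm by (simp add: cinner_Finv_right)
    show "mulf ?m' (Fop u) \<in> H" by (rule into_H[OF bm']) simp
    show "norm (mulf ?m' (Fop u)) \<le> sqrt P * norm u"
      using norm_mulf_le[OF bm' sP(1), of "Fop u"] by simp
    \<comment> \<open>The lower estimate comes from the norm bound \<open>1 / sqrt p\<close> of the
      inverse multiplier.\<close>
    have "mulf ?g' (mulf ?m' (Fop u)) = Fop u"
      by (rule inv[OF bg' bm' sP(2)]) (use u W_iff zero gm' in auto)
    then have "norm u \<le> (1 / sqrt p) * norm (mulf ?m' (Fop u))"
      using norm_mulf_le[OF bg' sP(2), of "mulf ?m' (Fop u)"] by simp
    then show "sqrt p * norm u \<le> norm (mulf ?m' (Fop u))"
      using assms(5) by (simp add: field_simps)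
  qed (use assms(5,6) in auto)

  have \<theta>_lf: "lsq_frame (\<lambda>u. Finv (?P (Fop u))) W 1 1 (\<lambda>k. abs_lsq (\<theta> k))"
    by unfold_locales (rule \<theta>_frame)
  have \<tau>_lf: "lsq_frame (\<lambda>u. Finv (?P (Fop u))) W (A * (sqrt p)\<^sup>2) (B * (sqrt P)\<^sup>2) (\<lambda>k. abs_lsq (\<tau> k))"
    by unfold_locales (rule \<tau>_frame)
  have span_\<theta>: "closed_span \<theta> = fset_of W"
    using closed_span_eq[of \<theta>] \<theta>(1) lsq_frame.cspan_frame[OF \<theta>_lf] by simp
  have span_\<tau>: "closed_span \<tau> = fset_of W"
    using closed_span_eq[of \<tau>] \<tau>(1) lsq_frame.cspan_frame[OF \<tau>_lf] by simp
  have parseval: "frame_with_bounds 1 1 (fset_of W) \<theta>"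
    using \<theta>_frame \<theta>(1) by (simp add: frame_with_bounds_iff)
  have frame_\<tau>: "is_frame (fset_of W) \<tau>"
    using \<tau>_frame \<tau>(1) unfolding is_frame_def frame_with_bounds_iff by blast

  \<comment> \<open>On transforms, \<open>U\<close> removes the phase \<open>q\<close>, undoes
    \<open>r\<close> by \<open>S r\<close>, which is inverse to \<open>r\<close> on
    \<open>H\<close>, and multiplies by \<open>m\<close>. \<open>V\<close> retraces these
    operations, with \<open>g\<close> undoing \<open>m\<close>.\<close>
  define U where "U u = Finv (mulf m (R.S (r (mulf ?q' (Fop u)))))" for u
  define V where "V u = Finv (mulf q (r (mulf g (Fop u))))" for u
  have q'_H [simp]: "mulf ?q' u \<in> H" for u by (rule into_H[OF bq']) (simp add: zero)
  have g_H [simp]: "mulf g u \<in> H" for u by (rule into_H[OF bg]) (simp add: zero)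
  have U_W: "U u \<in> W" and V_W: "V u \<in> W" for u
    unfolding U_def V_def Finv_W by (rule into_H[OF bm], simp, rule into_H[OF bq], simp add: zero)
  have C: "norm (r u) \<le> \<bar>C\<bar> * norm u" if "u \<in> H" for u
    using R.r_bound[OF that] mult_right_mono[OF abs_ge_self[of C] norm_ge_zero[of u]] by linarith
  have U_op: "bounded_op (fset_of W) (\<lambda>f. rep_lsq (U (abs_lsq f)))"
  proof (rule W.bounded_op_rep[where C="sqrt P * (B * (\<bar>C\<bar> * 1))"])
    fix u
    have "norm (U u) \<le> sqrt P * norm (R.S (r (mulf ?q' (Fop u))))"
      unfolding U_def norm_Finv by (rule norm_mulf_le[OF bm sP(1)])
    also have "\<dots> \<le> sqrt P * (B * norm (r (mulf ?q' (Fop u))))"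
      by (intro mult_left_mono R.norm_S_le sP)
    also have "\<dots> \<le> sqrt P * (B * (\<bar>C\<bar> * norm (mulf ?q' (Fop u))))"
      using R.B_pos by (intro mult_left_mono C sP) auto
    also have "\<dots> \<le> sqrt P * (B * (\<bar>C\<bar> * (1 * norm (Fop u))))"
      using R.B_pos by (intro mult_left_mono norm_mulf_le[OF bq'] sP) auto
    finally show "norm (U u) \<le> sqrt P * (B * (\<bar>C\<bar> * 1)) * norm u" by (simp add: mult_ac)
  qed (simp_all add: U_W, simp_all add: U_def Fop_add Fop_cscale mulf_add[OF bq'] mulf_cscale[OF bq']
      R.r_add R.r_cscale R.S_add R.S_cscale mulf_add[OF bm] mulf_cscale[OF bm] Finv_add Finv_cscale)
  have V_op: "bounded_op (fset_of W) (\<lambda>f. rep_lsq (V (abs_lsq f)))"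
  proof (rule W.bounded_op_rep[where C="1 * (\<bar>C\<bar> * (1 / sqrt p))"])
    fix u
    have "norm (V u) \<le> 1 * norm (r (mulf g (Fop u)))"
      unfolding V_def norm_Finv by (rule norm_mulf_le[OF bq]) simp
    also have "\<dots> \<le> 1 * (\<bar>C\<bar> * norm (mulf g (Fop u)))"
      by (intro mult_left_mono C) auto
    also have "\<dots> \<le> 1 * (\<bar>C\<bar> * ((1 / sqrt p) * norm (Fop u)))"
      by (intro mult_left_mono norm_mulf_le[OF bg] sP) auto
    finally show "norm (V u) \<le> 1 * (\<bar>C\<bar> * (1 / sqrt p)) * norm u" by (simp add: mult_ac)
  qed (simp_all add: V_W, simp_all add: V_def Fop_add Fop_cscale mulf_add[OF bg] mulf_cscale[OF bg]
      R.r_add R.r_cscale mulf_add[OF bq] mulf_cscale[OF bq] Finv_add Finv_cscale)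
  have VU: "V (U u) = u" and UV: "U (V u) = u" if u: "u \<in> W" for u
  proof -
    have FH: "Fop u \<in> H" using u by (simp add: W_iff)
    have 1: "mulf g (mulf m v) = v" "mulf m (mulf g v) = v" "mulf q (mulf ?q' v) = v" "mulf ?q' (mulf q v) = v"
      if "v \<in> H" for v
      using inv[OF bg bm sP(2) gm(1) zero(2) that] inv[OF bm bg sP(1) gm(2) _ that]
        inv[OF bq bq' _ qq zero(1) that] inv[OF bq' bq _ qq' _ that] zero by simp_all
    show "V (U u) = u"
      by (simp add: U_def V_def 1 FH R.r_S_r)
    show "U (V u) = u"
      by (simp add: U_def V_def 1 FH R.S_r_r)
  qed
  have equiv: "equivalent_frames (fset_of W) \<theta> \<tau>"
    unfolding equivalent_frames_def
  proof (intro conjI exI allI)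
    show "is_frame (fset_of W) \<theta>" using parseval by (auto simp: is_frame_def)
    show "is_frame (fset_of W) \<tau>" by (rule frame_\<tau>)
    show "bounded_op (fset_of W) (\<lambda>f. rep_lsq (U (abs_lsq f)))" by (rule U_op)
    show "is_op_inverse (fset_of W) (\<lambda>f. rep_lsq (U (abs_lsq f))) (\<lambda>f. rep_lsq (V (abs_lsq f)))"
      unfolding is_op_inverse_def
      by (intro conjI V_op ballI) (simp_all add: fset_of_def abs_eq_iff[symmetric] VU UV)
    fix k
    have "mulf ?q' (mulf q (r (abs_lsq (\<psi> k)))) = r (abs_lsq (\<psi> k))"
      by (rule inv[OF bq' bq _ qq']) (simp_all add: zero)
    then have "U (abs_lsq (\<theta> k)) = abs_lsq (\<tau> k)"
      by (simp add: U_def \<theta> \<tau> R.S_r_r)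
    then show "rep_lsq (U (abs_lsq (\<theta> k))) =\<^sub>a\<^sub>e \<tau> k"
      by (simp add: abs_eq_iff[symmetric] \<tau>(1))
  qed

  have tight: "\<theta> k =\<^sub>a\<^sub>e translate (lam k) (\<lambda>x. of_real (1 / sqrt a) * inv_fourier q x)"
    if a: "is_tight_frame a (fset_of H) \<psi>" for a k
  proof -
    define s where "s = complex_of_real (1 / sqrt a)"
    have "lsq_frame_bounds a a H (\<lambda>k. abs_lsq (\<psi> k))"
      using a by (simp add: is_tight_frame_def frame_with_bounds_iff)
    then have r: "r (abs_lsq (\<psi> k)) = cscale s (abs_lsq (\<psi> k))"
      unfolding s_def by (rule R.tight_r) simp
    \<comment> \<open>On the support \<open>q\<close> has modulus 1 while m has modulus at least
      \<open>sqrt p\<close> almost everywhere, so \<open>m\<close> dominates \<open>q\<close>; this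
      makes the inverse transform of \<open>q\<close> meaningful.\<close>
    have qL2: "q \<in> L2"
    proof (rule L2_bound[OF mL2, where C="1 / sqrt p"])
      show "AE w in lborel. cmod (q w) \<le> 1 / sqrt p * cmod (m w)"
        using bounds
      proof eventually_elim
        case (elim w)
        show ?case
        proof (cases "m w = 0")
          case False
          then have "sqrt p \<le> cmod (m w)" using elim by (intro real_le_lsqrt) auto
          then show ?thesis
            using assms(5) False by (simp add: q norm_divide field_simps)
        qed (simp add: q)
      qed
    qed measurable
    note qi = inv_fourier[OF qL2]
    have "Fop (abs_lsq (\<theta> k)) = cscale s (mulf q (abs_lsq (\<psi> k)))"
      by (simp add: \<theta> r mulf_cscale[OF bq])
    \<comment> \<open>The indicator in the exponential is absorbed because \<open>q\<close> vanishes
      off \<open>T\<close>.\<close>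
    also have "mulf q (abs_lsq (\<psi> k)) = mulf (expo (lam k)) (abs_lsq q)"
      unfolding mulf_abs[OF bdd_mult_expo qL2] mulf_abs[OF bq \<psi>L2]
      by (rule arg_cong[of _ _ abs_lsq]) (auto simp: \<psi>_def' fun_eq_iff indicator_def T_iff zero)
    also have "\<dots> = Fop (shift (- lam k) (abs_lsq (inv_fourier q)))"
      by (simp add: Fop_shift qi)
    finally have "Fop (abs_lsq (\<theta> k)) = Fop (cscale s (shift (- lam k) (abs_lsq (inv_fourier q))))"
      by (simp add: Fop_cscale)
    then have "abs_lsq (\<theta> k) = cscale s (shift (- lam k) (abs_lsq (inv_fourier q)))"
      by (metis Finv_Fop)
    also have "\<dots> = abs_lsq (translate (lam k) (\<lambda>x. s * inv_fourier q x))"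
      unfolding tr abs_shift[OF qi(1)] by (rule abs_cscale[OF L2_shift[OF qi(1)]])
    finally have "\<theta> k =\<^sub>a\<^sub>e translate (lam k) (\<lambda>x. s * inv_fourier q x)"
      unfolding tr by (subst (asm) abs_eq_iff[OF \<theta>(1) L2_cmult[OF L2_shift[OF qi(1)]]])
    then show ?thesis by (simp add: s_def)
  qed
  \<comment> \<open>The tightness constant of the new family is 1, whatever the constant of the
    exponentials.\<close>
  have "is_tight_frame 1 (fset_of W) \<theta>"
    using parseval by (simp add: is_tight_frame_def)
  then show ?thesis
    using parseval equiv frame_\<tau> tight
    unfolding \<tau>_def[abs_def, symmetric] span_\<theta> span_\<tau> m_def[symmetric] T_def[symmetric] \<psi>_def[symmetric] L2_on
      is_parseval_frame_def
    by blast
qed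

end
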